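(* Let $K:(0,\infty)\times(0,\infty)\to\mathbb{R}$ be a measurable function for which there is $\kappa>0$ such that $$0\le K(x,y)=K(y,x)\le \kappa(1+x)(1+y),\qquad (x,y)\in(0,\infty)\times(0,\infty),$$ and such that, for every $R>0$, $$\omega_R(y):=\sup_{x\in(0,R)}\frac{K(x,y)}{y}\longrightarrow 0\quad\text{as } y\to\infty .$$ Let $f^{in}\in L^1_1(0,\infty)$ with $f^{in}\ge 0$ a.e. in $(0,\infty)$. Then there is a non-negative function $$f\in C([0,\infty);L^1(0,\infty))\cap L^\infty(0,\infty;L^1_1(0,\infty))$$ such that $$\int_0^\infty \vartheta(x)\left(f(t,x)-f^{in}(x)\right)dx=\frac12\int_0^t\int_0^\infty\int_0^\infty \tilde\vartheta(x,y)K(x,y)f(s,x)f(s,y)\,dy\,dx\,ds$$ for all $t>0$ and all $\vartheta\in L^\infty(0,\infty)$, and $$M_0(f(t))\le M_0(f^{in})\quad\text{and}\quad M_1(f(t))\le M_1(f^{in}),\qquad t\ge 0 .$$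
   Context: For $\mu\in\mathbb{R}$, $L^1_\mu(0,\infty):=\{g\in L^1(0,\infty): \|g\|_{1,\mu}:=\int_0^\infty(1+x^\mu)|g(x)|\,dx<\infty\}$ and $M_\mu(g):=\int_0^\infty x^\mu g(x)\,dx$ for $g\in L^1_\mu(0,\infty)$. For $\vartheta\in L^\infty(0,\infty)$, $\tilde\vartheta(x,y):=\vartheta(x+y)-\vartheta(x)-\vartheta(y)$. (The displayed identity is the weak formulation of Smoluchowski's coagulation equation $\partial_t f(t,x)=\frac12\int_0^x K(y,x-y)f(t,y)f(t,x-y)\,dy-\int_0^\infty K(x,y)f(t,x)f(t,y)\,dy$ with $f(0)=f^{in}$.) *)

theory Defs
  imports "HOL-Analysis.Analysis"
begin

text \<open>
  Elements of Lebesgue spaces on $(0,\infty)$ are represented by functions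
  (not by classes modulo a.e. equality); only their values on $(0,\infty)$ matter.
\<close>

abbreviation half_line :: "real measure" where
  "half_line \<equiv> lebesgue_on {0<..}"

definition norm1 :: "real \<Rightarrow> (real \<Rightarrow> real) \<Rightarrow> real" where
  "norm1 \<mu> g = (LINT x|half_line. (1 + x powr \<mu>) * \<bar>g x\<bar>)"

definition L1 :: "(real \<Rightarrow> real) set" where
  "L1 = {g. integrable half_line g}"

text \<open>The second conjunct is finiteness of \<open>norm1 \<mu> g\<close>.\<close>

definition L1w :: "real \<Rightarrow> (real \<Rightarrow> real) set" where
  "L1w \<mu> = {g \<in> L1. integrable half_line (\<lambda>x. (1 + x powr \<mu>) * \<bar>g x\<bar>)}"

definition moment :: "real \<Rightarrow> (real \<Rightarrow> real) \<Rightarrow> real" where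
  "moment \<mu> g = (LINT x|half_line. x powr \<mu> * g x)"

definition Linf :: "(real \<Rightarrow> real) set" where
  "Linf = {\<theta> \<in> borel_measurable half_line. \<exists>C. AE x in half_line. \<bar>\<theta> x\<bar> \<le> C}"

definition tilde :: "(real \<Rightarrow> real) \<Rightarrow> real \<Rightarrow> real \<Rightarrow> real" where
  "tilde \<theta> x y = \<theta> (x + y) - \<theta> x - \<theta> y"

definition omega :: "(real \<Rightarrow> real \<Rightarrow> real) \<Rightarrow> real \<Rightarrow> real \<Rightarrow> real" where
  "omega K R y = (SUP x\<in>{0<..<R}. K x y / y)"

definition C_L1 :: "(real \<Rightarrow> real \<Rightarrow> real) set" where
  "C_L1 = {f. (\<forall>t\<ge>0. f t \<in> L1) \<and>
     (\<forall>t\<ge>0. ((\<lambda>s. LINT x|half_line. \<bar>f s x - f t x\<bar>) \<longlongrightarrow> 0) (at t within {0..}))}"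

text \<open>
  The Bochner space $L^\infty(0,\infty;L^1_\mu(0,\infty))$: strong measurability
  (a.e. limit, in the norm of $L^1_\mu$, of simple functions with values in $L^1_\mu$)
  and essential boundedness of the norm.
\<close>

definition Linf_L1w :: "real \<Rightarrow> (real \<Rightarrow> real \<Rightarrow> real) set" where
  "Linf_L1w \<mu> = {f.
     (AE t in half_line. f t \<in> L1w \<mu>) \<and>
     (\<exists>u :: nat \<Rightarrow> real \<Rightarrow> real \<Rightarrow> real.
        (\<forall>n. simple_function half_line (u n) \<and> (\<forall>t>0. u n t \<in> L1w \<mu>)) \<and>
        (AE t in half_line. (\<lambda>n. norm1 \<mu> (\<lambda>x. u n t x - f t x)) \<longlonglongrightarrow> 0)) \<and>
     (\<exists>C. AE t in half_line. norm1 \<mu> (f t) \<le> C)}"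

end

theory Submission
  imports Defs "HOL-Library.Diagonal_Subsequence"
begin

text \<open>
  The solution is a weak limit of discrete approximations, and the whole difficulty is to obtain
  enough compactness in \<open>L\<^sup>1\<close> and to control the interaction with very large clusters.

  For the kernel cut off at size \<open>n\<close>, which is bounded, the explicit Euler scheme with a step small
  compared with the inverse of that bound keeps densities non-negative; testing it with \<open>1\<close> and with
  \<open>x\<close> shows that it does not increase the number of clusters and that it conserves their mass. Since
  \<open>K\<close> grows at most like \<open>(1 + x) * (1 + y)\<close>, these two moments bound the coagulation operator in
  \<open>L\<^sup>1\<close>, so the approximations are Lipschitz in time up to one step (\<open>approx_lipschitz\<close>).

  Compactness in \<open>L\<^sup>1\<close> comes from a pointwise bound. The gain of clusters smaller than \<open>R\<close> only
  involves pairs smaller than \<open>R\<close>, for which \<open>K\<close> is bounded by some \<open>c\<close>; dropping the loss, the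
  approximations up to time \<open>T\<close> lie there below every non-negative solution of \<open>U = u + q * (U \<star> U)\<close>, where \<open>\<star>\<close> is the
  convolution and \<open>q = c * T\<close>. The Laplace transform turns this into a quadratic equation for a number,
  which is solvable once the weight \<open>exp (- l * x)\<close> makes the transform of \<open>u\<close> small. Hence on each
  bounded range of sizes and times all approximations lie below one integrable function
  (\<open>approx_dominated\<close>).

  A sequence dominated in this way, with bounded first moment, has masses that are uniformly countably
  additive. So if the masses of the half-lines with rational end point converge, those of all Borel
  sets do, the limit is a measure with a density, and integrals against all test functions of
  sublinear growth converge (\<open>limit_density\<close>). A diagonal argument over rational times and end points,
  together with the Lipschitz bound, gives one subsequence that works for all times
  (\<open>ex_weak_limit\<close>).

  The assumption on \<open>omega\<close> says that \<open>K x y\<close> is sublinear in \<open>y\<close> for fixed \<open>x\<close>, so the inner integral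
  of the quadratic term converges pointwise in \<open>x\<close>. If the test function vanishes beyond some size,
  the outer integral can be restricted to bounded \<open>x\<close>, where domination upgrades this to convergence
  of the quadratic term (\<open>bilinear_limit\<close>). General bounded test functions are reached afterwards, by
  cutting them off and using dominated convergence for the limit density alone. This order matters:
  pairs of two large clusters are not negligible uniformly in the approximation, and mass may escape
  to infinity, which is why the first moment satisfies only an inequality.

  Up to the last section, kernels and densities are Borel functions that vanish at non-positive sizes;
  the last section transfers the result to Lebesgue measurable data and to the function spaces of the
  theorem.
\<close>

section \<open>Limits by approximation\<close>

lemma LIMSEQ_approx:
  fixes u :: "nat \<Rightarrow> real"
  assumes "\<And>e. e > 0 \<Longrightarrow> \<exists>w l'. w \<longlonglongrightarrow> l' \<and> \<bar>l - l'\<bar> \<le> e \<and> (\<forall>\<^sub>F n in sequentially. \<bar>u n - w n\<bar> \<le> e)"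
  shows "u \<longlonglongrightarrow> l"
proof (rule LIMSEQ_I)
  fix r :: real assume "r > 0"
  then obtain w l' where w: "w \<longlonglongrightarrow> l'" "\<bar>l - l'\<bar> \<le> r/4" and ev: "\<forall>\<^sub>F n in sequentially. \<bar>u n - w n\<bar> \<le> r/4"
    using assms[of "r/4"] by auto
  have "\<forall>\<^sub>F n in sequentially. \<bar>w n - l'\<bar> < r/4"
    using w(1) \<open>r > 0\<close> tendstoD[OF w(1), of "r/4"] by (simp add: dist_real_def)
  with ev have "\<forall>\<^sub>F n in sequentially. norm (u n - l) < r"
  proof eventually_elim
    case (elim n)
    have "\<bar>u n - l\<bar> \<le> \<bar>u n - w n\<bar> + \<bar>w n - l'\<bar> + \<bar>l - l'\<bar>" by linarith
    with elim w(2) \<open>r > 0\<close> show ?case unfolding real_norm_def by linarith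
  qed
  then show "\<exists>no. \<forall>n\<ge>no. norm (u n - l) < r" by (simp add: eventually_sequentially)
qed

lemma convergent_approx:
  fixes u :: "nat \<Rightarrow> real"
  assumes "\<And>e. e > 0 \<Longrightarrow> \<exists>w. convergent w \<and> (\<forall>\<^sub>F n in sequentially. \<bar>u n - w n\<bar> \<le> e)"
  shows "convergent u"
proof -
  have "Cauchy u"
  proof (rule CauchyI')
    fix r :: real assume "r > 0"
    then obtain w where w: "convergent w" and ev: "\<forall>\<^sub>F n in sequentially. \<bar>u n - w n\<bar> \<le> r/4"
      using assms[of "r/4"] by auto
    from w have "Cauchy w" by (simp add: Cauchy_convergent_iff)
    then obtain M where M: "\<And>m n. m \<ge> M \<Longrightarrow> n \<ge> M \<Longrightarrow> \<bar>w m - w n\<bar> < r/4"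
      using \<open>r > 0\<close> CauchyD[of w "r/4"] by auto
    from ev obtain N where N: "\<And>n. n \<ge> N \<Longrightarrow> \<bar>u n - w n\<bar> \<le> r/4"
      by (auto simp: eventually_sequentially)
    show "\<exists>M. \<forall>m\<ge>M. \<forall>n>m. dist (u m) (u n) < r"
    proof (intro exI[of _ "max M N"] allI impI)
      fix m n assume "max M N \<le> m" "m < n"
      then have "\<bar>w m - w n\<bar> < r/4" "\<bar>u m - w m\<bar> \<le> r/4" "\<bar>u n - w n\<bar> \<le> r/4"
        using M[of m n] N[of m] N[of n] by auto
      moreover have "\<bar>u m - u n\<bar> \<le> \<bar>u m - w m\<bar> + \<bar>w m - w n\<bar> + \<bar>u n - w n\<bar>" by linarith
      ultimately show "dist (u m) (u n) < r" using \<open>r > 0\<close> unfolding dist_real_def by linarith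
    qed
  qed
  then show ?thesis by (simp add: Cauchy_convergent_iff)
qed

section \<open>Size distributions\<close>

text \<open>
  Cluster densities are total functions on the real line that vanish at sizes \<open>x \<le> 0\<close>, so that all
  integrals can be taken over the line and convolutions need no limits of integration. The parameters
  bound the number of clusters and their mass.
\<close>

definition size_dist :: "real \<Rightarrow> real \<Rightarrow> (real \<Rightarrow> real) \<Rightarrow> bool" where
  "size_dist a b v \<longleftrightarrow> v \<in> borel_measurable borel \<and> (\<forall>x. 0 \<le> v x) \<and> (\<forall>x\<le>0. v x = 0) \<and>
     integrable lborel v \<and> integrable lborel (\<lambda>x. x * v x) \<and>
     (LBINT x. v x) \<le> a \<and> (LBINT x. x * v x) \<le> b"

lemma size_dist_weighted:
  assumes v: "size_dist a b v" and [measurable]: "\<phi> \<in> borel_measurable borel"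
    and bd: "\<And>y. y > 0 \<Longrightarrow> \<bar>\<phi> y\<bar> \<le> e * y + C" and "e \<ge> 0" "C \<ge> 0"
  shows "integrable lborel (\<lambda>x. \<phi> x * v x)"
    and "(LBINT x. \<bar>\<phi> x\<bar> * v x) \<le> e * b + C * a"
    and "\<bar>LBINT x. \<phi> x * v x\<bar> \<le> e * b + C * a"
proof -
  have [measurable]: "v \<in> borel_measurable borel" and nn: "\<And>x. 0 \<le> v x" and z: "\<And>x. x \<le> 0 \<Longrightarrow> v x = 0"
    and i0: "integrable lborel v" and i1: "integrable lborel (\<lambda>x. x * v x)"
    and a: "(LBINT x. v x) \<le> a" and b: "(LBINT x. x * v x) \<le> b"
    using v by (auto simp: size_dist_def)
  have iS: "integrable lborel (\<lambda>x. e * (x * v x) + C * v x)" using i0 i1 by auto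
  have le: "\<bar>\<phi> x\<bar> * v x \<le> e * (x * v x) + C * v x" for x
  proof (cases "x \<le> 0")
    case False
    then have "\<bar>\<phi> x\<bar> * v x \<le> (e * x + C) * v x" using bd[of x] nn[of x] by (intro mult_right_mono) auto
    then show ?thesis by (simp add: algebra_simps)
  qed (simp add: z)
  show i: "integrable lborel (\<lambda>x. \<phi> x * v x)"
    by (rule Bochner_Integration.integrable_bound[OF iS])
       (auto simp: abs_mult nn intro!: AE_I2 order_trans[OF le])
  then have i': "integrable lborel (\<lambda>x. \<bar>\<phi> x\<bar> * v x)"
    using integrable_abs[OF i] by (simp add: abs_mult nn)
  have "(LBINT x. \<bar>\<phi> x\<bar> * v x) \<le> (LBINT x. e * (x * v x) + C * v x)"
    by (rule integral_mono[OF i' iS le])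
  also have "\<dots> = e * (LBINT x. x * v x) + C * (LBINT x. v x)"
    using i0 i1 by simp
  also have "\<dots> \<le> e * b + C * a"
    using a b \<open>e \<ge> 0\<close> \<open>C \<ge> 0\<close> by (intro add_mono mult_left_mono) auto
  finally show 1: "(LBINT x. \<bar>\<phi> x\<bar> * v x) \<le> e * b + C * a" .
  have "\<bar>LBINT x. \<phi> x * v x\<bar> \<le> (LBINT x. \<bar>\<phi> x * v x\<bar>)" by (rule integral_abs_bound)
  also have "\<dots> = (LBINT x. \<bar>\<phi> x\<bar> * v x)" by (simp add: abs_mult nn)
  finally show "\<bar>LBINT x. \<phi> x * v x\<bar> \<le> e * b + C * a" using 1 by linarith
qed

lemma size_dist_nonneg: "size_dist a b v \<Longrightarrow> 0 \<le> a" "size_dist a b v \<Longrightarrow> 0 \<le> b"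
proof -
  assume v: "size_dist a b v"
  have "0 \<le> (LBINT x. v x)" using v by (intro integral_nonneg_AE) (auto simp: size_dist_def)
  then show "0 \<le> a" using v unfolding size_dist_def by linarith
  have "0 \<le> x * v x" for x using v by (cases "x \<le> 0") (auto simp: size_dist_def)
  then have "0 \<le> (LBINT x. x * v x)" by (intro integral_nonneg_AE) auto
  then show "0 \<le> b" using v unfolding size_dist_def by linarith
qed

lemma size_dist_set:
  assumes v: "size_dist a b v" and [measurable]: "A \<in> sets borel"
  shows "integrable lborel (\<lambda>x. indicator A x * v x)"
    and "0 \<le> (LBINT x. indicator A x * v x)"
    and "(LBINT x. indicator A x * v x) \<le> a"
proof -
  show "integrable lborel (\<lambda>x. indicator A x * v x)"
    by (rule size_dist_weighted(1)[OF v, of _ 0 1]) (auto simp: indicator_def)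
  show "0 \<le> (LBINT x. indicator A x * v x)"
    using v by (intro integral_nonneg_AE) (auto simp: size_dist_def)
  have "\<bar>LBINT x. indicator A x * v x\<bar> \<le> 0 * b + 1 * a"
    by (rule size_dist_weighted(3)[OF v]) (auto simp: indicator_def)
  then show "(LBINT x. indicator A x * v x) \<le> a" by simp
qed

text \<open>
  Beyond \<open>R\<close> a constant \<open>C\<close> is at most \<open>C / R * y\<close>, so a growth bound \<open>e * y + C\<close> costs only
  \<open>(e + C / R)\<close> times the mass: this is how sublinear test functions become negligible at infinity.
\<close>

lemma size_dist_tail:
  assumes v: "size_dist a b v" and [measurable]: "\<phi> \<in> borel_measurable borel"
    and bd: "\<And>y. y > 0 \<Longrightarrow> \<bar>\<phi> y\<bar> \<le> e * y + C" and "e \<ge> 0" "C \<ge> 0" "R > 0"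
  shows "\<bar>LBINT x. (indicator {R<..} x * \<phi> x) * v x\<bar> \<le> (e + C / R) * b"
proof -
  have "\<bar>LBINT x. (indicator {R<..} x * \<phi> x) * v x\<bar> \<le> (e + C / R) * b + 0 * a"
  proof (rule size_dist_weighted(3)[OF v])
    fix y :: real assume "y > 0"
    have "\<bar>\<phi> y\<bar> \<le> (e + C / R) * y" if "y > R"
    proof -
      have "C * 1 \<le> C * (y / R)" using that \<open>C \<ge> 0\<close> \<open>R > 0\<close> by (intro mult_left_mono) auto
      then show ?thesis using bd[OF \<open>y > 0\<close>] by (simp add: algebra_simps)
    qed
    moreover have "0 \<le> (e + C / R) * y" using \<open>y > 0\<close> \<open>e \<ge> 0\<close> \<open>C \<ge> 0\<close> \<open>R > 0\<close> by simp
    ultimately show "\<bar>indicator {R<..} y * \<phi> y\<bar> \<le> (e + C / R) * y + 0" by (auto simp: indicator_def)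
  qed (use assms in auto)
  then show ?thesis by simp
qed

text \<open>
  Growth \<open>o(y)\<close> at infinity together with boundedness on bounded sets, in the form used for estimates.
  Such test functions do not see mass escaping to infinity.
\<close>

definition sublinear :: "(real \<Rightarrow> real) \<Rightarrow> bool" where
  "sublinear \<phi> \<longleftrightarrow> \<phi> \<in> borel_measurable borel \<and> (\<forall>e>0. \<exists>C\<ge>0. \<forall>y>0. \<bar>\<phi> y\<bar> \<le> e * y + C)"

lemma sublinear_bounded:
  assumes "\<phi> \<in> borel_measurable borel" "\<And>y. y > 0 \<Longrightarrow> \<bar>\<phi> y\<bar> \<le> C"
  shows "sublinear \<phi>"
  unfolding sublinear_def
proof (intro conjI allI impI)
  fix e :: real assume "e > 0"
  show "\<exists>C\<ge>0. \<forall>y>0. \<bar>\<phi> y\<bar> \<le> e * y + C"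
  proof (intro exI[of _ "\<bar>C\<bar>"] conjI allI impI)
    fix y :: real assume "y > 0"
    then have "0 \<le> e * y" using \<open>e > 0\<close> by simp
    then show "\<bar>\<phi> y\<bar> \<le> e * y + \<bar>C\<bar>" using assms(2)[OF \<open>y > 0\<close>] by linarith
  qed simp
qed (fact assms(1))

section \<open>Weak limits of locally dominated sequences\<close>

text \<open>
  Domination on bounded ranges of sizes replaces a Dunford-Pettis criterion: it gives
  uniform integrability in a form to which dominated convergence applies directly.
\<close>

locale dominated_dists =
  fixes v :: "nat \<Rightarrow> real \<Rightarrow> real" and a b :: real
  assumes dist: "\<And>n. size_dist a b (v n)"
    and dom: "\<And>R. \<exists>g. integrable lborel g \<and> (\<forall>n. AE x in lborel. x \<le> R \<longrightarrow> v n x \<le> g x)"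
begin

lemma v_meas[measurable]: "v n \<in> borel_measurable borel"
  and v_nonneg: "0 \<le> v n x" and v_zero: "x \<le> 0 \<Longrightarrow> v n x = 0"
  and v_int: "integrable lborel (v n)"
  using dist[of n] by (auto simp: size_dist_def)

lemma a_nonneg: "0 \<le> a" and b_nonneg: "0 \<le> b"
  using size_dist_nonneg dist by blast+

lemma tail_indicator:
  assumes [measurable]: "B \<in> sets borel" and "R > 0"
  shows "(LBINT x. indicator (B \<inter> {R<..}) x * v n x) \<le> b / R"
proof -
  have "\<bar>LBINT x. (indicator {R<..} x * indicator B x) * v n x\<bar> \<le> (0 + 1 / R) * b"
    using \<open>R > 0\<close> by (intro size_dist_tail[OF dist]) (auto simp: indicator_def)
  moreover have "indicator (B \<inter> {R<..}) x = indicator {R<..} x * (indicator B x :: real)" for x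
    by (auto simp: indicator_def)
  ultimately show ?thesis by auto
qed

text \<open>
  Uniform countable additivity: the part of \<open>B i\<close> beyond \<open>R\<close> has mass at most \<open>b / R\<close> by Markov's
  inequality, and the part below \<open>R\<close> is controlled by the common majorant.
\<close>

lemma uniformly_small:
  assumes B[measurable]: "\<And>i. B i \<in> sets borel" and dec: "decseq B" and emp: "(\<Inter>i. B i) = {}" and "e > 0"
  shows "\<exists>m. \<forall>i\<ge>m. \<forall>n. (LBINT x. indicator (B i) x * v n x) \<le> e"
proof -
  define R where "R = 2 * (b + 1) / e"
  have R: "R > 0" "b / R \<le> e / 2" using b_nonneg \<open>e > 0\<close> by (auto simp: R_def field_simps)
  from dom obtain g where g: "integrable lborel g" "\<And>n. AE x in lborel. x \<le> R \<longrightarrow> v n x \<le> g x" by blast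
  have [measurable]: "g \<in> borel_measurable borel" using g(1) by auto
  have "(\<lambda>i. LBINT x. indicator (B i) x * \<bar>g x\<bar>) \<longlonglongrightarrow> (LBINT x::real. 0)"
  proof (rule integral_dominated_convergence)
    show "integrable lborel (\<lambda>x. \<bar>g x\<bar>)" using g by simp
    show "AE x in lborel. (\<lambda>i. indicator (B i) x * \<bar>g x\<bar>) \<longlonglongrightarrow> 0"
    proof (rule AE_I2)
      fix x
      from emp obtain i where "x \<notin> B i" by auto
      then have "x \<notin> B j" if "j \<ge> i" for j using decseqD[OF dec that] by blast
      then have "\<forall>\<^sub>F j in sequentially. indicator (B j) x * \<bar>g x\<bar> = 0"
        by (intro eventually_sequentiallyI[of i]) simp
      then show "(\<lambda>i. indicator (B i) x * \<bar>g x\<bar>) \<longlonglongrightarrow> 0" by (rule tendsto_eventually)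
    qed
  qed (use g in \<open>auto simp: indicator_def\<close>)
  then have "\<forall>\<^sub>F i in sequentially. (LBINT x. indicator (B i) x * \<bar>g x\<bar>) < e / 2"
    using \<open>e > 0\<close> by (intro order_tendstoD(2)[where y = 0]) auto
  then obtain m where m: "\<And>i. i \<ge> m \<Longrightarrow> (LBINT x. indicator (B i) x * \<bar>g x\<bar>) < e / 2"
    by (auto simp: eventually_sequentially)
  show ?thesis
  proof (intro exI[of _ m] allI impI)
    fix i n assume "i \<ge> m"
    have ig: "integrable lborel (\<lambda>x. indicator (B i) x * \<bar>g x\<bar>)"
      using integrable_real_mult_indicator[of "B i" lborel "\<lambda>x. \<bar>g x\<bar>"] g(1) by (simp add: mult.commute)
    have it: "integrable lborel (\<lambda>x. indicator (B i \<inter> {R<..}) x * v n x)"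
      by (intro size_dist_set[OF dist]) auto
    have "(LBINT x. indicator (B i) x * v n x) \<le>
      (LBINT x. indicator (B i \<inter> {R<..}) x * v n x + indicator (B i) x * \<bar>g x\<bar>)"
    proof (rule integral_mono_AE)
      show "AE x in lborel. indicator (B i) x * v n x
              \<le> indicator (B i \<inter> {R<..}) x * v n x + indicator (B i) x * \<bar>g x\<bar>"
        using g(2)[of n] by eventually_elim (auto simp: indicator_def)
    qed (use ig it size_dist_set(1)[OF dist] in auto)
    also have "\<dots> = (LBINT x. indicator (B i \<inter> {R<..}) x * v n x) + (LBINT x. indicator (B i) x * \<bar>g x\<bar>)"
      using ig it by simp
    also have "\<dots> \<le> b / R + e / 2"
      using m[OF \<open>i \<ge> m\<close>] R tail_indicator[of "B i" R n] by (intro add_mono) auto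
    also have "\<dots> \<le> e" using R by linarith
    finally show "(LBINT x. indicator (B i) x * v n x) \<le> e" .
  qed
qed

definition mass :: "nat \<Rightarrow> real set \<Rightarrow> real" where
  "mass n A = (LBINT x. indicator A x * v n x)"

lemma mass_union:
  assumes "A \<in> sets borel" "B \<in> sets borel" "A \<inter> B = {}"
  shows "mass n (A \<union> B) = mass n A + mass n B"
proof -
  have "mass n (A \<union> B) = (LBINT x. indicator A x * v n x + indicator B x * v n x)"
    unfolding mass_def using assms(3)
    by (intro Bochner_Integration.integral_cong) (auto split: split_indicator)
  then show ?thesis
    unfolding mass_def using size_dist_set(1)[OF dist assms(1)] size_dist_set(1)[OF dist assms(2)]
    by simp
qed

lemma mass_empty: "mass n {} = 0" by (simp add: mass_def)

lemma mass_nonneg: "A \<in> sets borel \<Longrightarrow> 0 \<le> mass n A"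
  unfolding mass_def by (rule size_dist_set[OF dist])

text \<open>
  By uniform countable additivity, removing a member of a vanishing sequence of sets changes all
  masses by little at once, so convergence may be checked after the removal.
\<close>

lemma mass_small_convergent:
  assumes B[measurable]: "\<And>i. B i \<in> sets borel" and dec: "decseq B" and emp: "(\<Inter>i. B i) = {}"
    and A: "A \<in> sets borel" and cv: "\<And>i. convergent (\<lambda>n. mass n (A - B i))"
  shows "convergent (\<lambda>n. mass n A)"
proof (rule convergent_approx)
  fix e :: real assume "e > 0"
  then obtain m where m: "\<And>n. mass n (B m) \<le> e"
    using uniformly_small[OF B dec emp] unfolding mass_def by blast
  have "\<bar>mass n A - mass n (A - B m)\<bar> \<le> e" for n
  proof -
    have "mass n ((A - B m) \<union> (A \<inter> B m)) = mass n (A - B m) + mass n (A \<inter> B m)"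
      using A by (intro mass_union) auto
    moreover have "(A - B m) \<union> (A \<inter> B m) = A" by auto
    moreover have "mass n ((A \<inter> B m) \<union> (B m - A)) = mass n (A \<inter> B m) + mass n (B m - A)"
      using A by (intro mass_union) auto
    moreover have "(A \<inter> B m) \<union> (B m - A) = B m" by auto
    moreover have "0 \<le> mass n (A \<inter> B m)" "0 \<le> mass n (B m - A)" using A by (auto intro!: mass_nonneg)
    ultimately show ?thesis using m[of n] by auto
  qed
  then show "\<exists>w. convergent w \<and> (\<forall>\<^sub>F n in sequentially. \<bar>mass n A - w n\<bar> \<le> e)"
    using cv[of m] by (intro exI[of _ "\<lambda>n. mass n (A - B m)"]) simp
qed

text \<open>
  The sets whose masses converge form a Dynkin system: countable disjoint unions are handled by
  removing their tails. Half-lines with rational end points suffice as generators, because a half-line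
  differs from one with a nearby rational end point by a short interval of uniformly small mass.
\<close>

lemma mass_convergent:
  assumes rat: "\<And>q. q \<in> \<rat> \<Longrightarrow> convergent (\<lambda>n. mass n {..q})" and A: "A \<in> sets borel"
  shows "convergent (\<lambda>n. mass n A)"
proof -
  let ?G = "range (\<lambda>q::real. {..q})"
  have univ: "convergent (\<lambda>n. mass n UNIV)"
  proof (rule mass_small_convergent[where B = "\<lambda>i. {real i<..}"])
    show "(\<Inter>i. {real i<..}) = {}"
    proof (intro equals0I)
      fix x assume "x \<in> (\<Inter>i. {real i<..})"
      then show False using reals_Archimedean2[of x] by (auto dest: less_asym simp: not_less)
    qed
    show "decseq (\<lambda>i. {real i<..})" by (auto simp: decseq_def)
    fix i show "convergent (\<lambda>n. mass n (UNIV - {real i<..}))"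
      using rat[of "real i"] by (simp add: Compl_eq_Diff_UNIV[symmetric] )
  qed auto
  have atMost: "convergent (\<lambda>n. mass n {..q})" for q :: real
  proof -
    have "\<exists>r. r \<in> \<rat> \<and> q < r \<and> r < q + 1 / Suc i" for i :: nat
      using Rats_dense_in_real[of q "q + 1 / Suc i"] by auto
    then obtain r where "\<And>i::nat. r i \<in> \<rat> \<and> q < r i \<and> r i < q + 1 / Suc i"
      using choice[of "\<lambda>i r. r \<in> \<rat> \<and> q < r \<and> r < q + 1 / real (Suc i)"] by blast
    then have r: "\<And>i::nat. r i \<in> \<rat>" "\<And>i. q < r i" "\<And>i. r i < q + 1 / Suc i" by blast+
    show ?thesis
    proof (rule convergent_approx)
      fix e :: real assume "e > 0"
      have "\<exists>m. \<forall>i\<ge>m. \<forall>n. (LBINT x. indicator {q<..<q + 1 / Suc i} x * v n x) \<le> e"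
      proof (rule uniformly_small[OF _ _ _ \<open>e > 0\<close>])
        show "decseq (\<lambda>i. {q<..<q + 1 / real (Suc i)})"
        proof (rule decseq_SucI, rule subsetI)
          fix i x
          have "1 / real (Suc (Suc i)) \<le> 1 / real (Suc i)" by (rule frac_le) auto
          then show "x \<in> {q<..<q + 1 / real (Suc i)}" if "x \<in> {q<..<q + 1 / real (Suc (Suc i))}"
            using that by (auto simp del: of_nat_Suc)
        qed
        show "(\<Inter>i. {q<..<q + 1 / real (Suc i)}) = {}"
        proof (rule equals0I)
          fix x assume x: "x \<in> (\<Inter>i. {q<..<q + 1 / real (Suc i)})"
          then have "x - q > 0" by auto
          then obtain i where i: "1 / real (Suc i) < x - q" using nat_approx_posE by blast
          from x have "x \<in> {q<..<q + 1 / real (Suc i)}" by blast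
          then have "x < q + 1 / real (Suc i)" by (simp only: greaterThanLessThan_iff)
          with i show False by linarith
        qed
      qed auto
      then obtain m where m: "\<And>n. mass n {q<..<q + 1 / Suc m} \<le> e" unfolding mass_def by blast
      have "\<bar>mass n {..q} - mass n {..r m}\<bar> \<le> e" for n
      proof -
        have "mass n ({..q} \<union> {q<..r m}) = mass n {..q} + mass n {q<..r m}" by (intro mass_union) auto
        moreover have "{..q} \<union> {q<..r m} = {..r m}" using r(2)[of m] by auto
        moreover have "mass n ({q<..r m} \<union> {r m<..<q + 1 / Suc m}) = mass n {q<..r m} + mass n {r m<..<q + 1 / Suc m}"
          by (intro mass_union) auto
        moreover have "{q<..r m} \<union> {r m<..<q + 1 / Suc m} = {q<..<q + 1 / Suc m}" using r(2,3)[of m] by auto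
        moreover have "0 \<le> mass n {q<..r m}" "0 \<le> mass n {r m<..<q + 1 / Suc m}" by (auto intro!: mass_nonneg)
        ultimately show ?thesis using m[of n] by auto
      qed
      then show "\<exists>w. convergent w \<and> (\<forall>\<^sub>F n in sequentially. \<bar>mass n {..q} - w n\<bar> \<le> e)"
        using rat[OF r(1)[of m]] by (intro exI[of _ "\<lambda>n. mass n {..r m}"]) simp
    qed
  qed
  have bor: "sets borel = sigma_sets UNIV ?G"
    unfolding borel_eq_atMost by (rule sets_measure_of) auto
  have "Int_stable ?G" by (auto simp: Int_stable_def)
  moreover have "?G \<subseteq> Pow UNIV" by simp
  moreover have "A \<in> sigma_sets UNIV ?G" using A bor by simp
  ultimately show ?thesis
  proof (induction rule: sigma_sets_induct_disjoint)
    case (basic A) then show ?case using atMost by auto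
  next
    case empty show ?case by (simp add: mass_empty convergent_const)
  next
    case (compl A)
    then have [measurable]: "A \<in> sets borel" using bor by auto
    have "mass n UNIV = mass n (UNIV - A) + mass n A" for n
    proof -
      have "(UNIV - A) \<union> A = UNIV" by auto
      then show ?thesis using mass_union[of "UNIV - A" A n] by auto
    qed
    then have "(\<lambda>n. mass n (UNIV - A)) = (\<lambda>n. mass n UNIV - mass n A)" by (auto simp: fun_eq_iff)
    then show ?case using convergent_diff[OF univ compl(2)] by simp
  next
    case (union A)
    have A': "A i \<in> sets borel" for i using union(2) bor by auto
    show ?case
    proof (rule mass_small_convergent[where B = "\<lambda>m. \<Union>i\<in>{m..}. A i"])
      show "decseq (\<lambda>m. \<Union>i\<in>{m..}. A i)" by (intro decseq_SucI UN_mono) auto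
      show "(\<Inter>m. \<Union>i\<in>{m..}. A i) = {}"
      proof (rule ccontr)
        assume "(\<Inter>m. \<Union>i\<in>{m..}. A i) \<noteq> {}"
        then obtain x where x': "\<forall>m. x \<in> (\<Union>i\<in>{m..}. A i)" by blast
        then have x: "\<exists>i\<ge>m. x \<in> A i" for m by (auto dest: spec[of _ m])
        from x[of 0] obtain i where i: "x \<in> A i" by auto
        from x[of "Suc i"] obtain j where "j \<ge> Suc i" "x \<in> A j" by auto
        moreover from this have "A i \<inter> A j = {}" using union(1) by (auto simp: disjoint_family_on_def)
        ultimately show False using i by blast
      qed
      fix m
      have "(\<Union>i. A i) - (\<Union>i\<in>{m..}. A i) = (\<Union>i<m. A i)"
      proof (intro set_eqI iffI)
        fix x assume "x \<in> (\<Union>i<m. A i)"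
        then obtain i where i: "i < m" "x \<in> A i" by auto
        then have "x \<notin> A j" if "j \<ge> m" for j
          using disjoint_family_onD[OF union(1), of i j] i that by auto
        with i show "x \<in> (\<Union>i. A i) - (\<Union>i\<in>{m..}. A i)" by auto
      qed (metis Diff_iff UN_iff atLeast_iff lessThan_iff not_le)
      moreover have "mass n (\<Union>i<m. A i) = (\<Sum>i<m. mass n (A i))" for n
      proof (induction m)
        case (Suc m)
        have "A i \<inter> A m = {}" if "i < m" for i
          using disjoint_family_onD[OF union(1), of i m] that by auto
        then have "(\<Union>i<m. A i) \<inter> A m = {}" by blast
        then have "mass n ((\<Union>i<m. A i) \<union> A m) = mass n (\<Union>i<m. A i) + mass n (A m)"
          using A' by (intro mass_union) auto
        moreover have "(\<Union>i<m. A i) \<union> A m = (\<Union>i<Suc m. A i)" by (auto simp: less_Suc_eq)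
        ultimately show ?case using Suc by simp
      qed (simp add: mass_empty)
      ultimately show "convergent (\<lambda>n. mass n ((\<Union>i. A i) - (\<Union>i\<in>{m..}. A i)))"
        using union(3) by (simp add: convergent_sum)
    qed (use A' in auto)
  qed
qed

end

lemma bounded_weight_le:
  fixes w :: "real \<Rightarrow> real"
  assumes w: "integrable lborel w" "\<And>x. 0 \<le> w x" and [measurable]: "\<phi> \<in> borel_measurable borel"
    and bd: "\<And>x. \<bar>\<phi> x\<bar> \<le> C"
  shows "integrable lborel (\<lambda>x. \<phi> x * w x)" "\<bar>LBINT x. \<phi> x * w x\<bar> \<le> C * (LBINT x. w x)"
proof -
  have i: "integrable lborel (\<lambda>x. C * w x)" using w by simp
  have le: "\<bar>\<phi> x * w x\<bar> \<le> C * w x" for x by (simp add: abs_mult w bd mult_right_mono)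
  show 1: "integrable lborel (\<lambda>x. \<phi> x * w x)"
    by (rule Bochner_Integration.integrable_bound[OF i]) (use w le in \<open>auto intro!: AE_I2 order_trans[OF le]\<close>)
  have "\<bar>LBINT x. \<phi> x * w x\<bar> \<le> (LBINT x. \<bar>\<phi> x * w x\<bar>)" by (rule integral_abs_bound)
  also have "\<dots> \<le> (LBINT x. C * w x)" by (rule integral_mono[OF integrable_abs[OF 1] i le])
  finally show "\<bar>LBINT x. \<phi> x * w x\<bar> \<le> C * (LBINT x. w x)" by simp
qed

lemma simple_weight_integral:
  fixes w s :: "real \<Rightarrow> real"
  assumes w: "integrable lborel w" "\<And>x. 0 \<le> w x" and [measurable]: "s \<in> borel_measurable borel" and fin: "finite (range s)"
  shows "(LBINT x. s x * w x) = (\<Sum>z\<in>range s. z * (LBINT x. indicator (s -` {z}) x * w x))"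
proof -
  have m: "s -` {z} \<in> sets borel" for z using measurable_sets[of s borel borel "{z}"] by simp
  have i: "integrable lborel (\<lambda>x. indicator (s -` {z}) x * w x)" for z
    by (rule bounded_weight_le(1)[OF w, where C = 1]) (use m in \<open>auto simp: indicator_def\<close>)
  have "s x = (\<Sum>z\<in>range s. z * indicator (s -` {z}) x)" for x
  proof -
    have "(\<Sum>z\<in>range s. z * indicator (s -` {z}) x) = (\<Sum>z\<in>range s. if z = s x then s x else 0)"
      by (intro sum.cong) (auto simp: indicator_def)
    then show ?thesis using fin by simp
  qed
  then have "(LBINT x. s x * w x) = (LBINT x. (\<Sum>z\<in>range s. z * (indicator (s -` {z}) x * w x)))"
    by (intro Bochner_Integration.integral_cong refl) (metis (no_types, lifting) mult.assoc sum.cong sum_distrib_right)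
  also have "\<dots> = (\<Sum>z\<in>range s. z * (LBINT x. indicator (s -` {z}) x * w x))"
    using i by simp
  finally show ?thesis .
qed

context dominated_dists begin

text \<open>
  Bounded test functions are uniform limits of functions with finitely many values, for which the
  claim is a finite linear combination of convergent masses.
\<close>

lemma bounded_test_limit:
  assumes w: "integrable lborel w" "\<And>x. 0 \<le> w x"
    and lim: "\<And>A. A \<in> sets borel \<Longrightarrow> (\<lambda>n. mass n A) \<longlonglongrightarrow> (LBINT x. indicator A x * w x)"
    and [measurable]: "\<phi> \<in> borel_measurable borel" and bd: "\<And>x. \<bar>\<phi> x\<bar> \<le> C"
  shows "(\<lambda>n. LBINT x. \<phi> x * v n x) \<longlonglongrightarrow> (LBINT x. \<phi> x * w x)"
proof (rule LIMSEQ_approx)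
  fix e :: real assume "e > 0"
  define D where "D = a + (LBINT x. w x) + 1"
  have D: "a \<le> D" "(LBINT x. w x) \<le> D" "D > 0"
    using a_nonneg w by (auto simp: D_def add_nonneg_pos integral_nonneg_AE)
  define d where "d = e / D"
  have d: "d > 0" "d * D = e" using \<open>e > 0\<close> D by (auto simp: d_def)
  \<comment> \<open>Rounding to multiples of d costs at most d, hence d * D = e after integration.\<close>
  define s where "s x = d * of_int \<lfloor>\<phi> x / d\<rfloor>" for x
  have [measurable]: "s \<in> borel_measurable borel" unfolding s_def by measurable
  have sd: "\<bar>\<phi> x - s x\<bar> \<le> d" for x
  proof -
    have "\<bar>\<phi> x / d - of_int \<lfloor>\<phi> x / d\<rfloor>\<bar> \<le> 1" by linarith
    then have "d * \<bar>\<phi> x / d - of_int \<lfloor>\<phi> x / d\<rfloor>\<bar> \<le> d * 1" using d by (intro mult_left_mono) auto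
    then have "\<bar>d * (\<phi> x / d - of_int \<lfloor>\<phi> x / d\<rfloor>)\<bar> \<le> d" using d by (simp add: abs_mult)
    then show ?thesis using d by (simp add: s_def right_diff_distrib)
  qed
  have sC: "\<bar>s x\<bar> \<le> C + d" for x using sd[of x] bd[of x] by linarith
  have "range s \<subseteq> (\<lambda>k. d * of_int k) ` {\<lfloor>- C / d\<rfloor>..\<lfloor>C / d\<rfloor>}"
  proof safe
    fix x
    have "- C / d \<le> \<phi> x / d" "\<phi> x / d \<le> C / d" using bd[of x] d by (auto intro!: divide_right_mono simp del: divide_minus_left simp: abs_le_iff)
    then show "s x \<in> (\<lambda>k. d * of_int k) ` {\<lfloor>- C / d\<rfloor>..\<lfloor>C / d\<rfloor>}"
      unfolding s_def by (intro imageI) (auto intro: floor_mono)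
  qed
  then have fin: "finite (range s)" by (rule finite_subset) auto
  have err: "\<bar>(LBINT x. \<phi> x * f x) - (LBINT x. s x * f x)\<bar> \<le> e"
    if f: "integrable lborel f" "\<And>x. 0 \<le> f x" "(LBINT x. f x) \<le> D" for f
  proof -
    have "(LBINT x. \<phi> x * f x) - (LBINT x. s x * f x) = (LBINT x. \<phi> x * f x - s x * f x)"
      by (rule Bochner_Integration.integral_diff[symmetric]; rule bounded_weight_le(1)[OF f(1,2)])
         (auto intro: bd sC)
    also have "\<dots> = (LBINT x. (\<phi> x - s x) * f x)" by (simp add: left_diff_distrib)
    also have "\<bar>\<dots>\<bar> \<le> d * (LBINT x. f x)"
      by (rule bounded_weight_le(2)[OF f(1,2)]) (auto intro: sd)
    also have "\<dots> \<le> d * D" using f d by (intro mult_left_mono) auto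
    finally show ?thesis using d by simp
  qed
  have m: "s -` {z} \<in> sets borel" for z using measurable_sets[of s borel borel "{z}"] by simp
  have "(\<lambda>n. LBINT x. s x * v n x) \<longlonglongrightarrow> (LBINT x. s x * w x)"
    unfolding simple_weight_integral[OF w _ fin, simplified] simple_weight_integral[OF v_int v_nonneg _ fin, simplified]
    using lim[OF m] unfolding mass_def by (intro tendsto_intros)
  moreover have "(LBINT x. v n x) \<le> D" for n
    using dist[of n] D by (auto simp: size_dist_def)
  ultimately show "\<exists>w' l'. w' \<longlonglongrightarrow> l' \<and> \<bar>(LBINT x. \<phi> x * w x) - l'\<bar> \<le> e \<and>
     (\<forall>\<^sub>F n in sequentially. \<bar>(LBINT x. \<phi> x * v n x) - w' n\<bar> \<le> e)"
    using err[OF w D(2)] err[OF v_int v_nonneg] by (intro exI conjI always_eventually allI) auto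
qed

text \<open>
  The limits of the masses form a finite measure, by uniform countable additivity, and it is absolutely
  continuous because each density gives null sets mass zero; its density is the weak limit.
  Sublinear test functions are reached from bounded ones by cutting off at a large \<open>R\<close>. The bound on the
  first moment is lower semicontinuity: it holds below each level and passes to the supremum.
\<close>

theorem limit_density:
  assumes cv: "\<And>A. A \<in> sets borel \<Longrightarrow> convergent (\<lambda>n. mass n A)"
  shows "\<exists>w. size_dist a b w \<and>
    (\<forall>\<phi>. sublinear \<phi> \<longrightarrow> (\<lambda>n. LBINT x. \<phi> x * v n x) \<longlonglongrightarrow> (LBINT x. \<phi> x * w x))"
proof -
  define \<nu> where "\<nu> A = lim (\<lambda>n. mass n A)" for A
  have \<nu>: "(\<lambda>n. mass n A) \<longlonglongrightarrow> \<nu> A" if "A \<in> sets borel" for A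
    using cv[OF that] by (simp add: \<nu>_def convergent_LIMSEQ_iff)
  have \<nu>_nonneg: "0 \<le> \<nu> A" if "A \<in> sets borel" for A
    using that by (intro LIMSEQ_le_const[OF \<nu>]) (auto intro: mass_nonneg)
  have \<nu>_empty: "\<nu> {} = 0" by (simp add: \<nu>_def mass_empty lim_const)
  have \<nu>_union: "\<nu> (A \<union> B) = \<nu> A + \<nu> B" if "A \<in> sets borel" "B \<in> sets borel" "A \<inter> B = {}" for A B
  proof (rule LIMSEQ_unique)
    show "(\<lambda>n. mass n (A \<union> B)) \<longlonglongrightarrow> \<nu> (A \<union> B)" using that by (intro \<nu>) auto
    show "(\<lambda>n. mass n (A \<union> B)) \<longlonglongrightarrow> \<nu> A + \<nu> B"
      unfolding mass_union[OF that] using that by (intro tendsto_add \<nu>)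
  qed
  interpret borel: sigma_algebra "UNIV :: real set" "sets borel"
    using sets.sigma_algebra_axioms[of "borel :: real measure"] by simp
  have pos: "positive (sets borel) (\<lambda>A. ennreal (\<nu> A))" by (simp add: positive_def \<nu>_empty)
  have add: "countably_additive (sets borel) (\<lambda>A. ennreal (\<nu> A))"
  proof (rule borel.empty_continuous_imp_countably_additive[OF pos])
    show "additive (sets borel) (\<lambda>A. ennreal (\<nu> A))"
      by (auto simp: additive_def \<nu>_union \<nu>_nonneg ennreal_plus)
    fix B :: "nat \<Rightarrow> real set" assume "range B \<subseteq> sets borel" and dec: "decseq B" and emp: "(\<Inter>i. B i) = {}"
    then have B: "\<And>i. B i \<in> sets borel" by auto
    have "(\<lambda>i. \<nu> (B i)) \<longlonglongrightarrow> 0"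
    proof (rule LIMSEQ_I)
      fix r :: real assume "r > 0"
      then obtain m where m: "\<And>i n. i \<ge> m \<Longrightarrow> mass n (B i) \<le> r / 2"
        using uniformly_small[OF B dec emp, of "r / 2"] unfolding mass_def by auto
      have "\<nu> (B i) \<le> r / 2" if "i \<ge> m" for i
        using m[OF that] by (intro LIMSEQ_le_const2[OF \<nu>[OF B]]) auto
      then show "\<exists>no. \<forall>n\<ge>no. norm (\<nu> (B n) - 0) < r"
        using \<nu>_nonneg[OF B] \<open>r > 0\<close> by (intro exI[of _ m] allI impI) (fastforce intro: le_less_trans[of _ "r / 2"])
    qed
    then show "(\<lambda>i. ennreal (\<nu> (B i))) \<longlonglongrightarrow> 0" using tendsto_ennrealI by fastforce
  qed auto
  define N where "N = measure_of UNIV (sets borel) (\<lambda>A. ennreal (\<nu> A))"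
  have sN[simp]: "sets N = sets borel" "space N = UNIV"
    unfolding N_def by (simp_all add: borel.sigma_sets_eq)
  have eN: "emeasure N A = ennreal (\<nu> A)" if "A \<in> sets borel" for A
    by (rule emeasure_measure_of[OF N_def]) (use that pos add sN in auto)
  interpret N: finite_measure N by (rule finite_measureI) (simp add: eN)
  have ac: "absolutely_continuous lborel N"
    unfolding absolutely_continuous_def
  proof
    fix A :: "real set" assume A: "A \<in> null_sets lborel"
    then have m: "A \<in> sets borel" by (auto simp: null_sets_def)
    have "mass n A = 0" for n
      unfolding mass_def using AE_not_in[OF A]
      by (intro integral_eq_zero_AE) (auto elim: eventually_mono)
    then have "\<nu> A = 0" by (simp add: \<nu>_def lim_const)
    then show "A \<in> null_sets N" using m by (auto simp: null_sets_def eN)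
  qed
  define w0 where "w0 = RN_deriv lborel N"
  have w0_meas[measurable]: "w0 \<in> borel_measurable borel" unfolding w0_def by simp
  have dens: "density lborel w0 = N" unfolding w0_def by (rule sigma_finite_measure.density_RN_deriv[OF sigma_finite_lborel ac]) simp
  have w0A: "(\<integral>\<^sup>+x. w0 x * indicator A x \<partial>lborel) = ennreal (\<nu> A)" if "A \<in> sets borel" for A
    using that by (simp add: eN[symmetric] dens[symmetric] emeasure_density)
  have w0_fin: "AE x in lborel. w0 x \<noteq> \<infinity>"
    using w0A[of UNIV] by (intro nn_integral_noteq_infinite) auto
  define w where "w x = indicator {0<..} x * enn2real (w0 x)" for x
  have [measurable]: "w \<in> borel_measurable borel" unfolding w_def by measurable
  have w_nn: "0 \<le> w x" for x by (simp add: w_def)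
  \<comment> \<open>No mass reaches the non-positive axis, so the density may be set to zero there.\<close>
  have pos_part: "\<nu> (A \<inter> {0<..}) = \<nu> A" if "A \<in> sets borel" for A
  proof -
    have "mass n (A \<inter> {..0}) = 0" for n
      unfolding mass_def by (intro integral_eq_zero_AE AE_I2) (auto simp: indicator_def v_zero)
    then have "\<nu> (A \<inter> {..0}) = 0" by (simp add: \<nu>_def lim_const)
    moreover have "\<nu> ((A \<inter> {0<..}) \<union> (A \<inter> {..0})) = \<nu> (A \<inter> {0<..}) + \<nu> (A \<inter> {..0})"
      using that by (intro \<nu>_union) auto
    moreover have "(A \<inter> {0<..}) \<union> (A \<inter> {..0}) = A" by auto
    ultimately show ?thesis by simp
  qed
  have nnA: "(\<integral>\<^sup>+x. ennreal (indicator A x * w x) \<partial>lborel) = ennreal (\<nu> A)" if "A \<in> sets borel" for A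
  proof -
    have "(\<integral>\<^sup>+x. ennreal (indicator A x * w x) \<partial>lborel) = (\<integral>\<^sup>+x. w0 x * indicator (A \<inter> {0<..}) x \<partial>lborel)"
      using w0_fin by (intro nn_integral_cong_AE, elim eventually_mono)
        (auto simp: w_def indicator_def less_top)
    then show ?thesis using w0A[of "A \<inter> {0<..}"] pos_part[OF that] that by simp
  qed
  have wA: "integrable lborel (\<lambda>x. indicator A x * w x)" "(LBINT x. indicator A x * w x) = \<nu> A"
    if [measurable]: "A \<in> sets borel" for A
  proof -
    have "has_bochner_integral lborel (\<lambda>x. indicator A x * w x) (\<nu> A)"
      by (rule has_bochner_integral_nn_integral)
         (use nnA[OF that] \<nu>_nonneg[OF that] w_nn in \<open>auto intro: AE_I2\<close>)
    then show "integrable lborel (\<lambda>x. indicator A x * w x)" "(LBINT x. indicator A x * w x) = \<nu> A"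
      by (auto simp: has_bochner_integral_iff)
  qed
  have wi: "integrable lborel w" and w_total: "(LBINT x. w x) = \<nu> UNIV" using wA[of UNIV] by auto
  have bdd: "(\<lambda>n. LBINT x. \<phi> x * v n x) \<longlonglongrightarrow> (LBINT x. \<phi> x * w x)"
    if [measurable]: "\<phi> \<in> borel_measurable borel" and "\<And>x. \<bar>\<phi> x\<bar> \<le> C" for \<phi> C
    by (rule bounded_test_limit[OF wi w_nn]) (use that \<nu> wA in auto)
  have trunc: "(\<integral>\<^sup>+x. ennreal (indicator {..real k} x * (x * w x)) \<partial>lborel) \<le> ennreal b" for k
  proof -
    let ?f = "\<lambda>x. indicator {0..real k} x * x"
    have f: "\<bar>?f x\<bar> \<le> real k" for x by (auto simp: indicator_def)
    have "(LBINT x. ?f x * w x) \<le> b"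
    proof (rule LIMSEQ_le_const2[OF bdd[OF _ f]])
      show "\<exists>N. \<forall>n\<ge>N. (LBINT x. ?f x * v n x) \<le> b"
      proof (intro exI allI impI)
        fix n
        have "\<bar>LBINT x. ?f x * v n x\<bar> \<le> 1 * b + 0 * a"
          by (rule size_dist_weighted(3)[OF dist]) (auto simp: indicator_def)
        then show "(LBINT x. ?f x * v n x) \<le> b" by linarith
      qed
    qed simp
    moreover have "integrable lborel (\<lambda>x. ?f x * w x)"
      by (rule bounded_weight_le(1)[OF wi w_nn _ f]) simp
    then have "(\<integral>\<^sup>+x. ennreal (?f x * w x) \<partial>lborel) = ennreal (LBINT x. ?f x * w x)"
      by (intro nn_integral_eq_integral) (auto simp: w_nn indicator_def intro!: AE_I2)
    moreover have "(\<integral>\<^sup>+x. ennreal (indicator {..real k} x * (x * w x)) \<partial>lborel) = (\<integral>\<^sup>+x. ennreal (?f x * w x) \<partial>lborel)"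
      by (intro nn_integral_cong) (auto simp: indicator_def w_def)
    ultimately show ?thesis by (simp add: ennreal_leI)
  qed
  have xw_nn: "0 \<le> x * w x" for x by (auto simp: w_def indicator_def)
  have "(\<integral>\<^sup>+x. ennreal (x * w x) \<partial>lborel) = (\<integral>\<^sup>+x. (SUP k. ennreal (indicator {..real k} x * (x * w x))) \<partial>lborel)"
  proof (intro nn_integral_cong)
    fix x :: real
    obtain k where k: "x \<le> real k" using real_arch_simple by blast
    show "ennreal (x * w x) = (SUP k. ennreal (indicator {..real k} x * (x * w x)))"
    proof (rule antisym)
      show "ennreal (x * w x) \<le> (SUP k. ennreal (indicator {..real k} x * (x * w x)))"
        by (rule SUP_upper2[of k]) (use k in auto)
      show "(SUP k. ennreal (indicator {..real k} x * (x * w x))) \<le> ennreal (x * w x)"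
        by (intro SUP_least ennreal_leI) (auto simp: indicator_def xw_nn)
    qed
  qed
  also have "\<dots> = (SUP k. \<integral>\<^sup>+x. ennreal (indicator {..real k} x * (x * w x)) \<partial>lborel)"
    by (intro nn_integral_monotone_convergence_SUP)
       (auto simp: incseq_def le_fun_def indicator_def xw_nn intro!: ennreal_leI)
  also have "\<dots> \<le> ennreal b" by (intro SUP_least trunc)
  finally have nb: "(\<integral>\<^sup>+x. ennreal (x * w x) \<partial>lborel) \<le> ennreal b" .
  then have xwi: "integrable lborel (\<lambda>x. x * w x)"
    by (intro integrableI_nonneg) (auto simp: xw_nn intro: le_less_trans)
  have xwb: "(LBINT x. x * w x) \<le> b"
    using nb nn_integral_eq_integral[OF xwi] xw_nn b_nonneg by (simp add: AE_I2 ennreal_le_iff)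
  have wsd: "size_dist a b w"
    unfolding size_dist_def
  proof (intro conjI allI impI w_nn wi xwi xwb)
    show "(LBINT x. w x) \<le> a" unfolding w_total
      by (rule LIMSEQ_le_const2[OF \<nu>]) (use size_dist_set(3)[OF dist, of UNIV] in \<open>auto simp: mass_def\<close>)
  qed (auto simp: w_def)
  have "(\<lambda>n. LBINT x. \<phi> x * v n x) \<longlonglongrightarrow> (LBINT x. \<phi> x * w x)" if sl: "sublinear \<phi>" for \<phi>
  proof (rule LIMSEQ_approx)
    fix e :: real assume "e > 0"
    have [measurable]: "\<phi> \<in> borel_measurable borel" using sl by (simp add: sublinear_def)
    \<comment> \<open>Half of e is spent on the linear part of the growth bound, half on the constant part beyond R.\<close>
    define d where "d = e / (2 * (b + 1))"
    have d: "d > 0" "d * b \<le> e / 2" using \<open>e > 0\<close> b_nonneg by (auto simp: d_def field_simps)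
    obtain C where C: "C \<ge> 0" "\<And>y. y > 0 \<Longrightarrow> \<bar>\<phi> y\<bar> \<le> d * y + C"
      using sl d(1) unfolding sublinear_def by blast
    define R where "R = 2 * (C + 1) * (b + 1) / e"
    have R: "R > 0" using \<open>e > 0\<close> b_nonneg C by (simp add: R_def)
    have "C * b / R \<le> e / 2"
    proof -
      have "C * b \<le> (C + 1) * (b + 1)" using C b_nonneg by (intro mult_mono) auto
      also have "\<dots> = e / 2 * R" using \<open>e > 0\<close> by (simp add: R_def)
      finally show ?thesis using R by (simp add: divide_le_eq)
    qed
    moreover have "(d + C / R) * b = d * b + C * b / R" by (simp add: algebra_simps)
    ultimately have eb: "(d + C / R) * b \<le> e" using d by linarith
    let ?p = "\<lambda>x. indicator {0<..R} x * \<phi> x"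
    have pb: "\<bar>?p x\<bar> \<le> d * R + C" for x
    proof (cases "x \<in> {0<..R}")
      case True
      then have "d * x \<le> d * R" using d by simp
      then show ?thesis using True C(2)[of x] by auto
    qed (use d R C in auto)
    have err: "\<bar>(LBINT x. \<phi> x * f x) - (LBINT x. ?p x * f x)\<bar> \<le> e" if f: "size_dist a b f" for f
    proof -
      have z: "\<And>x. x \<le> 0 \<Longrightarrow> f x = 0" using f by (auto simp: size_dist_def)
      have fi: "integrable lborel f" "\<And>x. 0 \<le> f x" using f by (auto simp: size_dist_def)
      have i1: "integrable lborel (\<lambda>x. \<phi> x * f x)"
        by (rule size_dist_weighted(1)[OF f _ C(2)]) (use d C in auto)
      have i2: "integrable lborel (\<lambda>x. ?p x * f x)" by (rule bounded_weight_le(1)[OF fi _ pb]) simp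
      have "(LBINT x. \<phi> x * f x) - (LBINT x. ?p x * f x) = (LBINT x. \<phi> x * f x - ?p x * f x)"
        using i1 i2 by simp
      also have "\<dots> = (LBINT x. (indicator {R<..} x * \<phi> x) * f x)"
        by (intro Bochner_Integration.integral_cong) (use z R in \<open>auto simp: indicator_def\<close>)
      also have "\<bar>\<dots>\<bar> \<le> (d + C / R) * b"
        by (rule size_dist_tail[OF f _ C(2)]) (use d C R in auto)
      finally show ?thesis using eb by linarith
    qed
    show "\<exists>w' l'. w' \<longlonglongrightarrow> l' \<and> \<bar>(LBINT x. \<phi> x * w x) - l'\<bar> \<le> e \<and>
     (\<forall>\<^sub>F n in sequentially. \<bar>(LBINT x. \<phi> x * v n x) - w' n\<bar> \<le> e)"
    proof (intro exI conjI always_eventually allI)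
      show "(\<lambda>n. LBINT x. ?p x * v n x) \<longlonglongrightarrow> (LBINT x. ?p x * w x)"
        by (rule bdd[OF _ pb]) simp
    qed (use err[OF wsd] err[OF dist] in blast)+
  qed
  with wsd show ?thesis by blast
qed

end

section \<open>The coagulation operator\<close>

abbreviation plane :: "(real \<times> real) measure" where
  "plane \<equiv> lborel \<Otimes>\<^sub>M lborel"

lemma nn_integral_shear:
  fixes H :: "real \<times> real \<Rightarrow> ennreal"
  assumes [measurable]: "H \<in> borel_measurable plane"
  shows "(\<integral>\<^sup>+x. \<integral>\<^sup>+y. H (y, x - y) \<partial>lborel \<partial>lborel) = (\<integral>\<^sup>+y. \<integral>\<^sup>+z. H (y, z) \<partial>lborel \<partial>lborel)"
    (is "?L = ?R")
proof -
  have "?L = (\<integral>\<^sup>+y. \<integral>\<^sup>+x. H (y, x - y) \<partial>lborel \<partial>lborel)"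
    by (rule lborel_pair.Fubini') measurable
  also have "\<dots> = ?R"
  proof (rule nn_integral_cong)
    fix y :: real
    show "(\<integral>\<^sup>+x. H (y, x - y) \<partial>lborel) = (\<integral>\<^sup>+z. H (y, z) \<partial>lborel)"
      by (subst (2) nn_integral_real_affine[where c = 1 and t = "- y"]) (auto simp: add.commute[of "- y"])
  qed
  finally show ?thesis .
qed

text \<open>
  Substituting the size \<open>x = y + z\<close> of the merged cluster for \<open>z\<close> preserves area; this is what turns
  the gain term into an integral over pairs of merging clusters.
\<close>

lemma distr_shear:
  "distr plane plane (\<lambda>(x, y). (y, x - y :: real)) = plane"
proof (rule measure_eqI)
  fix A :: "(real \<times> real) set" assume "A \<in> sets (distr plane plane (\<lambda>(x, y). (y, x - y :: real)))"
  then have A[measurable]: "A \<in> sets plane" by simp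
  have T[measurable]: "(\<lambda>(x, y). (y, x - y :: real)) \<in> plane \<rightarrow>\<^sub>M plane" by measurable
  have "emeasure (distr plane plane (\<lambda>(x, y). (y, x - y :: real))) A
      = (\<integral>\<^sup>+p. indicator A p \<partial>distr plane plane (\<lambda>(x, y). (y, x - y :: real)))"
    by (rule nn_integral_indicator[symmetric]) (use A in simp)
  also have "\<dots> = (\<integral>\<^sup>+p. indicator A ((\<lambda>(x, y). (y, x - y :: real)) p) \<partial>plane)"
    by (rule nn_integral_distr) auto
  also have "\<dots> = (\<integral>\<^sup>+x. \<integral>\<^sup>+y. indicator A (y, x - y) \<partial>lborel \<partial>lborel)"
    by (subst lborel.nn_integral_fst[symmetric]) auto
  also have "\<dots> = (\<integral>\<^sup>+y. \<integral>\<^sup>+z. indicator A (y, z) \<partial>lborel \<partial>lborel)"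
    by (rule nn_integral_shear) measurable
  also have "\<dots> = emeasure plane A"
    using nn_integral_indicator[OF A] by (subst lborel.nn_integral_fst) auto
  finally show "emeasure (distr plane plane (\<lambda>(x, y). (y, x - y :: real))) A = emeasure plane A" .
qed simp

lemma shear_integral:
  fixes \<Phi> :: "real \<times> real \<Rightarrow> real"
  assumes i: "integrable plane \<Phi>"
  shows "integrable lborel (\<lambda>x. LBINT y. \<Phi> (y, x - y))"
    and "(LBINT x. LBINT y. \<Phi> (y, x - y)) = (\<integral>p. \<Phi> p \<partial>plane)"
proof -
  let ?T = "\<lambda>(x, y). (y, x - y :: real)"
  have T[measurable]: "?T \<in> plane \<rightarrow>\<^sub>M plane" by measurable
  have m: "\<Phi> \<in> borel_measurable plane" using i by auto
  have "integrable (distr plane plane ?T) \<Phi>" using i by (simp add: distr_shear)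
  then have "integrable plane (\<lambda>p. \<Phi> (?T p))" by (rule integrable_distr[OF T])
  then have 1: "integrable plane (\<lambda>(x, y). \<Phi> (y, x - y))" by (simp add: case_prod_unfold)
  show "integrable lborel (\<lambda>x. LBINT y. \<Phi> (y, x - y))"
    using lborel_pair.integrable_fst'[OF 1] by simp
  have "(LBINT x. LBINT y. \<Phi> (y, x - y)) = (\<integral>p. \<Phi> (?T p) \<partial>plane)"
    using lborel_pair.integral_fst'[OF 1] by (simp add: case_prod_unfold)
  also have "\<dots> = (\<integral>p. \<Phi> p \<partial>distr plane plane ?T)"
    by (rule integral_distr[symmetric]) (use m in auto)
  finally show "(LBINT x. LBINT y. \<Phi> (y, x - y)) = (\<integral>p. \<Phi> p \<partial>plane)"
    by (simp add: distr_shear)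
qed

text \<open>
  The growth condition on \<open>K\<close> is a product, so integrals over pairs are bounded by the square of the
  norm of \<open>L1w 1\<close>. This bound yields both the Lipschitz estimate in time and all applications of
  Fubini's theorem.
\<close>

lemma pair_weighted:
  fixes \<psi> :: "real \<Rightarrow> real \<Rightarrow> real"
  assumes f: "size_dist a b f" and [measurable]: "case_prod \<psi> \<in> borel_measurable (borel \<Otimes>\<^sub>M borel)"
    and bd: "\<And>x y. x > 0 \<Longrightarrow> y > 0 \<Longrightarrow> \<bar>\<psi> x y\<bar> \<le> C * (1 + x) * (1 + y)" and "C \<ge> 0"
  shows "integrable plane (\<lambda>(x, y). \<psi> x y * f x * f y)"
    and "\<bar>LBINT x. LBINT y. \<psi> x y * f x * f y\<bar> \<le> C * (a + b)\<^sup>2"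
    and "(LBINT x. LBINT y. \<psi> x y * f x * f y) = (\<integral>(x, y). \<psi> x y * f x * f y \<partial>plane)"
proof -
  have [measurable]: "f \<in> borel_measurable borel" and nn: "\<And>x. 0 \<le> f x" and z: "\<And>x. x \<le> 0 \<Longrightarrow> f x = 0"
    using f by (auto simp: size_dist_def)
  define F where "F x = \<bar>1 + x\<bar> * f x" for x
  have [measurable]: "F \<in> borel_measurable borel" unfolding F_def by measurable
  have Fnn: "0 \<le> F x" for x by (simp add: F_def nn)
  have Fi: "integrable lborel F" unfolding F_def
    by (rule size_dist_weighted(1)[OF f, where e = 1 and C = 1]) auto
  have "(LBINT x. F x) \<le> 1 * b + 1 * a"
    unfolding F_def using size_dist_weighted(2)[OF f, of "\<lambda>x. 1 + x" 1 1] by simp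
  then have Fb: "(LBINT x. F x) \<le> a + b" by simp
  have F0: "0 \<le> (LBINT x. F x)" using Fnn by (intro integral_nonneg_AE) auto
  have iF: "integrable plane (\<lambda>p. C * (F (fst p) * F (snd p)))"
  proof (intro integrable_mult_right lborel_pair.Fubini_integrable)
    show "integrable lborel (\<lambda>x. LBINT y. norm (F (fst (x, y)) * F (snd (x, y))))"
      using Fi by (simp add: Fnn abs_mult)
    show "AE x in lborel. integrable lborel (\<lambda>y. F (fst (x, y)) * F (snd (x, y)))"
      using Fi by simp
  qed measurable
  have le: "\<bar>\<psi> x y * f x * f y\<bar> \<le> C * (F x * F y)" for x y
  proof (cases "x > 0 \<and> y > 0")
    case True
    then have "\<bar>\<psi> x y\<bar> * (f x * f y) \<le> (C * (1 + x) * (1 + y)) * (f x * f y)"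
      by (intro mult_right_mono bd) (auto simp: nn)
    then show ?thesis using True nn by (simp add: abs_mult F_def mult_ac)
  next
    case False
    then have "f x * f y = 0" using z by (auto simp: not_less)
    then show ?thesis using Fnn \<open>C \<ge> 0\<close> by auto
  qed
  show i: "integrable plane (\<lambda>(x, y). \<psi> x y * f x * f y)"
    by (rule Bochner_Integration.integrable_bound[OF iF])
       (auto intro!: AE_I2 order_trans[OF le] simp: split_beta)
  have "\<bar>\<integral>(x, y). \<psi> x y * f x * f y \<partial>plane\<bar> \<le> (\<integral>p. \<bar>case p of (x, y) \<Rightarrow> \<psi> x y * f x * f y\<bar> \<partial>plane)"
    by (rule integral_abs_bound)
  also have "\<dots> \<le> (\<integral>p. C * (F (fst p) * F (snd p)) \<partial>plane)"
    by (rule integral_mono[OF integrable_abs[OF i] iF]) (use le in auto)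
  also have "\<dots> = (LBINT x. LBINT y. C * (F x * F y))"
    unfolding lborel_pair.integral_fst'[OF iF, symmetric] by simp
  also have "\<dots> = C * ((LBINT x. F x) * (LBINT x. F x))" by simp
  also have "\<dots> \<le> C * ((a + b) * (a + b))"
    using Fb F0 \<open>C \<ge> 0\<close> by (intro mult_left_mono mult_mono) auto
  finally have 1: "\<bar>\<integral>(x, y). \<psi> x y * f x * f y \<partial>plane\<bar> \<le> C * (a + b)\<^sup>2"
    by (simp add: power2_eq_square)
  show 2: "(LBINT x. LBINT y. \<psi> x y * f x * f y) = (\<integral>(x, y). \<psi> x y * f x * f y \<partial>plane)"
    using lborel_pair.integral_fst'[OF i] by simp
  show "\<bar>LBINT x. LBINT y. \<psi> x y * f x * f y\<bar> \<le> C * (a + b)\<^sup>2"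
    using 1 2 by simp
qed

locale coag_kernel =
  fixes K :: "real \<Rightarrow> real \<Rightarrow> real" and \<kappa> :: real
  assumes K_meas[measurable]: "case_prod K \<in> borel_measurable (borel \<Otimes>\<^sub>M borel)"
    and kappa_pos: "\<kappa> > 0"
    and K_nonneg: "0 \<le> K x y" and K_sym: "K x y = K y x" and K_zero: "x \<le> 0 \<Longrightarrow> K x y = 0"
    and K_le: "x > 0 \<Longrightarrow> y > 0 \<Longrightarrow> K x y \<le> \<kappa> * (1 + x) * (1 + y)"
begin

lemma K_comp[measurable (raw)]:
  assumes "f \<in> borel_measurable M" "g \<in> borel_measurable M"
  shows "(\<lambda>x. K (f x) (g x)) \<in> borel_measurable M"
  using measurable_compose[OF measurable_Pair[OF assms] K_meas] by simp

lemma K_zero': "y \<le> 0 \<Longrightarrow> K x y = 0" using K_zero[of y x] K_sym[of x y] by simp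

definition gain :: "(real \<Rightarrow> real) \<Rightarrow> real \<Rightarrow> real" where
  "gain f x = 1 / 2 * (LBINT y. K y (x - y) * f y * f (x - y))"

definition loss_rate :: "(real \<Rightarrow> real) \<Rightarrow> real \<Rightarrow> real" where
  "loss_rate f x = (LBINT y. K x y * f y)"

definition coag :: "(real \<Rightarrow> real) \<Rightarrow> real \<Rightarrow> real" where
  "coag f x = gain f x - f x * loss_rate f x"

definition weak :: "(real \<Rightarrow> real) \<Rightarrow> (real \<Rightarrow> real) \<Rightarrow> real" where
  "weak \<theta> f = 1 / 2 * (LBINT x. LBINT y. tilde \<theta> x y * K x y * f x * f y)"

lemma coag_meas[measurable]: "f \<in> borel_measurable borel \<Longrightarrow> gain f \<in> borel_measurable borel"
  "f \<in> borel_measurable borel \<Longrightarrow> loss_rate f \<in> borel_measurable borel"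
  "f \<in> borel_measurable borel \<Longrightarrow> coag f \<in> borel_measurable borel"
proof -
  assume [measurable]: "f \<in> borel_measurable borel"
  have "gain f \<in> borel_measurable lborel" unfolding gain_def by measurable
  then show [measurable]: "gain f \<in> borel_measurable borel" by simp
  have "loss_rate f \<in> borel_measurable lborel" unfolding loss_rate_def by measurable
  then show [measurable]: "loss_rate f \<in> borel_measurable borel" by simp
  show "coag f \<in> borel_measurable borel" unfolding coag_def by measurable
qed

text \<open>
  By symmetry of \<open>K\<close> the two clusters lost in a collision contribute equally. In this form the loss
  depends on \<open>\<theta>\<close> only through the outer variable.
\<close>

lemma weak_split:
  assumes f: "size_dist a b f" and [measurable]: "\<theta> \<in> borel_measurable borel" and "C \<ge> 0"
    and bd1: "\<And>x y. x > 0 \<Longrightarrow> y > 0 \<Longrightarrow> \<bar>\<theta> (x + y) * K x y\<bar> \<le> C * (1 + x) * (1 + y)"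
    and bd2: "\<And>x y. x > 0 \<Longrightarrow> y > 0 \<Longrightarrow> \<bar>\<theta> x * K x y\<bar> \<le> C * (1 + x) * (1 + y)"
  shows "integrable plane (\<lambda>(x, y). \<theta> (x + y) * K x y * f x * f y)"
    and "integrable plane (\<lambda>(x, y). \<theta> x * K x y * f x * f y)"
    and "weak \<theta> f = 1 / 2 * (\<integral>(x, y). \<theta> (x + y) * K x y * f x * f y \<partial>plane)
      - (\<integral>(x, y). \<theta> x * K x y * f x * f y \<partial>plane)"
proof -
  have [measurable]: "f \<in> borel_measurable borel" using f by (auto simp: size_dist_def)
  have bd3: "\<bar>\<theta> y * K x y\<bar> \<le> C * (1 + x) * (1 + y)" if "x > 0" "y > 0" for x y
    using bd2[OF that(2,1)] K_sym[of x y] by (simp add: mult_ac)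
  show i1: "integrable plane (\<lambda>(x, y). \<theta> (x + y) * K x y * f x * f y)"
    by (rule pair_weighted(1)[OF f _ bd1 \<open>C \<ge> 0\<close>]) measurable
  show i2: "integrable plane (\<lambda>(x, y). \<theta> x * K x y * f x * f y)"
    by (rule pair_weighted(1)[OF f _ bd2 \<open>C \<ge> 0\<close>]) measurable
  have i3: "integrable plane (\<lambda>(x, y). \<theta> y * K x y * f x * f y)"
    by (rule pair_weighted(1)[OF f _ bd3 \<open>C \<ge> 0\<close>]) measurable
  have swap: "(\<integral>(x, y). \<theta> y * K x y * f x * f y \<partial>plane) = (\<integral>(x, y). \<theta> x * K x y * f x * f y \<partial>plane)"
  proof -
    have "(\<integral>p. (case p of (x, y) \<Rightarrow> \<theta> x * K x y * f x * f y) \<partial>plane)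
      = (\<integral>(x, y). (case (y, x) of (x, y) \<Rightarrow> \<theta> x * K x y * f x * f y) \<partial>plane)"
      by (rule lborel_pair.integral_product_swap[symmetric]) (use i2 in auto)
    also have "\<dots> = (\<integral>(x, y). \<theta> y * K x y * f x * f y \<partial>plane)"
      by (intro Bochner_Integration.integral_cong) (auto simp: K_sym mult_ac)
    finally show ?thesis ..
  qed
  have t: "(\<lambda>p. case p of (x, y) \<Rightarrow> tilde \<theta> x y * K x y * f x * f y) =
    (\<lambda>p. (case p of (x, y) \<Rightarrow> \<theta> (x + y) * K x y * f x * f y) - (case p of (x, y) \<Rightarrow> \<theta> x * K x y * f x * f y)
       - (case p of (x, y) \<Rightarrow> \<theta> y * K x y * f x * f y))"
    by (auto simp: tilde_def fun_eq_iff algebra_simps)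
  have it: "integrable plane (\<lambda>(x, y). tilde \<theta> x y * K x y * f x * f y)"
    unfolding t by (intro Bochner_Integration.integrable_diff i1 i2 i3)
  have "weak \<theta> f = 1 / 2 * (\<integral>(x, y). tilde \<theta> x y * K x y * f x * f y \<partial>plane)"
    unfolding weak_def using lborel_pair.integral_fst'[OF it] by simp
  then show "weak \<theta> f = 1 / 2 * (\<integral>(x, y). \<theta> (x + y) * K x y * f x * f y \<partial>plane)
      - (\<integral>(x, y). \<theta> x * K x y * f x * f y \<partial>plane)"
    unfolding t Bochner_Integration.integral_diff[OF Bochner_Integration.integrable_diff[OF i1 i2] i3]
      Bochner_Integration.integral_diff[OF i1 i2]
    using swap by simp
qed

lemma coag_weak:
  assumes f: "size_dist a b f" and \<theta>: "\<theta> \<in> borel_measurable borel" and C: "C \<ge> 0"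
    and bd1: "\<And>x y. x > 0 \<Longrightarrow> y > 0 \<Longrightarrow> \<bar>\<theta> (x + y) * K x y\<bar> \<le> C * (1 + x) * (1 + y)"
    and bd2: "\<And>x y. x > 0 \<Longrightarrow> y > 0 \<Longrightarrow> \<bar>\<theta> x * K x y\<bar> \<le> C * (1 + x) * (1 + y)"
  shows "integrable lborel (\<lambda>x. \<theta> x * coag f x)"
    and "(LBINT x. \<theta> x * coag f x) = weak \<theta> f"
proof -
  have split: "integrable plane (\<lambda>(x, y). \<theta> (x + y) * K x y * f x * f y)"
    "integrable plane (\<lambda>(x, y). \<theta> x * K x y * f x * f y)"
    "weak \<theta> f = 1 / 2 * (\<integral>(x, y). \<theta> (x + y) * K x y * f x * f y \<partial>plane)
      - (\<integral>(x, y). \<theta> x * K x y * f x * f y \<partial>plane)"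
    by (rule weak_split[OF f \<theta> C bd1 bd2]; assumption)+
  have e: "(\<lambda>x. LBINT y. (case (y, x - y) of (x, y) \<Rightarrow> \<theta> (x + y) * K x y * f x * f y)) = (\<lambda>x. 2 * (\<theta> x * gain f x))"
    by (auto simp: gain_def mult.assoc fun_eq_iff)
  have g: "integrable lborel (\<lambda>x. \<theta> x * gain f x)"
    using shear_integral(1)[OF split(1)] unfolding e by simp
  have gi: "2 * (LBINT x. \<theta> x * gain f x) = (\<integral>(x, y). \<theta> (x + y) * K x y * f x * f y \<partial>plane)"
    using shear_integral(2)[OF split(1)] unfolding e by simp
  have e2: "(\<lambda>x. LBINT y. (case (x, y) of (x, y) \<Rightarrow> \<theta> x * K x y * f x * f y)) = (\<lambda>x. \<theta> x * (f x * loss_rate f x))"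
  proof
    fix x
    have "(LBINT y. (case (x, y) of (x, y) \<Rightarrow> \<theta> x * K x y * f x * f y)) = (LBINT y. (\<theta> x * f x) * (K x y * f y))"
      by (simp add: mult_ac)
    then show "(LBINT y. (case (x, y) of (x, y) \<Rightarrow> \<theta> x * K x y * f x * f y)) = \<theta> x * (f x * loss_rate f x)"
      by (simp add: loss_rate_def mult.assoc)
  qed
  have l: "integrable lborel (\<lambda>x. \<theta> x * (f x * loss_rate f x))"
    using lborel_pair.integrable_fst'[OF split(2)] unfolding e2 .
  have li: "(LBINT x. \<theta> x * (f x * loss_rate f x)) = (\<integral>(x, y). \<theta> x * K x y * f x * f y \<partial>plane)"
    using lborel_pair.integral_fst'[OF split(2)] unfolding e2 .
  have c: "\<theta> x * coag f x = \<theta> x * gain f x - \<theta> x * (f x * loss_rate f x)" for x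
    by (simp add: coag_def right_diff_distrib)
  show "integrable lborel (\<lambda>x. \<theta> x * coag f x)" unfolding c using g l by simp
  show "(LBINT x. \<theta> x * coag f x) = weak \<theta> f"
    unfolding c split(3) using g l gi li by simp
qed

lemma tilde_bound: "(\<And>x. \<bar>\<theta> x\<bar> \<le> c) \<Longrightarrow> \<bar>tilde \<theta> x y\<bar> \<le> 3 * c"
  unfolding tilde_def by (smt (verit))

lemma bounded_times_K:
  assumes "\<bar>t\<bar> \<le> c" "x > 0" "y > 0"
  shows "\<bar>t * K x y\<bar> \<le> (c * \<kappa>) * (1 + x) * (1 + y)"
proof -
  have "\<bar>t\<bar> * \<bar>K x y\<bar> \<le> c * (\<kappa> * (1 + x) * (1 + y))"
    using assms K_le[of x y] K_nonneg[of x y] by (intro mult_mono) auto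
  then show ?thesis by (simp add: abs_mult mult.assoc)
qed

lemma weak_bound:
  assumes f: "size_dist a b f" and [measurable]: "\<theta> \<in> borel_measurable borel" and bd: "\<And>x. \<bar>\<theta> x\<bar> \<le> c"
  shows "\<bar>weak \<theta> f\<bar> \<le> 3 / 2 * c * \<kappa> * (a + b)\<^sup>2"
proof -
  have "0 \<le> c" using bd[of 0] by linarith
  have "\<bar>LBINT x. LBINT y. tilde \<theta> x y * K x y * f x * f y\<bar> \<le> (3 * c * \<kappa>) * (a + b)\<^sup>2"
  proof (rule pair_weighted(2)[OF f])
    show "(\<lambda>(x, y). tilde \<theta> x y * K x y) \<in> borel_measurable (borel \<Otimes>\<^sub>M borel)"
      unfolding tilde_def by measurable
  qed (use \<open>0 \<le> c\<close> kappa_pos bounded_times_K[OF tilde_bound[OF bd]] in auto)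
  then show ?thesis by (simp add: weak_def abs_mult)
qed

lemma coag_weak_bounded:
  assumes f: "size_dist a b f" and "\<theta> \<in> borel_measurable borel" and bd: "\<And>x. \<bar>\<theta> x\<bar> \<le> c"
  shows "integrable lborel (\<lambda>x. \<theta> x * coag f x)" "(LBINT x. \<theta> x * coag f x) = weak \<theta> f"
proof -
  have "0 \<le> c" using bd[of 0] by linarith
  then show "integrable lborel (\<lambda>x. \<theta> x * coag f x)" "(LBINT x. \<theta> x * coag f x) = weak \<theta> f"
    using coag_weak[OF f assms(2), of "c * \<kappa>"] bounded_times_K[OF bd] kappa_pos by auto
qed

text \<open>
  Here the factor \<open>\<theta> (x + y) / 2 - \<theta> x\<close> vanishes for large \<open>x\<close> if \<open>\<theta>\<close> does, whatever the size of
  \<open>y\<close>, while \<open>tilde \<theta> x y\<close> still contains \<open>\<theta> y\<close>. It is therefore this expression that passes to the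
  limit: the outer variable stays bounded and only the inner one requires sublinearity.
\<close>

lemma weak_asymmetric:
  assumes f: "size_dist a b f" and \<theta>: "\<theta> \<in> borel_measurable borel" and bd: "\<And>x. \<bar>\<theta> x\<bar> \<le> c"
  shows "weak \<theta> f = (LBINT x. f x * (LBINT y. (\<theta> (x + y) / 2 - \<theta> x) * K x y * f y))"
proof -
  have ck: "0 \<le> c * \<kappa>" using bd[of 0] kappa_pos by (simp add: order_trans[OF abs_ge_zero])
  have split: "integrable plane (\<lambda>(x, y). \<theta> (x + y) * K x y * f x * f y)"
    "integrable plane (\<lambda>(x, y). \<theta> x * K x y * f x * f y)"
    "weak \<theta> f = 1 / 2 * (\<integral>(x, y). \<theta> (x + y) * K x y * f x * f y \<partial>plane)
      - (\<integral>(x, y). \<theta> x * K x y * f x * f y \<partial>plane)"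
    by (rule weak_split[OF f \<theta> ck bounded_times_K[OF bd] bounded_times_K[OF bd]]; assumption)+
  have s: "(\<lambda>p. case p of (x, y) \<Rightarrow> (\<theta> (x + y) / 2 - \<theta> x) * K x y * f x * f y) =
    (\<lambda>p. 1 / 2 * (case p of (x, y) \<Rightarrow> \<theta> (x + y) * K x y * f x * f y) - (case p of (x, y) \<Rightarrow> \<theta> x * K x y * f x * f y))"
    by (auto simp: fun_eq_iff algebra_simps)
  have i: "integrable plane (\<lambda>(x, y). (\<theta> (x + y) / 2 - \<theta> x) * K x y * f x * f y)"
    unfolding s by (intro Bochner_Integration.integrable_diff integrable_mult_right split)
  have "weak \<theta> f = (\<integral>(x, y). (\<theta> (x + y) / 2 - \<theta> x) * K x y * f x * f y \<partial>plane)"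
    unfolding s split(3) Bochner_Integration.integral_diff[OF integrable_mult_right[OF split(1)] split(2)]
    by simp
  also have "\<dots> = (LBINT x. LBINT y. (\<theta> (x + y) / 2 - \<theta> x) * K x y * f x * f y)"
    using lborel_pair.integral_fst'[OF i] by simp
  also have "\<dots> = (LBINT x. f x * (LBINT y. (\<theta> (x + y) / 2 - \<theta> x) * K x y * f y))"
  proof (intro Bochner_Integration.integral_cong refl)
    fix x
    have "(LBINT y. (\<theta> (x + y) / 2 - \<theta> x) * K x y * f x * f y) = (LBINT y. f x * ((\<theta> (x + y) / 2 - \<theta> x) * K x y * f y))"
      by (simp add: mult_ac)
    then show "(LBINT y. (\<theta> (x + y) / 2 - \<theta> x) * K x y * f x * f y) = f x * (LBINT y. (\<theta> (x + y) / 2 - \<theta> x) * K x y * f y)"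
      by simp
  qed
  finally show ?thesis .
qed

lemma coag_integrable:
  assumes f: "size_dist a b f"
  shows "integrable lborel (coag f)"
  using coag_weak_bounded(1)[OF f, of "\<lambda>_. 1" 1] by simp

section \<open>The explicit Euler scheme\<close>

primrec euler :: "real \<Rightarrow> (real \<Rightarrow> real) \<Rightarrow> nat \<Rightarrow> real \<Rightarrow> real" where
  "euler h u 0 = u"
| "euler h u (Suc j) = (\<lambda>x. euler h u j x + h * coag (euler h u j) x)"

text \<open>
  The step preserves the sign because the rate of loss is at most \<open>B * a\<close>. The bounded support of
  the kernel makes \<open>\<theta> x = x\<close> an admissible test function, for which \<open>tilde \<theta>\<close> vanishes, so mass is
  conserved; for \<open>\<theta> x = 1\<close> it is \<open>-1\<close>, so the number of clusters decreases.
\<close>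

lemma euler_step_dist:
  assumes f: "size_dist a b f" and h: "0 \<le> h" "h * (B * a) \<le> 1"
    and K: "\<And>x y. K x y \<le> B" and sup: "\<And>x y. y > R \<Longrightarrow> K x y = 0"
  shows "size_dist a b (\<lambda>x. f x + h * coag f x)"
proof -
  have [measurable]: "f \<in> borel_measurable borel" and nn: "\<And>x. 0 \<le> f x" and z: "\<And>x. x \<le> 0 \<Longrightarrow> f x = 0"
    and fi: "integrable lborel f" "integrable lborel (\<lambda>x. x * f x)"
    and fa: "(LBINT x. f x) \<le> a" and fb: "(LBINT x. x * f x) \<le> b"
    using f by (auto simp: size_dist_def)
  have B: "0 \<le> B" using K[of 0 0] K_nonneg[of 0 0] by linarith
  have gain_nn: "0 \<le> gain f x" for x
    unfolding gain_def by (intro mult_nonneg_nonneg integral_nonneg_AE AE_I2) (auto simp: K_nonneg nn)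
  have loss: "loss_rate f x \<le> B * a" for x
  proof -
    have "(LBINT y. K x y * f y) \<le> 0 * b + B * a"
      by (rule order_trans[OF abs_ge_self size_dist_weighted(3)[OF f]]) (use K K_nonneg B in auto)
    then show ?thesis by (simp add: loss_rate_def)
  qed
  have gain0: "gain f x = 0" if "x \<le> 0" for x
  proof -
    have "K y (x - y) = 0" for y using that K_zero[of y] K_zero'[of "x - y"] by (cases "y \<le> 0") auto
    then show ?thesis by (simp add: gain_def)
  qed
  define R' where "R' = max R 0"
  have R': "R' \<ge> 0" "\<And>x y. y > R' \<Longrightarrow> K x y = 0" using sup by (auto simp: R'_def)
  have bd: "\<bar>t * K x y\<bar> \<le> (2 * R' * \<kappa>) * (1 + x) * (1 + y)" if "x > 0" "y > 0" "t = x + y \<or> t = x" for x y t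
  proof (cases "x \<le> R' \<and> y \<le> R'")
    case True
    then show ?thesis using that by (intro bounded_times_K) auto
  next
    case False
    then have "K x y = 0" using R'(2)[of y x] R'(2)[of x y] K_sym[of x y] by auto
    then show ?thesis using that R' kappa_pos by simp
  qed
  have w0: "weak (\<lambda>_. 1) f \<le> 0"
  proof -
    have "0 \<le> (LBINT x. LBINT y. K x y * f x * f y)"
      by (intro integral_nonneg_AE AE_I2) (auto simp: K_nonneg nn)
    then show ?thesis by (simp add: weak_def tilde_def)
  qed
  have w1: "weak (\<lambda>x. x) f = 0" by (simp add: weak_def tilde_def)
  have C: "0 \<le> 2 * R' * \<kappa>" using R' kappa_pos by simp
  have c1: "integrable lborel (\<lambda>x. x * coag f x)" "(LBINT x. x * coag f x) = weak (\<lambda>x. x) f"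
    using coag_weak[OF f _ C, of "\<lambda>x. x"] bd by simp_all
  have c0: "(LBINT x. coag f x) = weak (\<lambda>_. 1) f"
    using coag_weak_bounded(2)[OF f, of "\<lambda>_. 1" 1] by simp
  note i0 = coag_integrable[OF f]
  show ?thesis
    unfolding size_dist_def
  proof (intro conjI allI impI)
    show "(\<lambda>x. f x + h * coag f x) \<in> borel_measurable borel" by measurable
    fix x
    have "h * loss_rate f x \<le> h * (B * a)" using loss h by (intro mult_left_mono)
    \<comment> \<open>The new density regrouped as a sum of two non-negative terms.\<close>
    then have "0 \<le> f x * (1 - h * loss_rate f x) + h * gain f x"
      using h nn[of x] gain_nn[of x] by (intro add_nonneg_nonneg mult_nonneg_nonneg) auto
    then show "0 \<le> f x + h * coag f x" by (simp add: coag_def algebra_simps)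
    show "f x + h * coag f x = 0" if "x \<le> 0" using that by (simp add: z gain0 coag_def)
  next
    show "integrable lborel (\<lambda>x. f x + h * coag f x)" using fi i0 by simp
    have e: "x * (f x + h * coag f x) = x * f x + h * (x * coag f x)" for x by (simp add: algebra_simps)
    show "integrable lborel (\<lambda>x. x * (f x + h * coag f x))" unfolding e using fi c1 by simp
    have "(LBINT x. f x + h * coag f x) = (LBINT x. f x) + h * weak (\<lambda>_. 1) f"
      using fi i0 c0 by simp
    also have "\<dots> \<le> a" using fa mult_nonneg_nonpos[OF h(1) w0] by linarith
    finally show "(LBINT x. f x + h * coag f x) \<le> a" .
    show "(LBINT x. x * (f x + h * coag f x)) \<le> b"
      unfolding e using fi c1 w1 fb by simp
  qed
qed

lemma euler_dist:
  assumes "size_dist a b u" "0 \<le> h" "h * (B * a) \<le> 1"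
    and "\<And>x y. K x y \<le> B" "\<And>x y. y > R \<Longrightarrow> K x y = 0"
  shows "size_dist a b (euler h u j)"
proof (induction j)
  case (Suc j)
  show ?case using euler_step_dist[OF Suc assms(2-5)] by simp
qed (use assms(1) in simp)

end

section \<open>A pointwise majorant\<close>

definition self_conv :: "(real \<Rightarrow> ennreal) \<Rightarrow> real \<Rightarrow> ennreal" where
  "self_conv V x = (\<integral>\<^sup>+y. V y * V (x - y) \<partial>lborel)"

text \<open>
  Picard iterates for \<open>U = u + q * (U \<star> U)\<close>. They increase and may take the value \<open>\<infinity>\<close>; their
  integrability is read off from the Laplace transform.
\<close>

primrec majorant :: "real \<Rightarrow> (real \<Rightarrow> real) \<Rightarrow> nat \<Rightarrow> real \<Rightarrow> ennreal" where
  "majorant q u 0 = (\<lambda>x. ennreal (u x))"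
| "majorant q u (Suc j) = (\<lambda>x. ennreal (u x) + ennreal q * self_conv (majorant q u j) x)"

lemma self_conv_meas[measurable]:
  assumes [measurable]: "V \<in> borel_measurable borel"
  shows "self_conv V \<in> borel_measurable borel"
proof -
  have "self_conv V \<in> borel_measurable lborel" unfolding self_conv_def by measurable
  then show ?thesis by simp
qed

lemma self_conv_mono: "(\<And>x. V x \<le> W x) \<Longrightarrow> self_conv V x \<le> self_conv W x"
  unfolding self_conv_def by (intro nn_integral_mono mult_mono) auto

lemma majorant_meas[measurable]: "u \<in> borel_measurable borel \<Longrightarrow> majorant q u j \<in> borel_measurable borel"
proof (induction j)
  case (Suc j)
  then have [measurable]: "u \<in> borel_measurable borel" "majorant q u j \<in> borel_measurable borel" by auto
  show ?case unfolding majorant.simps by measurable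
qed (simp, measurable)

lemma majorant_Suc_mono: "majorant q u j x \<le> majorant q u (Suc j) x"
proof (induction j arbitrary: x)
  case (Suc j)
  have "self_conv (majorant q u j) x \<le> self_conv (majorant q u (Suc j)) x"
    by (rule self_conv_mono) (rule Suc)
  then show ?case unfolding majorant.simps(2)[of q u j] majorant.simps(2)[of q u "Suc j"]
    by (intro add_left_mono mult_left_mono) auto
qed simp

text \<open>
  The Laplace transform is multiplicative because \<open>exp (- l * x)\<close> splits along \<open>x = y + (x - y)\<close>.
\<close>

lemma laplace_self_conv:
  fixes V :: "real \<Rightarrow> ennreal" and l :: real
  assumes [measurable]: "V \<in> borel_measurable borel"
  shows "(\<integral>\<^sup>+x. ennreal (exp (- l * x)) * self_conv V x \<partial>lborel) = (\<integral>\<^sup>+x. ennreal (exp (- l * x)) * V x \<partial>lborel)\<^sup>2"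
proof -
  let ?G = "\<lambda>x. ennreal (exp (- l * x)) * V x"
  have "(\<integral>\<^sup>+x. ennreal (exp (- l * x)) * self_conv V x \<partial>lborel) = (\<integral>\<^sup>+x. \<integral>\<^sup>+y. ?G y * ?G (x - y) \<partial>lborel \<partial>lborel)"
  proof (rule nn_integral_cong)
    fix x
    have "ennreal (exp (- l * x)) * self_conv V x = (\<integral>\<^sup>+y. ennreal (exp (- l * x)) * (V y * V (x - y)) \<partial>lborel)"
      unfolding self_conv_def by (rule nn_integral_cmult[symmetric]) measurable
    also have "\<dots> = (\<integral>\<^sup>+y. ?G y * ?G (x - y) \<partial>lborel)"
    proof (rule nn_integral_cong)
      fix y
      have "exp (- l * x) = exp (- l * y) * exp (- l * (x - y))" by (simp add: exp_add[symmetric] algebra_simps)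
      then show "ennreal (exp (- l * x)) * (V y * V (x - y)) = ?G y * ?G (x - y)"
        by (simp add: ennreal_mult mult_ac)
    qed
    finally show "ennreal (exp (- l * x)) * self_conv V x = (\<integral>\<^sup>+y. ?G y * ?G (x - y) \<partial>lborel)" .
  qed
  also have "\<dots> = (\<integral>\<^sup>+y. \<integral>\<^sup>+z. ?G y * ?G z \<partial>lborel \<partial>lborel)"
    using nn_integral_shear[of "\<lambda>p. ?G (fst p) * ?G (snd p)"] by simp
  also have "\<dots> = (\<integral>\<^sup>+x. ?G x \<partial>lborel)\<^sup>2"
    by (simp add: nn_integral_cmult nn_integral_multc power2_eq_square)
  finally show ?thesis .
qed

text \<open>
  With \<open>M\<close> for the transform of an iterate, the next one has transform at most \<open>m + q * M\<^sup>2\<close>; if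
  \<open>4 * q * m \<le> 1\<close>, the interval from \<open>0\<close> to \<open>2 * m\<close> is invariant under this map.
\<close>

lemma laplace_majorant:
  fixes l m q :: real
  assumes [measurable]: "u \<in> borel_measurable borel" and m: "m \<ge> 0" "q \<ge> 0" "4 * q * m \<le> 1"
    and u: "(\<integral>\<^sup>+x. ennreal (exp (- l * x)) * ennreal (u x) \<partial>lborel) \<le> ennreal m"
  shows "(\<integral>\<^sup>+x. ennreal (exp (- l * x)) * majorant q u j x \<partial>lborel) \<le> ennreal (2 * m)"
proof (induction j)
  case 0
  have "ennreal m \<le> ennreal (2 * m)" using m by (intro ennreal_leI) auto
  with u show ?case by simp
next
  case (Suc j)
  let ?e = "\<lambda>x. ennreal (exp (- l * x))"
  have "(\<integral>\<^sup>+x. ?e x * majorant q u (Suc j) x \<partial>lborel) =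
     (\<integral>\<^sup>+x. ?e x * ennreal (u x) + ennreal q * (?e x * self_conv (majorant q u j) x) \<partial>lborel)"
    by (simp add: distrib_left mult_ac)
  also have "\<dots> = (\<integral>\<^sup>+x. ?e x * ennreal (u x) \<partial>lborel) + ennreal q * (\<integral>\<^sup>+x. ?e x * majorant q u j x \<partial>lborel)\<^sup>2"
    unfolding laplace_self_conv[OF majorant_meas[OF assms(1)], symmetric] by (simp add: nn_integral_add nn_integral_cmult)
  also have "\<dots> \<le> ennreal m + ennreal q * (ennreal (2 * m))\<^sup>2"
    using u Suc by (intro add_mono mult_left_mono power_mono) auto
  also have "\<dots> = ennreal (m + q * (2 * m)\<^sup>2)"
    using m by (simp add: ennreal_mult ennreal_power)
  also have "\<dots> \<le> ennreal (2 * m)"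
  proof (rule ennreal_leI)
    have "(4 * q * m) * m \<le> 1 * m" using m by (intro mult_right_mono) auto
    then show "m + q * (2 * m)\<^sup>2 \<le> 2 * m" by (simp add: power2_eq_square algebra_simps)
  qed
  finally show ?case .
qed

lemma laplace_tendsto_0:
  assumes u: "size_dist a b u"
  shows "(\<lambda>n. LBINT x. exp (- real n * x) * u x) \<longlonglongrightarrow> 0"
proof -
  have [measurable]: "u \<in> borel_measurable borel" and nn: "\<And>x. 0 \<le> u x" and z: "\<And>x. x \<le> 0 \<Longrightarrow> u x = 0"
    and ui: "integrable lborel u"
    using u by (auto simp: size_dist_def)
  have "(\<lambda>n. LBINT x. exp (- real n * x) * u x) \<longlonglongrightarrow> (LBINT x::real. 0)"
  proof (rule integral_dominated_convergence)
    show "integrable lborel u" by (fact ui)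
    show "AE x in lborel. norm (exp (- real n * x) * u x) \<le> u x" for n
    proof (rule AE_I2)
      fix x show "norm (exp (- real n * x) * u x) \<le> u x"
        using nn[of x] z[of x] by (cases "x \<le> 0") (auto simp: abs_mult intro!: mult_left_le_one_le)
    qed
    show "AE x in lborel. (\<lambda>n. exp (- real n * x) * u x) \<longlonglongrightarrow> 0"
    proof (rule AE_I2)
      fix x
      show "(\<lambda>n. exp (- real n * x) * u x) \<longlonglongrightarrow> 0"
      proof (cases "x \<le> 0")
        case False
        have "(\<lambda>n. exp (- x) ^ n) \<longlonglongrightarrow> 0" using False by (intro LIMSEQ_power_zero) auto
        then have "(\<lambda>n. exp (- x) ^ n * u x) \<longlonglongrightarrow> 0 * u x" by (intro tendsto_mult tendsto_const)
        then show ?thesis by (simp add: exp_of_nat_mult[symmetric] mult_ac)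
      qed (simp add: z)
    qed
  qed auto
  then show ?thesis by simp
qed

text \<open>
  However large \<open>q\<close> is, the transform of \<open>u\<close> at a large \<open>l\<close> is so small that the quadratic iteration
  stays bounded. On sizes below \<open>R\<close> the weight is bounded from below, which makes the supremum of the
  iterates integrable there.
\<close>

lemma majorant_integrable:
  assumes u: "size_dist a b u" and q: "q \<ge> 0"
  shows "\<exists>g. integrable lborel g \<and> (\<forall>j. AE x in lborel. x \<le> R \<longrightarrow> majorant q u j x \<le> ennreal (g x))"
proof -
  have [measurable]: "u \<in> borel_measurable borel" and nn: "\<And>x. 0 \<le> u x" and z: "\<And>x. x \<le> 0 \<Longrightarrow> u x = 0"
    using u by (auto simp: size_dist_def)
  define m where "m n = (LBINT x. exp (- real n * x) * u x)" for n :: nat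
  have "m \<longlonglongrightarrow> 0" using laplace_tendsto_0[OF u] unfolding m_def .
  then have "(\<lambda>n. 4 * q * m n) \<longlonglongrightarrow> 4 * q * 0" by (intro tendsto_intros)
  then have "\<forall>\<^sub>F n in sequentially. 4 * q * m n < 1" by (intro order_tendstoD(2)[where y = "4 * q * 0"]) auto
  then obtain n where n: "4 * q * m n \<le> 1" by (auto simp: eventually_sequentially intro: less_imp_le)
  define l where "l = real n"
  have e: "integrable lborel (\<lambda>x. exp (- l * x) * u x)"
    by (rule size_dist_weighted(1)[OF u, of _ 0 1]) (auto simp: l_def)
  have enn: "(\<integral>\<^sup>+x. ennreal (exp (- l * x)) * ennreal (u x) \<partial>lborel) = ennreal (m n)"
    using nn_integral_eq_integral[OF e] nn by (simp add: m_def l_def ennreal_mult[symmetric])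
  have m0: "0 \<le> m n" unfolding m_def using nn by (intro integral_nonneg_AE) auto
  define U where "U x = (SUP j. majorant q u j x)" for x
  have [measurable]: "U \<in> borel_measurable borel" unfolding U_def by measurable
  have inc: "incseq (\<lambda>j. majorant q u j)"
    by (rule incseq_SucI) (simp only: le_fun_def majorant_Suc_mono simp_thms)
  have inc': "incseq (\<lambda>j x. ennreal (exp (- l * x)) * majorant q u j x)"
    using inc by (auto simp: incseq_def le_fun_def intro!: mult_left_mono)
  have "(\<integral>\<^sup>+x. ennreal (exp (- l * x)) * U x \<partial>lborel) = (\<integral>\<^sup>+x. (SUP j. ennreal (exp (- l * x)) * majorant q u j x) \<partial>lborel)"
    by (simp add: U_def SUP_mult_left_ennreal)
  also have "\<dots> = (SUP j. \<integral>\<^sup>+x. ennreal (exp (- l * x)) * majorant q u j x \<partial>lborel)"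
    by (rule nn_integral_monotone_convergence_SUP[OF inc']) measurable
  also have "\<dots> \<le> ennreal (2 * m n)"
    using m0 q n enn by (intro SUP_least laplace_majorant) auto
  finally have U: "(\<integral>\<^sup>+x. ennreal (exp (- l * x)) * U x \<partial>lborel) \<le> ennreal (2 * m n)" .
  then have "(\<integral>\<^sup>+x. ennreal (exp (- l * x)) * U x \<partial>lborel) \<noteq> \<infinity>" by (auto simp: top_unique)
  then have "AE x in lborel. ennreal (exp (- l * x)) * U x \<noteq> \<infinity>" by (intro nn_integral_noteq_infinite) auto
  then have fin: "AE x in lborel. U x \<noteq> \<infinity>" by eventually_elim (auto simp: ennreal_mult_eq_top_iff)
  define g where "g x = indicator {..R} x * enn2real (U x)" for x
  have gm: "g \<in> borel_measurable lborel" unfolding g_def by measurable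
  have "(\<integral>\<^sup>+x. ennreal (g x) \<partial>lborel) \<le> (\<integral>\<^sup>+x. ennreal (exp (l * R)) * (ennreal (exp (- l * x)) * U x) \<partial>lborel)"
  proof (rule nn_integral_mono)
    fix x
    show "ennreal (g x) \<le> ennreal (exp (l * R)) * (ennreal (exp (- l * x)) * U x)"
    proof (cases "x \<le> R")
      case True
      have "ennreal (g x) \<le> 1 * U x" using True by (cases "U x") (auto simp: g_def)
      also have "\<dots> \<le> ennreal (exp (l * R) * exp (- l * x)) * U x"
      proof (rule mult_right_mono)
        have "0 \<le> l * R + - l * x" using True by (simp add: l_def mult_left_mono)
        then have "1 \<le> exp (l * R) * exp (- l * x)" by (simp flip: exp_add)
        then show "1 \<le> ennreal (exp (l * R) * exp (- l * x))" by (simp add: ennreal_ge_1)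
      qed simp
      finally show ?thesis by (simp add: ennreal_mult mult.assoc)
    qed (simp add: g_def)
  qed
  also have "\<dots> = ennreal (exp (l * R)) * (\<integral>\<^sup>+x. ennreal (exp (- l * x)) * U x \<partial>lborel)"
    by (rule nn_integral_cmult) measurable
  also have "\<dots> < \<infinity>" using U by (auto simp: ennreal_mult_less_top intro: le_less_trans)
  finally have "integrable lborel g" by (intro integrableI_nonneg[OF gm]) (auto simp: g_def)
  moreover have "AE x in lborel. x \<le> R \<longrightarrow> majorant q u j x \<le> ennreal (g x)" for j
    using fin
  proof eventually_elim
    case (elim x)
    have "majorant q u j x \<le> U x" unfolding U_def by (rule SUP_upper) simp
    then show ?case using elim by (auto simp: g_def less_top)
  qed
  ultimately show ?thesis by blast
qed

context coag_kernel begin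

text \<open>
  Clusters of size \<open>x \<le> R\<close> arise only from smaller ones, so bounds on \<open>K\<close> and on the density below \<open>R\<close>
  suffice. The Bochner integral in \<open>gain\<close> is \<open>0\<close> where it diverges, so the estimate holds at every \<open>x\<close>.
\<close>

lemma gain_le_self_conv:
  assumes [measurable]: "f \<in> borel_measurable borel" and nn: "\<And>x. 0 \<le> f x"
    and K: "\<And>x y. x \<le> R \<Longrightarrow> y \<le> R \<Longrightarrow> K x y \<le> c" "c \<ge> 0"
    and Fm: "F \<in> borel_measurable borel" and F: "\<And>y. y \<le> R \<Longrightarrow> ennreal (f y) \<le> F y" and x: "x \<le> R"
  shows "ennreal (gain f x) \<le> ennreal c * self_conv F x"
proof -
  let ?h = "\<lambda>y. K y (x - y) * f y * f (x - y)"
  have h: "0 \<le> ?h y" for y by (simp add: K_nonneg nn)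
  have "gain f x \<le> (LBINT y. ?h y)" unfolding gain_def using h by (simp add: integral_nonneg_AE)
  also have "(LBINT y. ?h y) = enn2real (\<integral>\<^sup>+y. ennreal (?h y) \<partial>lborel)"
    by (rule integral_eq_nn_integral) (use h in auto)
  finally have "ennreal (gain f x) \<le> ennreal (enn2real (\<integral>\<^sup>+y. ennreal (?h y) \<partial>lborel))" by (rule ennreal_leI)
  also have "\<dots> \<le> (\<integral>\<^sup>+y. ennreal (?h y) \<partial>lborel)"
    by (cases "(\<integral>\<^sup>+y. ennreal (?h y) \<partial>lborel)") auto
  also have "\<dots> \<le> (\<integral>\<^sup>+y. ennreal c * (F y * F (x - y)) \<partial>lborel)"
  proof (rule nn_integral_mono)
    fix y
    show "ennreal (?h y) \<le> ennreal c * (F y * F (x - y))"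
    proof (cases "y \<le> 0 \<or> x - y \<le> 0")
      case True
      then have "K y (x - y) = 0" using K_zero K_zero' by auto
      then show ?thesis by simp
    next
      case False
      then have le: "y \<le> R" "x - y \<le> R" using x by auto
      have "ennreal (?h y) = ennreal (K y (x - y)) * (ennreal (f y) * ennreal (f (x - y)))"
        by (simp add: ennreal_mult K_nonneg nn mult.assoc)
      also have "\<dots> \<le> ennreal c * (F y * F (x - y))"
        using le K F by (intro mult_mono ennreal_leI) auto
      finally show ?thesis .
    qed
  qed
  also have "\<dots> = ennreal c * self_conv F x"
  proof -
    note Fm[measurable]
    show ?thesis unfolding self_conv_def by (rule nn_integral_cmult) measurable
  qed
  finally show ?thesis .
qed

text \<open>
  Summing the gains of \<open>j\<close> steps, each at most \<open>h * c\<close> times the convolution square of the majorant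
  at the preceding index, gives \<open>h * c * j \<le> q\<close> times that square: total elapsed time, not the
  number of steps, enters the bound, so it is uniform in the step size.
\<close>

lemma euler_le_majorant:
  assumes d: "\<And>j. size_dist a b (euler h u j)" and "h \<ge> 0"
    and K: "\<And>x y. x \<le> R \<Longrightarrow> y \<le> R \<Longrightarrow> K x y \<le> c" "c \<ge> 0"
    and q: "c * (h * real j) \<le> q" and x: "x \<le> R"
  shows "ennreal (euler h u j x) \<le> majorant q u (Suc j) x"
proof -
  have [measurable]: "euler h u j \<in> borel_measurable borel" and nn: "0 \<le> euler h u j x" for j x
    using d[of j] by (auto simp: size_dist_def)
  have um[measurable]: "u \<in> borel_measurable borel" using d[of 0] by (auto simp: size_dist_def)
  \<comment> \<open>The factor grows with j, so the induction carries c * (h * j) in place of q.\<close>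
  have claim: "ennreal (euler h u j x) \<le> ennreal (u x) + ennreal (c * (h * real j)) * self_conv (majorant q u j) x"
    if "c * (h * real j) \<le> q" "x \<le> R" for j x
    using that
  proof (induction j arbitrary: x)
    case (Suc j)
    let ?f = "euler h u j" and ?M = "self_conv (majorant q u j)" and ?M' = "self_conv (majorant q u (Suc j))"
    have "c * (h * real j) \<le> c * (h * real (Suc j))" using K(2) \<open>h \<ge> 0\<close> by (intro mult_left_mono) auto
    then have q': "c * (h * real j) \<le> q" using Suc.prems by linarith
    have MM: "?M y \<le> ?M' y" for y by (rule self_conv_mono) (rule majorant_Suc_mono)
    have fM: "ennreal (?f y) \<le> majorant q u (Suc j) y" if "y \<le> R" for y
    proof -
      have "ennreal (?f y) \<le> ennreal (u y) + ennreal (c * (h * real j)) * ?M y" by (rule Suc.IH[OF q' that])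
      also have "\<dots> \<le> ennreal (u y) + ennreal q * ?M y"
        using q' by (intro add_left_mono mult_right_mono ennreal_leI) auto
      finally show ?thesis by simp
    qed
    have ln: "0 \<le> loss_rate ?f x" unfolding loss_rate_def
      by (intro integral_nonneg_AE AE_I2) (auto simp: K_nonneg nn)
    have gn: "0 \<le> gain ?f x" unfolding gain_def
      by (intro mult_nonneg_nonneg integral_nonneg_AE AE_I2) (auto simp: K_nonneg nn)
    have "coag ?f x \<le> gain ?f x" unfolding coag_def using ln nn[of j x] by simp
    then have "euler h u (Suc j) x \<le> ?f x + h * gain ?f x"
      using \<open>h \<ge> 0\<close> by (simp add: mult_left_mono)
    then have "ennreal (euler h u (Suc j) x) \<le> ennreal (?f x) + ennreal h * ennreal (gain ?f x)"
      using \<open>h \<ge> 0\<close> gn nn by (simp add: ennreal_leI flip: ennreal_mult ennreal_plus)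
    also have "\<dots> \<le> (ennreal (u x) + ennreal (c * (h * real j)) * ?M x) + ennreal h * (ennreal c * ?M' x)"
      using Suc.prems by (intro add_mono mult_left_mono Suc.IH q' gain_le_self_conv[OF _ nn K _ fM]) auto
    also have "\<dots> \<le> (ennreal (u x) + ennreal (c * (h * real j)) * ?M' x) + ennreal h * (ennreal c * ?M' x)"
      using MM by (intro add_mono mult_left_mono) auto
    also have "\<dots> = ennreal (u x) + ennreal (c * (h * real (Suc j))) * ?M' x"
    proof -
      have "ennreal (c * (h * real (Suc j))) = ennreal (c * (h * real j)) + ennreal h * ennreal c"
        using K(2) \<open>h \<ge> 0\<close> by (simp add: algebra_simps flip: ennreal_mult ennreal_plus)
      then show ?thesis by (simp add: distrib_right add.assoc mult.assoc)
    qed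
    finally show ?case .
  qed simp
  have "ennreal (euler h u j x) \<le> ennreal (u x) + ennreal (c * (h * real j)) * self_conv (majorant q u j) x"
    by (rule claim[OF q x])
  also have "\<dots> \<le> ennreal (u x) + ennreal q * self_conv (majorant q u j) x"
    using q by (intro add_left_mono mult_right_mono ennreal_leI) auto
  finally show ?thesis by simp
qed

end

section \<open>Convergence of quadratic expressions\<close>

text \<open>
  A product of two weakly convergent sequences converges here because integration against \<open>\<Psi>\<close> is
  smoothing: the inner integrals \<open>A n x\<close> converge for every \<open>x\<close>, are bounded, and vanish for
  \<open>x > R\<close>. Against the majorant on sizes up to \<open>R\<close> they converge in the mean, which leaves a weak limit with the fixed
  bounded test function \<open>L\<close>. The bounds \<open>N n\<close> accommodate kernels cut off in \<open>y\<close>.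
\<close>

lemma (in dominated_dists) bilinear_limit:
  fixes \<Psi> :: "real \<Rightarrow> real \<Rightarrow> real" and N :: "nat \<Rightarrow> real"
  assumes w: "size_dist a b w"
    and lim: "\<And>\<phi>. sublinear \<phi> \<Longrightarrow> (\<lambda>n. LBINT x. \<phi> x * v n x) \<longlonglongrightarrow> (LBINT x. \<phi> x * w x)"
    and [measurable]: "case_prod \<Psi> \<in> borel_measurable (borel \<Otimes>\<^sub>M borel)"
    and bd: "\<And>x y. y > 0 \<Longrightarrow> \<bar>\<Psi> x y\<bar> \<le> C * (1 + y)" and C: "C \<ge> 0"
    and sup: "\<And>x y. x > R \<Longrightarrow> \<Psi> x y = 0"
    and sub: "\<And>x. sublinear (\<Psi> x)"
    and N: "filterlim N at_top sequentially"
  shows "(\<lambda>n. LBINT x. v n x * (LBINT y. indicator {..N n} y * \<Psi> x y * v n y)) \<longlonglongrightarrow>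
    (LBINT x. w x * (LBINT y. \<Psi> x y * w y))"
proof -
  have [measurable]: "w \<in> borel_measurable borel" using w by (auto simp: size_dist_def)
  define A where "A n x = (LBINT y. indicator {..N n} y * \<Psi> x y * v n y)" for n x
  define L where "L x = (LBINT y. \<Psi> x y * w y)" for x
  have "A n \<in> borel_measurable lborel" for n unfolding A_def by measurable
  then have [measurable]: "A n \<in> borel_measurable borel" for n by simp
  have "L \<in> borel_measurable lborel" unfolding L_def by measurable
  then have [measurable]: "L \<in> borel_measurable borel" by simp
  have bd': "y > 0 \<Longrightarrow> \<bar>indicator S y * \<Psi> x y\<bar> \<le> C * y + C" for x y S
    using bd[of y x] C by (auto simp: indicator_def algebra_simps)
  define D where "D = C * b + C * a"
  have D0: "D \<ge> 0" using C a_nonneg b_nonneg by (simp add: D_def)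
  have Ab: "\<bar>A n x\<bar> \<le> D" for n x
    unfolding A_def D_def by (rule size_dist_weighted(3)[OF dist _ bd' C C]) measurable
  have Lb: "\<bar>L x\<bar> \<le> D" for x
  proof -
    have "\<bar>LBINT y. (indicator UNIV y * \<Psi> x y) * w y\<bar> \<le> D"
      unfolding D_def by (rule size_dist_weighted(3)[OF w _ bd' C C]) measurable
    then show ?thesis by (simp add: L_def)
  qed
  have A0: "A n x = 0" if "x > R" for n x using sup[OF that] by (simp add: A_def)
  have L0: "L x = 0" if "x > R" for x using sup[OF that] by (simp add: L_def)
  \<comment> \<open>The region y > N n contributes little by sublinearity, so the cut-off may be dropped.\<close>
  have ptw: "(\<lambda>n. A n x) \<longlonglongrightarrow> L x" for x
  proof -
    have full: "(\<lambda>n. LBINT y. \<Psi> x y * v n y) \<longlonglongrightarrow> L x" unfolding L_def by (rule lim[OF sub])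
    have "(\<lambda>n. LBINT y. (indicator {N n<..} y * \<Psi> x y) * v n y) \<longlonglongrightarrow> 0"
    proof (rule LIMSEQ_I)
      fix e :: real assume "e > 0"
      define d where "d = e / (2 * (b + 1))"
      have d: "d > 0" "2 * (d * b) < e" using \<open>e > 0\<close> b_nonneg by (auto simp: d_def field_simps)
      obtain C' where C': "C' \<ge> 0" "\<And>y. y > 0 \<Longrightarrow> \<bar>\<Psi> x y\<bar> \<le> d * y + C'"
        using sub[of x] d(1) unfolding sublinear_def by blast
      have "\<forall>\<^sub>F n in sequentially. N n \<ge> max 1 (C' / d)" using N unfolding filterlim_at_top by blast
      then obtain n0 where n0: "\<And>n. n \<ge> n0 \<Longrightarrow> N n \<ge> 1 \<and> N n \<ge> C' / d" by (auto simp: eventually_sequentially)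
      show "\<exists>no. \<forall>n\<ge>no. norm ((LBINT y. (indicator {N n<..} y * \<Psi> x y) * v n y) - 0) < e"
      proof (intro exI allI impI)
        fix n assume "n \<ge> n0"
        then have Nn: "N n > 0" "C' / d \<le> N n" using n0[of n] by auto
        then have "C' \<le> d * N n" using d by (simp add: field_simps)
        then have "C' / N n \<le> d" using Nn by (simp add: field_simps)
        have "\<bar>LBINT y. (indicator {N n<..} y * \<Psi> x y) * v n y\<bar> \<le> (d + C' / N n) * b"
          by (rule size_dist_tail[OF dist _ C'(2)]) (use d C' Nn in auto)
        also have "\<dots> \<le> (d + d) * b" using \<open>C' / N n \<le> d\<close> b_nonneg by (intro mult_right_mono) auto
        also have "\<dots> < e" using d by simp
        finally show "norm ((LBINT y. (indicator {N n<..} y * \<Psi> x y) * v n y) - 0) < e" by simp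
      qed
    qed
    from tendsto_diff[OF full this]
    have "(\<lambda>n. (LBINT y. \<Psi> x y * v n y) - (LBINT y. (indicator {N n<..} y * \<Psi> x y) * v n y)) \<longlonglongrightarrow> L x"
      by simp
    moreover have "A n x = (LBINT y. \<Psi> x y * v n y) - (LBINT y. (indicator {N n<..} y * \<Psi> x y) * v n y)" for n
    proof -
      have i: "integrable lborel (\<lambda>y. (indicator S y * \<Psi> x y) * v n y)" if "S \<in> sets borel" for S
        by (rule size_dist_weighted(1)[OF dist _ bd' C C]) (use that in measurable)
      have "(LBINT y. \<Psi> x y * v n y) = (LBINT y. (indicator {..N n} y * \<Psi> x y) * v n y + (indicator {N n<..} y * \<Psi> x y) * v n y)"
        by (intro Bochner_Integration.integral_cong) (auto simp: indicator_def)
      also have "\<dots> = A n x + (LBINT y. (indicator {N n<..} y * \<Psi> x y) * v n y)"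
        unfolding A_def by (rule Bochner_Integration.integral_add) (auto intro: i)
      finally show ?thesis by simp
    qed
    ultimately show ?thesis by simp
  qed
  from dom obtain g where g: "integrable lborel g" "\<And>n. AE x in lborel. x \<le> R \<longrightarrow> v n x \<le> g x" by blast
  have [measurable]: "g \<in> borel_measurable borel" using g(1) by auto
  have dct: "(\<lambda>n. LBINT x. \<bar>A n x - L x\<bar> * \<bar>g x\<bar>) \<longlonglongrightarrow> (LBINT x::real. 0)"
  proof (rule integral_dominated_convergence)
    show "integrable lborel (\<lambda>x. 2 * D * \<bar>g x\<bar>)" using g(1) by simp
    show "AE x in lborel. norm (\<bar>A n x - L x\<bar> * \<bar>g x\<bar>) \<le> 2 * D * \<bar>g x\<bar>" for n
    proof (rule AE_I2)
      fix x
      have "\<bar>A n x - L x\<bar> \<le> 2 * D" using Ab[of n x] Lb[of x] by linarith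
      then show "norm (\<bar>A n x - L x\<bar> * \<bar>g x\<bar>) \<le> 2 * D * \<bar>g x\<bar>" by (simp add: abs_mult mult_right_mono)
    qed
    show "AE x in lborel. (\<lambda>n. \<bar>A n x - L x\<bar> * \<bar>g x\<bar>) \<longlonglongrightarrow> 0"
      using ptw by (intro AE_I2 tendsto_mult_left_zero tendsto_rabs_zero) (simp add: LIM_zero)
  qed auto
  have gi: "integrable lborel (\<lambda>x. \<bar>A n x - L x\<bar> * \<bar>g x\<bar>)" for n
  proof (rule Bochner_Integration.integrable_bound)
    show "integrable lborel (\<lambda>x. 2 * D * \<bar>g x\<bar>)" using g(1) by simp
    show "AE x in lborel. norm (\<bar>A n x - L x\<bar> * \<bar>g x\<bar>) \<le> norm (2 * D * \<bar>g x\<bar>)"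
    proof (rule AE_I2)
      fix x
      have "\<bar>A n x - L x\<bar> \<le> 2 * D" using Ab[of n x] Lb[of x] by linarith
      then show "norm (\<bar>A n x - L x\<bar> * \<bar>g x\<bar>) \<le> norm (2 * D * \<bar>g x\<bar>)" using D0 by (simp add: abs_mult mult_right_mono)
    qed
  qed measurable
  have iA: "integrable lborel (\<lambda>x. A n x * v n x)" for n
    by (rule size_dist_weighted(1)[OF dist, where e = 0 and C = D]) (use Ab D0 in auto)
  have iL: "integrable lborel (\<lambda>x. L x * v n x)" for n
    by (rule size_dist_weighted(1)[OF dist, where e = 0 and C = D]) (use Lb D0 in auto)
  have "(\<lambda>n. (LBINT x. A n x * v n x) - (LBINT x. L x * v n x)) \<longlonglongrightarrow> 0"
  proof (rule Lim_null_comparison)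
    show "\<forall>\<^sub>F n in sequentially. norm ((LBINT x. A n x * v n x) - (LBINT x. L x * v n x)) \<le> (LBINT x. \<bar>A n x - L x\<bar> * \<bar>g x\<bar>)"
    proof (intro always_eventually allI)
      fix n
      have "(LBINT x. A n x * v n x) - (LBINT x. L x * v n x) = (LBINT x. A n x * v n x - L x * v n x)"
        using iA iL by simp
      also have "norm \<dots> \<le> (LBINT x. \<bar>A n x * v n x - L x * v n x\<bar>)" by simp
      also have "\<dots> \<le> (LBINT x. \<bar>A n x - L x\<bar> * \<bar>g x\<bar>)"
      proof (rule integral_mono_AE[OF _ gi])
        show "integrable lborel (\<lambda>x. \<bar>A n x * v n x - L x * v n x\<bar>)" using iA iL by (intro integrable_abs) simp
        show "AE x in lborel. \<bar>A n x * v n x - L x * v n x\<bar> \<le> \<bar>A n x - L x\<bar> * \<bar>g x\<bar>"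
          using g(2)[of n]
        proof eventually_elim
          case (elim x)
          show ?case
          proof (cases "x \<le> R")
            case True
            then have "v n x \<le> \<bar>g x\<bar>" using elim by linarith
            then have "\<bar>A n x - L x\<bar> * v n x \<le> \<bar>A n x - L x\<bar> * \<bar>g x\<bar>" by (intro mult_left_mono) auto
            then show ?thesis using v_nonneg[of n x] by (simp add: left_diff_distrib[symmetric] abs_mult)
          qed (simp add: A0 L0)
        qed
      qed
      finally show "norm ((LBINT x. A n x * v n x) - (LBINT x. L x * v n x)) \<le> (LBINT x. \<bar>A n x - L x\<bar> * \<bar>g x\<bar>)" .
    qed
  qed (use dct in simp)
  moreover have "(\<lambda>n. LBINT x. L x * v n x) \<longlonglongrightarrow> (LBINT x. L x * w x)"
    by (rule lim, rule sublinear_bounded[where C = D]) (use Lb in auto)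
  ultimately have "(\<lambda>n. ((LBINT x. A n x * v n x) - (LBINT x. L x * v n x)) + (LBINT x. L x * v n x)) \<longlonglongrightarrow> 0 + (LBINT x. L x * w x)"
    by (rule tendsto_add)
  then show ?thesis by (simp add: A_def L_def mult.commute)
qed

lemma step_integral:
  fixes w :: "nat \<Rightarrow> real"
  assumes h: "h > 0"
  shows "(LBINT s. indicator {0..<h * real k} s * w (nat \<lfloor>s / h\<rfloor>)) = h * (\<Sum>i<k. w i)"
proof -
  have e: "indicator {0..<h * real k} s * w (nat \<lfloor>s / h\<rfloor>) = (\<Sum>i<k. indicator {h * real i..<h * real (Suc i)} s * w i)" for s
  proof (cases "0 \<le> s")
    case True
    define j where "j = nat \<lfloor>s / h\<rfloor>"
    have j: "real j = of_int \<lfloor>s / h\<rfloor>" using True h by (simp add: j_def)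
    have iff: "s \<in> {h * real i..<h * real (Suc i)} \<longleftrightarrow> i = j" for i
    proof -
      have "s \<in> {h * real i..<h * real (Suc i)} \<longleftrightarrow> real i \<le> s / h \<and> s / h < real i + 1"
        using h by (auto simp: field_simps)
      also have "\<dots> \<longleftrightarrow> \<lfloor>s / h\<rfloor> = int i" by (simp add: floor_eq_iff)
      also have "\<dots> \<longleftrightarrow> i = j" using True h by (auto simp: j_def)
      finally show ?thesis .
    qed
    have "s < h * real k \<longleftrightarrow> s / h < real k" using h by (simp add: field_simps)
    also have "\<dots> \<longleftrightarrow> \<lfloor>s / h\<rfloor> < int k" by (simp add: floor_less_iff)
    also have "\<dots> \<longleftrightarrow> j < k" using True h by (simp add: j_def nat_less_iff)
    finally have jk: "s < h * real k \<longleftrightarrow> j < k" .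
    have "(\<Sum>i<k. indicator {h * real i..<h * real (Suc i)} s * w i) = (\<Sum>i<k. if i = j then w j else 0)"
      using iff by (intro sum.cong) (auto simp: indicator_def)
    then show ?thesis using jk True by (simp add: indicator_def j_def[symmetric])
  next
    case False
    have "s \<notin> {h * real i..<h * real (Suc i)}" for i
    proof -
      have "0 \<le> h * real i" using h by simp
      then show ?thesis using False by auto
    qed
    then show ?thesis using False by simp
  qed
  have i: "integrable lborel (\<lambda>s. indicator {h * real i..<h * real (Suc i)} s * w i)" for i
    using h by (intro integrable_mult_left integrable_real_indicator) (auto simp: algebra_simps)
  have j: "(LBINT s. indicator {h * real i..<h * real (Suc i)} s * w i) = h * w i" for i
    using h by (simp add: algebra_simps)
  show "(LBINT s. indicator {0..<h * real k} s * w (nat \<lfloor>s / h\<rfloor>)) = h * (\<Sum>i<k. w i)"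
    unfolding e Bochner_Integration.integral_sum[OF i] j by (rule sum_distrib_left[symmetric])
qed

section \<open>Approximate solutions and their weak limit\<close>

locale coag_problem = coag_kernel +
  fixes u :: "real \<Rightarrow> real" and a b :: real
  assumes u_dist: "size_dist a b u"
    and K_sublinear: "sublinear (K x)"
begin

definition trunc :: "nat \<Rightarrow> real \<Rightarrow> real \<Rightarrow> real" where
  "trunc n x y = (if x \<le> real n \<and> y \<le> real n then K x y else 0)"

end

sublocale coag_problem \<subseteq> tr: coag_kernel "trunc n" \<kappa> for n
proof
  show "case_prod (trunc n) \<in> borel_measurable (borel \<Otimes>\<^sub>M borel)" unfolding trunc_def by measurable
  fix x y :: real
  show "trunc n x y \<le> \<kappa> * (1 + x) * (1 + y)" if "0 < x" "0 < y"
    using K_le[OF that] that kappa_pos by (auto simp: trunc_def)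
qed (auto simp: trunc_def K_nonneg K_sym K_zero kappa_pos)

context coag_problem begin

lemma a_nn: "0 \<le> a"
  using size_dist_nonneg[OF u_dist] by auto

lemma trunc_le:
  assumes "x \<le> R" "y \<le> R" "R \<ge> 0"
  shows "trunc n x y \<le> \<kappa> * (1 + R)\<^sup>2"
proof (cases "0 < x \<and> 0 < y \<and> x \<le> real n \<and> y \<le> real n")
  case True
  have "K x y \<le> \<kappa> * ((1 + x) * (1 + y))" using K_le[of x y] True by (simp add: mult.assoc)
  also have "\<dots> \<le> \<kappa> * ((1 + R) * (1 + R))"
    using True assms kappa_pos by (intro mult_left_mono mult_mono) auto
  finally show ?thesis using True by (simp add: trunc_def power2_eq_square)
next
  case False
  then have "trunc n x y = 0" by (auto simp: trunc_def not_less K_zero K_zero')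
  then show ?thesis using kappa_pos by simp
qed

text \<open>
  The bound \<open>\<kappa> * (1 + n)\<^sup>2\<close> on the truncated kernel, times the number of clusters, bounds the rate of
  loss; the summand \<open>1\<close> in \<open>1 + a\<close> covers \<open>a = 0\<close>.
\<close>

definition timestep :: "nat \<Rightarrow> real" where
  "timestep n = 1 / (\<kappa> * (1 + real n)\<^sup>2 * (1 + a))"

lemma timestep_pos: "timestep n > 0"
  using kappa_pos a_nn by (simp add: timestep_def)

lemma timestep_tendsto: "timestep \<longlonglongrightarrow> 0"
proof (rule Lim_null_comparison)
  show "\<forall>\<^sub>F n in sequentially. norm (timestep n) \<le> (1 / \<kappa>) * inverse (real (Suc n))"
  proof (intro always_eventually allI)
    fix n
    have "1 * (1 + real n) * 1 \<le> (1 + real n) * (1 + real n) * (1 + a)"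
      using a_nn by (intro mult_mono) auto
    then have "\<kappa> * (1 + real n) \<le> \<kappa> * ((1 + real n)\<^sup>2 * (1 + a))"
      using kappa_pos by (intro mult_left_mono) (auto simp: power2_eq_square)
    then have "timestep n \<le> 1 / (\<kappa> * (1 + real n))"
      unfolding timestep_def using kappa_pos a_nn by (intro divide_left_mono) (auto simp: mult.assoc)
    then show "norm (timestep n) \<le> (1 / \<kappa>) * inverse (real (Suc n))"
      using timestep_pos[of n] by (simp add: field_simps)
  qed
  show "(\<lambda>n. (1 / \<kappa>) * inverse (real (Suc n))) \<longlonglongrightarrow> 0"
    using tendsto_mult[OF tendsto_const[of "1 / \<kappa>"] LIMSEQ_inverse_real_of_nat] by simp
qed

abbreviation iter :: "nat \<Rightarrow> nat \<Rightarrow> real \<Rightarrow> real" where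
  "iter n \<equiv> tr.euler n (timestep n) u"

lemma iter_dist: "size_dist a b (iter n j)"
proof (rule tr.euler_dist[OF u_dist])
  show "0 \<le> timestep n" using timestep_pos[of n] by simp
  show "timestep n * (\<kappa> * (1 + real n)\<^sup>2 * a) \<le> 1"
  proof -
    have "\<kappa> * (1 + real n)\<^sup>2 > 0" using kappa_pos by simp
    then have "timestep n * (\<kappa> * (1 + real n)\<^sup>2 * a) = a / (1 + a)"
      using kappa_pos by (simp add: timestep_def)
    then show ?thesis using a_nn by simp
  qed
  show "trunc n x y \<le> \<kappa> * (1 + real n)\<^sup>2" for x y
  proof (cases "x \<le> real n \<and> y \<le> real n")
    case False
    then show ?thesis using kappa_pos by (auto simp: trunc_def)
  qed (use trunc_le in auto)
  show "trunc n x y = 0" if "y > real n" for x y using that by (simp add: trunc_def)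
qed

definition approx :: "nat \<Rightarrow> real \<Rightarrow> real \<Rightarrow> real" where
  "approx n t = iter n (nat \<lfloor>t / timestep n\<rfloor>)"

lemma approx_dist: "size_dist a b (approx n t)"
  unfolding approx_def by (rule iter_dist)

lemma steps_bounds:
  assumes "t \<ge> 0"
  shows "timestep n * real (nat \<lfloor>t / timestep n\<rfloor>) \<le> t" "t < timestep n * real (nat \<lfloor>t / timestep n\<rfloor>) + timestep n"
proof -
  let ?h = "timestep n"
  have h: "?h > 0" by (rule timestep_pos)
  have j: "real (nat \<lfloor>t / ?h\<rfloor>) = of_int \<lfloor>t / ?h\<rfloor>" using assms h by simp
  have "?h * of_int \<lfloor>t / ?h\<rfloor> \<le> ?h * (t / ?h)" using h by (intro mult_left_mono of_int_floor_le) auto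
  then show "?h * real (nat \<lfloor>t / ?h\<rfloor>) \<le> t" unfolding j using h by simp
  have "?h * (t / ?h) < ?h * (of_int \<lfloor>t / ?h\<rfloor> + 1)" using h by (intro mult_strict_left_mono) linarith+
  then show "t < ?h * real (nat \<lfloor>t / ?h\<rfloor>) + ?h" unfolding j using h by (simp add: distrib_left)
qed

text \<open>
  The bound \<open>c\<close> on \<open>K\<close> below \<open>R\<close> is the same for all truncations, so one majorant serves all \<open>n\<close>.
\<close>

lemma approx_dominated:
  "\<exists>g. integrable lborel g \<and> (\<forall>n t. 0 \<le> t \<longrightarrow> t \<le> T \<longrightarrow> (AE x in lborel. x \<le> R \<longrightarrow> approx n t x \<le> g x))"
proof (cases "T \<ge> 0")
  case True
  define c where "c = \<kappa> * (1 + max R 0)\<^sup>2"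
  have c: "c \<ge> 0" using kappa_pos by (simp add: c_def)
  obtain g where g: "integrable lborel g" "\<And>j. AE x in lborel. x \<le> R \<longrightarrow> majorant (c * T) u j x \<le> ennreal (g x)"
    using majorant_integrable[OF u_dist, of "c * T" R] c True by auto
  show ?thesis
  proof (intro exI[of _ "\<lambda>x. \<bar>g x\<bar>"] conjI allI impI)
    show "integrable lborel (\<lambda>x. \<bar>g x\<bar>)" using g(1) by simp
    fix n t assume t: "0 \<le> t" "t \<le> T"
    let ?j = "nat \<lfloor>t / timestep n\<rfloor>"
    show "AE x in lborel. x \<le> R \<longrightarrow> approx n t x \<le> \<bar>g x\<bar>"
      using g(2)[of "Suc ?j"]
    proof eventually_elim
      case (elim x)
      show ?case
      proof
        assume x: "x \<le> R"
        have "ennreal (iter n ?j x) \<le> majorant (c * T) u (Suc ?j) x"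
        proof (rule tr.euler_le_majorant[OF iter_dist])
          show "0 \<le> timestep n" using timestep_pos[of n] by simp
          show "trunc n x y \<le> c" if "x \<le> R" "y \<le> R" for x y
            unfolding c_def using that by (intro trunc_le) auto
          show "c * (timestep n * real ?j) \<le> c * T"
            using steps_bounds(1)[OF t(1), of n] t c by (intro mult_left_mono) auto
        qed (use c x in auto)
        also have "\<dots> \<le> ennreal (g x)" using elim x by simp
        also have "\<dots> \<le> ennreal \<bar>g x\<bar>" by (intro ennreal_leI) simp
        finally show "approx n t x \<le> \<bar>g x\<bar>" by (simp add: approx_def ennreal_le_iff)
      qed
    qed
  qed
qed (intro exI[of _ "\<lambda>_. 0"], auto)

definition lip :: real where "lip = 3 / 2 * \<kappa> * (a + b)\<^sup>2"

lemma lip_nonneg: "0 \<le> lip" using kappa_pos by (simp add: lip_def)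

lemma iter_integral_diff:
  assumes [measurable]: "\<theta> \<in> borel_measurable borel" and bd: "\<And>x. \<bar>\<theta> x\<bar> \<le> c"
  shows "(LBINT x. \<theta> x * iter n (i + m) x) - (LBINT x. \<theta> x * iter n i x) =
    timestep n * (\<Sum>j<m. tr.weak n \<theta> (iter n (i + j)))"
proof (induction m)
  case (Suc m)
  let ?f = "iter n (i + m)"
  have f: "size_dist a b ?f" by (rule iter_dist)
  then have "integrable lborel ?f" "\<And>x. 0 \<le> ?f x" by (auto simp: size_dist_def)
  then have i1: "integrable lborel (\<lambda>x. \<theta> x * ?f x)" by (rule bounded_weight_le(1)[OF _ _ _ bd]) simp
  note i2 = tr.coag_weak_bounded[OF f assms]
  have "(LBINT x. \<theta> x * iter n (i + Suc m) x) = (LBINT x. \<theta> x * ?f x + timestep n * (\<theta> x * tr.coag n ?f x))"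
    by (simp add: distrib_left mult_ac)
  also have "\<dots> = (LBINT x. \<theta> x * ?f x) + timestep n * tr.weak n \<theta> ?f"
    using i1 i2 by simp
  finally show ?case using Suc by (simp add: distrib_left)
qed simp

text \<open>
  The additional \<open>timestep n\<close> accounts for the jumps of a piecewise constant function.
\<close>

lemma approx_lipschitz:
  assumes [measurable]: "\<theta> \<in> borel_measurable borel" and bd: "\<And>x. \<bar>\<theta> x\<bar> \<le> c" and st: "0 \<le> s" "s \<le> t"
  shows "\<bar>(LBINT x. \<theta> x * approx n t x) - (LBINT x. \<theta> x * approx n s x)\<bar> \<le> c * lip * (t - s + timestep n)"
proof -
  let ?h = "timestep n"
  let ?i = "nat \<lfloor>s / ?h\<rfloor>" and ?k = "nat \<lfloor>t / ?h\<rfloor>"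
  have c: "0 \<le> c" using bd[of 0] by linarith
  have "?i \<le> ?k" using st timestep_pos[of n] by (intro nat_mono floor_mono divide_right_mono) auto
  then obtain m where m: "?k = ?i + m" using le_Suc_ex by blast
  have "\<bar>(LBINT x. \<theta> x * approx n t x) - (LBINT x. \<theta> x * approx n s x)\<bar>
     = ?h * \<bar>\<Sum>j<m. tr.weak n \<theta> (iter n (?i + j))\<bar>"
    unfolding approx_def m iter_integral_diff[OF assms(1) bd] using timestep_pos[of n] by (simp add: abs_mult)
  also have "\<dots> \<le> ?h * (\<Sum>j<m. c * lip)"
  proof (rule mult_left_mono)
    have "\<bar>\<Sum>j<m. tr.weak n \<theta> (iter n (?i + j))\<bar> \<le> (\<Sum>j<m. \<bar>tr.weak n \<theta> (iter n (?i + j))\<bar>)" by (rule sum_abs)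
    also have "\<dots> \<le> (\<Sum>j<m. c * lip)"
    proof (rule sum_mono)
      fix j
      show "\<bar>tr.weak n \<theta> (iter n (?i + j))\<bar> \<le> c * lip"
        using tr.weak_bound[OF iter_dist assms(1) bd, of n n "?i + j"] by (simp add: lip_def mult_ac)
    qed
    finally show "\<bar>\<Sum>j<m. tr.weak n \<theta> (iter n (?i + j))\<bar> \<le> (\<Sum>j<m. c * lip)" .
  qed (use timestep_pos[of n] in simp)
  also have "\<dots> = c * lip * (?h * real m)" by simp
  also have "\<dots> \<le> c * lip * (t - s + ?h)"
  proof (rule mult_left_mono)
    have "?h * real ?k = ?h * real ?i + ?h * real m" by (simp add: m distrib_left)
    then show "?h * real m \<le> t - s + ?h"
      using steps_bounds[of s n] steps_bounds[of t n] st by linarith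
  qed (use c lip_nonneg in simp)
  finally show ?thesis .
qed

lemma approx_weak:
  assumes "\<theta> \<in> borel_measurable borel" and bd: "\<And>x. \<bar>\<theta> x\<bar> \<le> c"
  shows "(LBINT x. \<theta> x * approx n t x) - (LBINT x. \<theta> x * u x) =
    (LBINT s. indicator {0..<timestep n * real (nat \<lfloor>t / timestep n\<rfloor>)} s * tr.weak n \<theta> (approx n s))"
  using iter_integral_diff[OF assms, of n 0]
    step_integral[OF timestep_pos, where w = "\<lambda>j. tr.weak n \<theta> (iter n j)"]
  by (simp add: approx_def)

text \<open>
  A diagonal sequence over the countably many pairs of a rational time and a rational end point.
\<close>

lemma ex_convergent_subsequence:
  "\<exists>r::nat \<Rightarrow> nat. strict_mono r \<and> (\<forall>t\<in>\<rat>. \<forall>q\<in>\<rat>. convergent (\<lambda>n. LBINT x. indicator {..q} x * approx (r n) t x))"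
proof -
  define I where "I k m = (LBINT x. indicator {..real_of_rat (snd (from_nat k :: rat \<times> rat))} x *
     approx m (real_of_rat (fst (from_nat k :: rat \<times> rat))) x)" for k m :: nat
  define P where "P k s = convergent (\<lambda>n. I k (s n))" for k :: nat and s :: "nat \<Rightarrow> nat"
  interpret subseqs P
  proof
    fix k and s :: "nat \<Rightarrow> nat"
    have "\<bar>I k m\<bar> \<le> a" for m
      using size_dist_set(2,3)[OF approx_dist, of "{..real_of_rat (snd (from_nat k :: rat \<times> rat))}"] by (simp add: I_def)
    then have "bounded (range (\<lambda>n. I k (s n)))" by (auto simp: bounded_iff)
    from bounded_imp_convergent_subsequence[OF this]
    obtain l r where "strict_mono r" "((\<lambda>n. I k (s n)) \<circ> r) \<longlonglongrightarrow> l" by blast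
    then show "\<exists>r'. strict_mono r' \<and> P k (s \<circ> r')" by (auto simp: P_def convergent_def o_def)
  qed
  have "P k (diagseq \<circ> (+) (Suc k))" for k
  proof (rule diagseq_holds)
    fix r s :: "nat \<Rightarrow> nat" and n assume "strict_mono r" "P n s"
    then show "P n (s \<circ> r)"
      using convergent_subseq_convergent[of "\<lambda>i. I n (s i)" r] by (simp add: P_def o_def)
  qed
  moreover define D where "D = diagseq"
  ultimately have PD: "P k (D \<circ> (+) (Suc k))" for k by simp
  have cv: "convergent (\<lambda>n. I k (D n))" for k
  proof -
    have "convergent (\<lambda>n. I k (D (n + Suc k)))"
      using PD[of k] unfolding P_def o_apply by (simp only: add.commute)
    then show ?thesis by (rule convergent_ignore_initial_segment[THEN iffD1])
  qed
  show ?thesis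
  proof (intro exI[of _ D] conjI ballI)
    show "strict_mono D" unfolding D_def by (rule subseq_diagseq)
  next
    fix t q :: real assume "t \<in> \<rat>" "q \<in> \<rat>"
    then obtain t' q' where "t = of_rat t'" "q = of_rat q'" by (auto elim!: Rats_cases)
    then show "convergent (\<lambda>n. LBINT x. indicator {..q} x * approx (D n) t x)"
      using cv[of "to_nat (t', q')"] by (simp add: I_def)
  qed
qed

lemma subsequence_dominated:
  assumes "t \<ge> 0"
  shows "dominated_dists (\<lambda>n. approx (r n) t) a b"
proof
  fix R
  show "\<exists>g. integrable lborel g \<and> (\<forall>n. AE x in lborel. x \<le> R \<longrightarrow> approx (r n) t x \<le> g x)"
    using approx_dominated[of t R] assms by blast
qed (rule approx_dist)

text \<open>
  Convergence at rational times extends to all times by the Lipschitz bound, which is uniform up to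
  the vanishing step size.
\<close>

lemma ex_weak_limit:
  "\<exists>r f. strict_mono r \<and> (\<forall>t\<ge>0. size_dist a b (f t) \<and>
     (\<forall>\<phi>. sublinear \<phi> \<longrightarrow> (\<lambda>n. LBINT x. \<phi> x * approx (r n) t x) \<longlonglongrightarrow> (LBINT x. \<phi> x * f t x)))"
proof -
  obtain r :: "nat \<Rightarrow> nat" where r: "strict_mono r"
    and cv: "\<And>t q. t \<in> \<rat> \<Longrightarrow> q \<in> \<rat> \<Longrightarrow> convergent (\<lambda>n. LBINT x. indicator {..q} x * approx (r n) t x)"
    using ex_convergent_subsequence by blast
  have ex: "\<exists>w. size_dist a b w \<and> (\<forall>\<phi>. sublinear \<phi> \<longrightarrow> (\<lambda>n. LBINT x. \<phi> x * approx (r n) t x) \<longlonglongrightarrow> (LBINT x. \<phi> x * w x))"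
    if t: "t \<ge> 0" for t
  proof -
    interpret dominated_dists "\<lambda>n. approx (r n) t" a b by (rule subsequence_dominated[OF t])
    have "convergent (\<lambda>n. mass n {..q})" if q: "q \<in> \<rat>" for q
    proof (rule convergent_approx)
      fix e :: real assume "e > 0"
      define d where "d = e / (2 * (lip + 1))"
      have d: "d > 0" "lip * (2 * d) \<le> e" using \<open>e > 0\<close> lip_nonneg by (auto simp: d_def field_simps)
      obtain t' where t': "t' \<in> \<rat>" "t < t'" "t' < t + d" using Rats_dense_in_real[of t "t + d"] d by auto
      have "(\<lambda>n. timestep (r n)) \<longlonglongrightarrow> 0" using LIMSEQ_subseq_LIMSEQ[OF timestep_tendsto r] by (simp add: o_def)
      then have "\<forall>\<^sub>F n in sequentially. timestep (r n) < d" using d by (auto dest: order_tendstoD)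
      then have "\<forall>\<^sub>F n in sequentially. \<bar>mass n {..q} - (LBINT x. indicator {..q} x * approx (r n) t' x)\<bar> \<le> e"
      proof eventually_elim
        case (elim n)
        have "\<bar>(LBINT x. indicator {..q} x * approx (r n) t' x) - mass n {..q}\<bar> \<le> 1 * lip * (t' - t + timestep (r n))"
          unfolding mass_def by (rule approx_lipschitz) (use t t' in \<open>auto simp: indicator_def\<close>)
        also have "\<dots> \<le> lip * (2 * d)" using elim t' lip_nonneg by (simp add: mult_left_mono)
        finally show ?case using d by linarith
      qed
      then show "\<exists>w. convergent w \<and> (\<forall>\<^sub>F n in sequentially. \<bar>mass n {..q} - w n\<bar> \<le> e)"
        using cv[OF t'(1) q] by (intro exI[of _ "\<lambda>n. LBINT x. indicator {..q} x * approx (r n) t' x"]) simp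
    qed
    from limit_density[OF mass_convergent[OF this]] show ?thesis by blast
  qed
  then have "\<exists>f. \<forall>t. t \<ge> 0 \<longrightarrow> size_dist a b (f t) \<and> (\<forall>\<phi>. sublinear \<phi> \<longrightarrow>
     (\<lambda>n. LBINT x. \<phi> x * approx (r n) t x) \<longlonglongrightarrow> (LBINT x. \<phi> x * f t x))"
    by (intro choice allI) blast
  with r show ?thesis by blast
qed

end

section \<open>The limit equation\<close>

locale coag_limit = coag_problem +
  fixes r :: "nat \<Rightarrow> nat" and f :: "real \<Rightarrow> real \<Rightarrow> real"
  assumes r: "strict_mono r"
    and f_dist: "t \<ge> 0 \<Longrightarrow> size_dist a b (f t)"
    and f_lim: "t \<ge> 0 \<Longrightarrow> sublinear \<phi> \<Longrightarrow> (\<lambda>n. LBINT x. \<phi> x * approx (r n) t x) \<longlonglongrightarrow> (LBINT x. \<phi> x * f t x)"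
begin

lemma timestep_r: "(\<lambda>n. timestep (r n)) \<longlonglongrightarrow> 0"
  using LIMSEQ_subseq_LIMSEQ[OF timestep_tendsto r] by (simp add: o_def)

text \<open>
  The \<open>L\<^sup>1\<close> norm is attained by testing with the sign of the difference, a bounded function that does
  not depend on \<open>n\<close>; so the bound for fixed test functions passes to the limit.
\<close>

lemma f_lipschitz:
  assumes st: "0 \<le> s" "s \<le> t"
  shows "(LBINT x. \<bar>f t x - f s x\<bar>) \<le> lip * (t - s)"
proof -
  have t: "0 \<le> t" using st by simp
  have ft: "integrable lborel (f t)" "\<And>x. 0 \<le> f t x" "f t \<in> borel_measurable borel"
    and fs: "integrable lborel (f s)" "\<And>x. 0 \<le> f s x" "f s \<in> borel_measurable borel"
    using f_dist[OF t] f_dist[OF st(1)] by (auto simp: size_dist_def)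
  note [measurable] = ft(3) fs(3)
  let ?s = "\<lambda>x. sgn (f t x - f s x)"
  have sb: "\<bar>?s x\<bar> \<le> 1" for x by (simp add: sgn_real_def)
  have sub: "sublinear ?s" by (rule sublinear_bounded[OF _ sb]) measurable
  have sm: "?s \<in> borel_measurable borel" by measurable
  have "(\<lambda>n. (LBINT x. ?s x * approx (r n) t x) - (LBINT x. ?s x * approx (r n) s x)) \<longlonglongrightarrow>
     (LBINT x. ?s x * f t x) - (LBINT x. ?s x * f s x)"
    by (intro tendsto_diff f_lim sub t st)
  moreover have "(\<lambda>n. 1 * lip * (t - s + timestep (r n))) \<longlonglongrightarrow> 1 * lip * (t - s + 0)"
    by (intro tendsto_intros timestep_r)
  ultimately have "(LBINT x. ?s x * f t x) - (LBINT x. ?s x * f s x) \<le> 1 * lip * (t - s + 0)"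
    by (rule LIMSEQ_le) (use order_trans[OF abs_ge_self approx_lipschitz[OF sm sb st]] in blast)
  also have "(LBINT x. ?s x * f t x) - (LBINT x. ?s x * f s x) = (LBINT x. ?s x * f t x - ?s x * f s x)"
    by (rule Bochner_Integration.integral_diff[symmetric])
       (rule bounded_weight_le(1)[OF ft(1,2) sm sb] bounded_weight_le(1)[OF fs(1,2) sm sb])+
  also have "(\<lambda>x. ?s x * f t x - ?s x * f s x) = (\<lambda>x. \<bar>f t x - f s x\<bar>)"
    by (auto simp: fun_eq_iff sgn_real_def)
  finally show ?thesis by simp
qed

text \<open>
  For \<open>r n \<ge> R\<close> the truncation in \<open>x\<close> is invisible to a test function supported below \<open>R\<close>; what
  remains is the truncation in \<open>y\<close>.
\<close>

lemma weak_limit: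
  assumes s: "s \<ge> 0" and [measurable]: "\<theta> \<in> borel_measurable borel" and bd: "\<And>x. \<bar>\<theta> x\<bar> \<le> c"
    and sup: "\<And>x. x > R \<Longrightarrow> \<theta> x = 0"
  shows "(\<lambda>n. tr.weak (r n) \<theta> (approx (r n) s)) \<longlonglongrightarrow> weak \<theta> (f s)"
proof -
  interpret dominated_dists "\<lambda>n. approx (r n) s" a b by (rule subsequence_dominated[OF s])
  define R' where "R' = max R 0"
  have R': "R' \<ge> 0" "\<And>x. x > R' \<Longrightarrow> \<theta> x = 0" using sup by (auto simp: R'_def)
  define \<Psi> where "\<Psi> x y = (\<theta> (x + y) / 2 - \<theta> x) * K x y" for x y
  have c: "0 \<le> c" using bd[of 0] by linarith
  have tb: "\<bar>\<theta> (x + y) / 2 - \<theta> x\<bar> \<le> 2 * c" for x y using bd[of x] bd[of "x + y"] by linarith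
  have \<Psi>0: "\<Psi> x y = 0" if "x > R'" for x y
    using that R'(2)[of x] R'(2)[of "x + y"] K_zero'[of y x] by (cases "y \<le> 0") (auto simp: \<Psi>_def)
  have \<Psi>m[measurable]: "case_prod \<Psi> \<in> borel_measurable (borel \<Otimes>\<^sub>M borel)" unfolding \<Psi>_def by measurable
  have \<Psi>b: "\<bar>\<Psi> x y\<bar> \<le> (2 * c * \<kappa> * (1 + R')) * (1 + y)" if y: "y > 0" for x y
  proof (cases "0 < x \<and> x \<le> R'")
    case True
    have "\<bar>\<Psi> x y\<bar> \<le> (2 * c * \<kappa>) * (1 + x) * (1 + y)"
      unfolding \<Psi>_def using True y by (intro bounded_times_K tb) auto
    also have "\<dots> \<le> (2 * c * \<kappa>) * (1 + R') * (1 + y)"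
      using True y c kappa_pos by (intro mult_right_mono mult_left_mono) auto
    finally show ?thesis .
  next
    case False
    then have "\<Psi> x y = 0" using \<Psi>0[of x y] K_zero[of x y] by (auto simp: \<Psi>_def not_less)
    then show ?thesis using R' c kappa_pos y by simp
  qed
  have \<Psi>s: "sublinear (\<Psi> x)" for x
    unfolding sublinear_def
  proof (intro conjI allI impI)
    have "(\<lambda>y. (\<theta> (x + y) / 2 - \<theta> x) * K x y) \<in> borel_measurable borel" by measurable
    then show "\<Psi> x \<in> borel_measurable borel" by (simp add: \<Psi>_def[abs_def])
    fix e :: real assume "e > 0"
    then have "e / (2 * c + 1) > 0" using c by simp
    then obtain C where C: "C \<ge> 0" "\<And>y. y > 0 \<Longrightarrow> \<bar>K x y\<bar> \<le> e / (2 * c + 1) * y + C"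
      using K_sublinear[of x] unfolding sublinear_def by blast
    show "\<exists>C\<ge>0. \<forall>y>0. \<bar>\<Psi> x y\<bar> \<le> e * y + C"
    proof (intro exI[of _ "(2 * c + 1) * C"] conjI allI impI)
      fix y :: real assume "y > 0"
      have "\<bar>\<Psi> x y\<bar> \<le> (2 * c + 1) * (e / (2 * c + 1) * y + C)"
        unfolding \<Psi>_def abs_mult using tb[of x y] C(2)[OF \<open>y > 0\<close>] c by (intro mult_mono) auto
      also have "\<dots> = e * y + (2 * c + 1) * C" using c by (simp add: field_simps)
      finally show "\<bar>\<Psi> x y\<bar> \<le> e * y + (2 * c + 1) * C" .
    qed (use c C in simp)
  qed
  have N: "filterlim (\<lambda>n. real (r n)) at_top sequentially"
    by (rule filterlim_compose[OF filterlim_real_sequentially filterlim_subseq[OF r]])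
  have "(\<lambda>n. LBINT x. approx (r n) s x * (LBINT y. indicator {..real (r n)} y * \<Psi> x y * approx (r n) s y)) \<longlonglongrightarrow>
    (LBINT x. f s x * (LBINT y. \<Psi> x y * f s y))"
  proof (rule bilinear_limit[OF f_dist[OF s] f_lim[OF s] \<Psi>m \<Psi>b _ \<Psi>0 \<Psi>s N])
    show "0 \<le> 2 * c * \<kappa> * (1 + R')" using c R' kappa_pos by simp
  qed auto
  moreover have "weak \<theta> (f s) = (LBINT x. f s x * (LBINT y. \<Psi> x y * f s y))"
    unfolding \<Psi>_def by (rule weak_asymmetric[OF f_dist[OF s] _ bd]) simp
  moreover have "\<forall>\<^sub>F n in sequentially.
     (LBINT x. approx (r n) s x * (LBINT y. indicator {..real (r n)} y * \<Psi> x y * approx (r n) s y))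
       = tr.weak (r n) \<theta> (approx (r n) s)"
  proof -
    have "\<forall>\<^sub>F n in sequentially. real (r n) \<ge> R'" using N unfolding filterlim_at_top by blast
    then show ?thesis
    proof eventually_elim
      case (elim n)
      have "indicator {..real (r n)} y * \<Psi> x y = (\<theta> (x + y) / 2 - \<theta> x) * trunc (r n) x y" for x y
        using elim \<Psi>0[of x y] by (cases "x \<le> R'") (auto simp: \<Psi>_def trunc_def indicator_def)
      then show ?case
        by (subst tr.weak_asymmetric[OF approx_dist _ bd]) auto
    qed
  qed
  ultimately show ?thesis using Lim_transform_eventually by fastforce
qed

lemma weak_equation_compact:
  assumes t: "t > 0" and \<theta>[measurable]: "\<theta> \<in> borel_measurable borel" and bd: "\<And>x. \<bar>\<theta> x\<bar> \<le> c"
    and sup: "\<And>x. x > R \<Longrightarrow> \<theta> x = 0"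
  shows "(\<lambda>s. indicator {0..<t} s * weak \<theta> (f s)) \<in> borel_measurable borel"
    and "(LBINT x. \<theta> x * f t x) - (LBINT x. \<theta> x * u x) = (LBINT s. indicator {0..<t} s * weak \<theta> (f s))"
proof -
  define W where "W n s = tr.weak (r n) \<theta> (approx (r n) s)" for n s
  define T where "T n = timestep (r n) * real (nat \<lfloor>t / timestep (r n)\<rfloor>)" for n
  have [measurable]: "W n \<in> borel_measurable borel" for n
  proof -
    have "(\<lambda>s. nat \<lfloor>s / timestep (r n)\<rfloor>) \<in> borel \<rightarrow>\<^sub>M count_space UNIV" by measurable
    then have "(\<lambda>s. (\<lambda>j. tr.weak (r n) \<theta> (iter (r n) j)) (nat \<lfloor>s / timestep (r n)\<rfloor>)) \<in> borel_measurable borel"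
      by (rule measurable_compose) simp
    then show ?thesis unfolding W_def[abs_def] approx_def .
  qed
  have c: "0 \<le> c" using bd[of 0] by linarith
  have Wb: "\<bar>W n s\<bar> \<le> c * lip" for n s
    using tr.weak_bound[OF approx_dist \<theta> bd, of "r n" "r n" s] by (simp add: W_def lip_def mult_ac)
  have Wl: "(\<lambda>n. W n s) \<longlonglongrightarrow> weak \<theta> (f s)" if "s \<ge> 0" for s
    unfolding W_def by (rule weak_limit[OF that \<theta> bd sup])
  show m: "(\<lambda>s. indicator {0..<t} s * weak \<theta> (f s)) \<in> borel_measurable borel"
  proof (rule borel_measurable_LIMSEQ_real)
    show "(\<lambda>n. indicator {0..<t} s * W n s) \<longlonglongrightarrow> indicator {0..<t} s * weak \<theta> (f s)" for s
      using Wl[of s] by (cases "s \<ge> 0") (auto intro!: tendsto_mult)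
  qed measurable
  have Tt: "T n \<le> t" "t < T n + timestep (r n)" for n
    unfolding T_def using t by (intro steps_bounds; simp)+
  have Tl: "T \<longlonglongrightarrow> t"
  proof (rule tendsto_sandwich[of "\<lambda>n. t - timestep (r n)" T _ "\<lambda>n. t"])
    show "(\<lambda>n. t - timestep (r n)) \<longlonglongrightarrow> t" using tendsto_diff[OF tendsto_const[of t] timestep_r] by simp
    show "\<forall>\<^sub>F n in sequentially. t - timestep (r n) \<le> T n"
      using Tt(2) by (intro always_eventually allI) (smt (verit))
  qed (use Tt in auto)
  have "(\<lambda>n. LBINT s. indicator {0..<T n} s * W n s) \<longlonglongrightarrow> (LBINT s. indicator {0..<t} s * weak \<theta> (f s))"
  proof (rule integral_dominated_convergence)
    show "integrable lborel (\<lambda>s. indicator {0..t} s * (c * lip))"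
      using t by (intro integrable_mult_left integrable_real_indicator) auto
    show "AE s in lborel. norm (indicator {0..<T n} s * W n s) \<le> indicator {0..t} s * (c * lip)" for n
      using Wb[of n] Tt(1)[of n] mult_nonneg_nonneg[OF c lip_nonneg] by (intro AE_I2) (auto simp: indicator_def)
    show "AE s in lborel. (\<lambda>n. indicator {0..<T n} s * W n s) \<longlonglongrightarrow> indicator {0..<t} s * weak \<theta> (f s)"
    proof (rule AE_I2)
      fix s
      consider "s < 0" | "0 \<le> s" "s < t" | "t \<le> s" by linarith
      then show "(\<lambda>n. indicator {0..<T n} s * W n s) \<longlonglongrightarrow> indicator {0..<t} s * weak \<theta> (f s)"
      proof cases
        case 2
        have "\<forall>\<^sub>F n in sequentially. s < T n" using order_tendstoD(1)[OF Tl 2(2)] .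
        then have "\<forall>\<^sub>F n in sequentially. W n s = indicator {0..<T n} s * W n s"
          using 2 by (auto elim: eventually_mono)
        from Lim_transform_eventually[OF Wl[OF 2(1)] this] show ?thesis using 2 by simp
      next
        case 3
        then have "s \<notin> {0..<T n}" for n using Tt(1)[of n] by auto
        then show ?thesis using 3 by simp
      qed simp
    qed
  qed (use m in simp_all)
  moreover have "(\<lambda>n. (LBINT x. \<theta> x * approx (r n) t x) - (LBINT x. \<theta> x * u x)) \<longlonglongrightarrow>
     (LBINT x. \<theta> x * f t x) - (LBINT x. \<theta> x * u x)"
    using t by (intro tendsto_diff f_lim tendsto_const sublinear_bounded[OF \<theta>]) (auto intro: bd)
  ultimately show "(LBINT x. \<theta> x * f t x) - (LBINT x. \<theta> x * u x) = (LBINT s. indicator {0..<t} s * weak \<theta> (f s))"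
    unfolding approx_weak[OF \<theta> bd] W_def T_def by (rule LIMSEQ_unique[rotated])
qed

text \<open>
  The limit satisfies the integrability that fails uniformly for the approximations: for a single
  density the product \<open>K x y * f s x * f s y\<close> is integrable over all pairs, so cut-offs of \<open>\<theta>\<close> can be
  removed by dominated convergence, first in the sizes and then in time.
\<close>

lemma weak_equation:
  assumes t: "t > 0" and \<theta>[measurable]: "\<theta> \<in> borel_measurable borel" and bd: "\<And>x. \<bar>\<theta> x\<bar> \<le> c"
  shows "(\<lambda>s. indicator {0..<t} s * weak \<theta> (f s)) \<in> borel_measurable borel"
    and "(LBINT x. \<theta> x * f t x) - (LBINT x. \<theta> x * u x) = (LBINT s. indicator {0..<t} s * weak \<theta> (f s))"
proof -
  define \<Theta> where "\<Theta> m x = indicator {..real m} x * \<theta> x" for m :: nat and x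
  have \<Theta>m[measurable]: "\<Theta> m \<in> borel_measurable borel" for m unfolding \<Theta>_def by measurable
  have c: "0 \<le> c" using bd[of 0] by linarith
  have \<Theta>b: "\<bar>\<Theta> m x\<bar> \<le> c" for m x using bd[of x] c by (auto simp: \<Theta>_def indicator_def)
  have \<Theta>0: "\<Theta> m x = 0" if "x > real m" for m x using that by (simp add: \<Theta>_def)
  have \<Theta>l: "(\<lambda>m. \<Theta> m x) \<longlonglongrightarrow> \<theta> x" for x
  proof (rule tendsto_eventually)
    have "\<forall>\<^sub>F m in sequentially. real m \<ge> x"
      using filterlim_real_sequentially unfolding filterlim_at_top by blast
    then show "\<forall>\<^sub>F m in sequentially. \<Theta> m x = \<theta> x" by eventually_elim (simp add: \<Theta>_def)
  qed
  have lin: "(\<lambda>m. LBINT x. \<Theta> m x * g x) \<longlonglongrightarrow> (LBINT x. \<theta> x * g x)" if g: "size_dist a b g" for g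
  proof (rule integral_dominated_convergence)
    have [measurable]: "g \<in> borel_measurable borel" and nn: "\<And>x. 0 \<le> g x" and i: "integrable lborel g"
      using g by (auto simp: size_dist_def)
    show "integrable lborel (\<lambda>x. c * g x)" using i by simp
    show "AE x in lborel. norm (\<Theta> m x * g x) \<le> c * g x" for m
      using \<Theta>b by (intro AE_I2) (simp add: abs_mult nn mult_right_mono)
    show "AE x in lborel. (\<lambda>m. \<Theta> m x * g x) \<longlonglongrightarrow> \<theta> x * g x"
      by (intro AE_I2 tendsto_mult \<Theta>l tendsto_const)
    show "(\<lambda>x. \<theta> x * g x) \<in> borel_measurable lborel" "(\<lambda>x. \<Theta> m x * g x) \<in> borel_measurable lborel" for m
      by measurable
  qed
  have wl: "(\<lambda>m. weak (\<Theta> m) (f s)) \<longlonglongrightarrow> weak \<theta> (f s)" if s: "s \<ge> 0" for s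
  proof -
      note fd = f_dist[OF s]
    have [measurable]: "f s \<in> borel_measurable borel" and nn: "\<And>x. 0 \<le> f s x" using fd by (auto simp: size_dist_def)
    have tm: "(\<lambda>(x, y). tilde \<eta> x y * K x y) \<in> borel_measurable (borel \<Otimes>\<^sub>M borel)"
      if "\<eta> \<in> borel_measurable borel" for \<eta> using that unfolding tilde_def by measurable
    have it: "weak \<eta> (f s) = 1 / 2 * (\<integral>(x, y). tilde \<eta> x y * K x y * f s x * f s y \<partial>plane)"
      if "\<eta> \<in> borel_measurable borel" "\<And>x. \<bar>\<eta> x\<bar> \<le> c" for \<eta>
      unfolding weak_def using pair_weighted(3)[OF fd tm[OF that(1)] bounded_times_K[OF tilde_bound[OF that(2)]]] c kappa_pos by simp
    have iK: "integrable plane (\<lambda>(x, y). K x y * f s x * f s y)"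
      by (rule pair_weighted(1)[OF fd, where C = \<kappa>]) (use K_le K_nonneg kappa_pos in auto)
    have "(\<lambda>m. \<integral>(x, y). tilde (\<Theta> m) x y * K x y * f s x * f s y \<partial>plane) \<longlonglongrightarrow> (\<integral>(x, y). tilde \<theta> x y * K x y * f s x * f s y \<partial>plane)"
    proof (rule integral_dominated_convergence)
      show "integrable plane (\<lambda>p. (3 * c) * (case p of (x, y) \<Rightarrow> K x y * f s x * f s y))"
        using iK by (rule integrable_mult_right)
      show "AE p in plane. norm (case p of (x, y) \<Rightarrow> tilde (\<Theta> m) x y * K x y * f s x * f s y) \<le> (3 * c) * (case p of (x, y) \<Rightarrow> K x y * f s x * f s y)" for m
      proof (rule AE_I2)
        fix p :: "real \<times> real"
        obtain x y where p: "p = (x, y)" by (cases p)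
        have "\<bar>tilde (\<Theta> m) x y\<bar> * (K x y * f s x * f s y) \<le> (3 * c) * (K x y * f s x * f s y)"
          using tilde_bound[OF \<Theta>b] by (intro mult_right_mono) (auto simp: K_nonneg nn)
        then show "norm (case p of (x, y) \<Rightarrow> tilde (\<Theta> m) x y * K x y * f s x * f s y) \<le> (3 * c) * (case p of (x, y) \<Rightarrow> K x y * f s x * f s y)"
          by (simp add: p abs_mult K_nonneg nn mult.assoc)
      qed
      show "AE p in plane. (\<lambda>m. case p of (x, y) \<Rightarrow> tilde (\<Theta> m) x y * K x y * f s x * f s y) \<longlonglongrightarrow> (case p of (x, y) \<Rightarrow> tilde \<theta> x y * K x y * f s x * f s y)"
        unfolding tilde_def by (intro AE_I2) (auto split: prod.split intro!: tendsto_intros \<Theta>l)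
    qed (unfold tilde_def, measurable)
    then show ?thesis
      unfolding it[OF \<Theta>m \<Theta>b] it[OF \<theta> bd] by (intro tendsto_mult tendsto_const)
  qed
  have eq: "(\<lambda>s. indicator {0..<t} s * weak (\<Theta> m) (f s)) \<in> borel_measurable borel"
    "(LBINT x. \<Theta> m x * f t x) - (LBINT x. \<Theta> m x * u x) = (LBINT s. indicator {0..<t} s * weak (\<Theta> m) (f s))" for m
    by (rule weak_equation_compact[OF t \<Theta>m \<Theta>b, where R = "real m"]; erule \<Theta>0)+
  show m: "(\<lambda>s. indicator {0..<t} s * weak \<theta> (f s)) \<in> borel_measurable borel"
  proof (rule borel_measurable_LIMSEQ_real)
    show "(\<lambda>n. indicator {0..<t} s * weak (\<Theta> n) (f s)) \<longlonglongrightarrow> indicator {0..<t} s * weak \<theta> (f s)" for s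
      using wl[of s] by (cases "s \<ge> 0") (auto intro!: tendsto_mult)
  qed (rule eq(1))
  have "(\<lambda>m. LBINT s. indicator {0..<t} s * weak (\<Theta> m) (f s)) \<longlonglongrightarrow> (LBINT s. indicator {0..<t} s * weak \<theta> (f s))"
  proof (rule integral_dominated_convergence)
    show "integrable lborel (\<lambda>s. indicator {0..t} s * (c * lip))"
      using t by (intro integrable_mult_left integrable_real_indicator) auto
    show "AE s in lborel. norm (indicator {0..<t} s * weak (\<Theta> m) (f s)) \<le> indicator {0..t} s * (c * lip)" for m
    proof (rule AE_I2)
      fix s
      show "norm (indicator {0..<t} s * weak (\<Theta> m) (f s)) \<le> indicator {0..t} s * (c * lip)"
        using weak_bound[OF f_dist \<Theta>m \<Theta>b, of s m] by (auto simp: indicator_def lip_def mult_ac)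
    qed
    show "AE s in lborel. (\<lambda>m. indicator {0..<t} s * weak (\<Theta> m) (f s)) \<longlonglongrightarrow> indicator {0..<t} s * weak \<theta> (f s)"
    proof (rule AE_I2)
      fix s
      show "(\<lambda>m. indicator {0..<t} s * weak (\<Theta> m) (f s)) \<longlonglongrightarrow> indicator {0..<t} s * weak \<theta> (f s)"
        using wl[of s] by (cases "s \<ge> 0") (auto intro!: tendsto_mult)
    qed
  qed (use m eq(1) in simp_all)
  moreover have "(\<lambda>m. (LBINT x. \<Theta> m x * f t x) - (LBINT x. \<Theta> m x * u x)) \<longlonglongrightarrow>
     (LBINT x. \<theta> x * f t x) - (LBINT x. \<theta> x * u x)"
    using t by (intro tendsto_diff lin f_dist u_dist) auto
  ultimately show "(LBINT x. \<theta> x * f t x) - (LBINT x. \<theta> x * u x) = (LBINT s. indicator {0..<t} s * weak \<theta> (f s))"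
    unfolding eq(2) by (rule LIMSEQ_unique[rotated])
qed

end

section \<open>Lebesgue measurable data on the half-line\<close>

lemma AE_half_line_iff: "(AE x in half_line. P x) \<longleftrightarrow> (AE x in lebesgue. x > 0 \<longrightarrow> P x)"
  by (subst AE_restrict_space_iff) auto

lemma AE_half_lineI: "AE x in lborel. x > 0 \<longrightarrow> P x \<Longrightarrow> AE x in half_line. P x"
  unfolding AE_half_line_iff by (rule AE_completion)

lemma AE_half_lineD: "AE x in half_line. P x \<Longrightarrow> AE x in lborel. x > 0 \<longrightarrow> P x"
  unfolding AE_half_line_iff by (simp add: AE_completion_iff)

lemma half_line_borel:
  fixes g :: "real \<Rightarrow> real"
  assumes [measurable]: "g \<in> borel_measurable borel"
  shows "integrable half_line g \<longleftrightarrow> integrable lborel (\<lambda>x. indicator {0<..} x * g x)"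
    and "(LINT x|half_line. g x) = (LBINT x. indicator {0<..} x * g x)"
  by (simp_all add: integrable_restrict_space integral_restrict_space integrable_completion integral_completion)

lemma half_line_vanishing:
  fixes g :: "real \<Rightarrow> real"
  assumes "g \<in> borel_measurable borel" and z: "\<And>x. x \<le> 0 \<Longrightarrow> g x = 0"
  shows "integrable half_line g \<longleftrightarrow> integrable lborel g"
    and "(LINT x|half_line. g x) = (LBINT x. g x)"
proof -
  have "(\<lambda>x. indicator {0<..} x * g x) = g" using z by (auto simp: fun_eq_iff indicator_def not_less)
  then show "integrable half_line g \<longleftrightarrow> integrable lborel g" "(LINT x|half_line. g x) = (LBINT x. g x)"
    using half_line_borel[OF assms(1)] by simp_all
qed

text \<open>
  Completeness of Lebesgue measure. It yields measurability of the inner integrals in the theorem,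
  which are known only almost everywhere.
\<close>

lemma half_line_measurable_AE:
  fixes g g' :: "real \<Rightarrow> real"
  assumes g: "g \<in> borel_measurable half_line" and ae: "AE x in half_line. g x = g' x"
  shows "g' \<in> borel_measurable half_line"
proof -
  let ?I = "\<lambda>h x. indicator {0<..} x *\<^sub>R (h x :: real)"
  have 1: "?I g \<in> borel_measurable lebesgue" using g by (simp add: borel_measurable_restrict_space_iff)
  have "?I g' \<in> borel_measurable lebesgue"
  proof (rule measurableI)
    fix A :: "real set" assume A: "A \<in> sets borel"
    show "?I g' -` A \<inter> space lebesgue \<in> sets lebesgue"
    proof (rule completion.in_sets_AE[where A = "?I g -` A \<inter> space lebesgue"])
      show "AE x in lebesgue. (x \<in> ?I g -` A \<inter> space lebesgue) = (x \<in> ?I g' -` A \<inter> space lebesgue)"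
        using ae unfolding AE_half_line_iff by eventually_elim (auto simp: indicator_def)
    qed (use measurable_sets[OF 1 A] in auto)
  qed simp
  then show ?thesis by (simp add: borel_measurable_restrict_space_iff)
qed

lemma half_line_cong:
  fixes g g' :: "real \<Rightarrow> real"
  assumes g: "g \<in> borel_measurable half_line" and ae: "AE x in half_line. g' x = g x"
  shows "(LINT x|half_line. g' x) = (LINT x|half_line. g x)"
    and "integrable half_line g' \<longleftrightarrow> integrable half_line g"
proof -
  have ae': "AE x in half_line. g x = g' x" using ae by eventually_elim simp
  note g' = half_line_measurable_AE[OF g ae']
  show "(LINT x|half_line. g' x) = (LINT x|half_line. g x)" by (rule integral_cong_AE[OF g' g ae])
  show "integrable half_line g' \<longleftrightarrow> integrable half_line g" by (rule integrable_cong_AE[OF g' g ae])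
qed

lemma half_line_borel_version:
  fixes g :: "real \<Rightarrow> real"
  assumes g: "g \<in> borel_measurable half_line"
  shows "\<exists>g'. g' \<in> borel_measurable borel \<and> (AE x in half_line. g x = g' x)"
proof -
  have "(\<lambda>x. indicator {0<..} x *\<^sub>R g x) \<in> borel_measurable lebesgue"
    using g by (simp add: borel_measurable_restrict_space_iff)
  from completion_ex_borel_measurable_real[OF this]
  obtain g' where g': "g' \<in> borel_measurable lborel" "AE x in lborel. indicator {0<..} x *\<^sub>R g x = g' x" by blast
  have "AE x in half_line. g x = g' x"
    using g'(2) by (intro AE_half_lineI, eventually_elim) (auto simp: indicator_def split: if_splits)
  then show ?thesis using g'(1) by auto
qed

lemma borel_half_line: "g \<in> borel_measurable borel \<Longrightarrow> g \<in> borel_measurable half_line"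
  for g :: "real \<Rightarrow> real"
  by (intro measurable_restrict_space1 measurable_completion) simp

text \<open>
  Off a Borel null set \<open>N\<close> of the plane, \<open>K\<close> agrees with a Borel function. Setting the kernel to
  zero on \<open>N\<close> and on its mirror image keeps symmetry, and each value of the new kernel is \<open>0\<close> or the
  value of \<open>K\<close>, so that pointwise bounds survive.
\<close>

lemma ex_borel_kernel:
  fixes K :: "real \<Rightarrow> real \<Rightarrow> real"
  assumes K_meas: "(\<lambda>(x, y). K x y) \<in> borel_measurable (lebesgue_on ({0<..} \<times> {0<..}))"
    and sym: "\<And>x y. x > 0 \<Longrightarrow> y > 0 \<Longrightarrow> K x y = K y x"
  shows "\<exists>K'. case_prod K' \<in> borel_measurable (borel \<Otimes>\<^sub>M borel) \<and> (\<forall>x y. K' x y = K' y x) \<and>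
    (\<forall>x y. K' x y = 0 \<or> (x > 0 \<and> y > 0 \<and> K' x y = K x y)) \<and>
    (AE x in lborel. AE y in lborel. x > 0 \<longrightarrow> y > 0 \<longrightarrow> K x y = K' x y)"
proof -
  let ?Q = "{0<..} \<times> {0<..} :: (real \<times> real) set"
  have Q: "?Q \<in> sets borel" by (simp add: borel_prod[symmetric])
  have "?Q \<inter> space lebesgue \<in> sets lebesgue" using Q by simp
  then have "(\<lambda>p. indicator ?Q p *\<^sub>R (case p of (x, y) \<Rightarrow> K x y)) \<in> borel_measurable lebesgue"
    using K_meas by (subst (asm) borel_measurable_restrict_space_iff) auto
  from completion_ex_borel_measurable_real[OF this]
  obtain k where k: "k \<in> borel_measurable lborel"
    and kae: "AE p in lborel. indicator ?Q p *\<^sub>R (case p of (x, y) \<Rightarrow> K x y) = k p" by blast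
  from kae obtain N where N: "{p. indicator ?Q p *\<^sub>R (case p of (x, y) \<Rightarrow> K x y) \<noteq> k p} \<subseteq> N"
    "emeasure lborel N = 0" "N \<in> sets lborel" by (auto elim: AE_E)
  have km[measurable]: "k \<in> borel_measurable (borel \<Otimes>\<^sub>M borel)" using k by (simp add: borel_prod)
  have Nm[measurable]: "N \<in> sets (borel \<Otimes>\<^sub>M borel)" using N(3) unfolding borel_prod by simp
  have kK: "k (x, y) = K x y" if "x > 0" "y > 0" "(x, y) \<notin> N" for x y
    using that N(1) by (force simp: indicator_def)
  define K' where "K' x y = (if x > 0 \<and> y > 0 \<and> (x, y) \<notin> N \<and> (y, x) \<notin> N then k (x, y) else 0)" for x y
  have "AE p in lborel. p \<notin> N" using N(2,3) by (intro AE_not_in) (auto simp: null_sets_def)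
  then have "AE p in plane. p \<notin> N" unfolding lborel_prod .
  from lborel_pair.AE_pair[OF this] have ae1: "AE x in lborel. AE y in lborel. (x, y) \<notin> N" by simp
  have "(AE x in lborel. AE y in lborel. (x, y) \<notin> N) \<longleftrightarrow> (AE y in lborel. AE x in lborel. (x, y) \<notin> N)"
  proof (rule lborel_pair.AE_commute)
    have "{p \<in> space plane. (fst p, snd p) \<notin> N} = space (borel \<Otimes>\<^sub>M borel) - N"
      by (auto simp: space_pair_measure)
    then show "{p \<in> space plane. (fst p, snd p) \<notin> N} \<in> sets plane"
      using Nm by simp
  qed
  with ae1 have ae2: "AE x in lborel. AE y in lborel. (y, x) \<notin> N" by simp
  have "AE x in lborel. AE y in lborel. x > 0 \<longrightarrow> y > 0 \<longrightarrow> K x y = K' x y"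
    using ae1 ae2
  proof eventually_elim
    case (elim x)
    then show ?case by eventually_elim (auto simp: K'_def kK)
  qed
  moreover have "K' x y = K' y x" for x y
    unfolding K'_def using kK[of x y] kK[of y x] sym[of x y] by auto
  moreover have "K' x y = 0 \<or> (x > 0 \<and> y > 0 \<and> K' x y = K x y)" for x y
    unfolding K'_def using kK[of x y] by auto
  moreover have "case_prod K' \<in> borel_measurable (borel \<Otimes>\<^sub>M borel)"
    unfolding K'_def by measurable
  ultimately show ?thesis by blast
qed

lemma size_dist_L1w:
  assumes v: "size_dist a b v"
  shows "v \<in> L1" "v \<in> L1w 1" "moment 0 v = (LBINT x. v x)" "moment 1 v = (LBINT x. x * v x)"
    and "norm1 1 v \<le> a + b"
proof -
  have [measurable]: "v \<in> borel_measurable borel" and nn: "\<And>x. 0 \<le> v x" and z: "\<And>x. x \<le> 0 \<Longrightarrow> v x = 0"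
    and i: "integrable lborel v" "integrable lborel (\<lambda>x. x * v x)"
    and le: "(LBINT x. v x) \<le> a" "(LBINT x. x * v x) \<le> b"
    using v by (auto simp: size_dist_def)
  show 1: "v \<in> L1" unfolding L1_def using half_line_vanishing(1)[of v] z i by simp
  have e: "(1 + x powr 1) * \<bar>v x\<bar> = v x + x * v x" for x
    using nn[of x] z[of x] by (cases "x \<le> 0") (auto simp: algebra_simps)
  have z2: "v x + x * v x = 0" if "x \<le> 0" for x using z[OF that] by simp
  have "integrable half_line (\<lambda>x. v x + x * v x)"
    using i by (subst half_line_vanishing(1)) (auto simp: z2)
  then show "v \<in> L1w 1" using 1 unfolding L1w_def mem_Collect_eq e by simp
  have "norm1 1 v = (LBINT x. v x + x * v x)"
    unfolding norm1_def e by (rule half_line_vanishing(2)) (auto simp: z2)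
  also have "\<dots> \<le> a + b" using i le by simp
  finally show "norm1 1 v \<le> a + b" .
  have e0: "x powr 0 * v x = v x" for x using z[of x] by (cases "x \<le> 0") auto
  show "moment 0 v = (LBINT x. v x)"
    unfolding moment_def e0 by (rule half_line_vanishing(2)) (auto simp: z)
  have e1: "x powr 1 * v x = x * v x" for x using z[of x] by (cases "x \<le> 0") auto
  show "moment 1 v = (LBINT x. x * v x)"
    unfolding moment_def e1 by (rule half_line_vanishing(2)) (auto simp: z)
qed

lemma ex_size_dist_version:
  assumes "fin \<in> L1w 1" and nonneg: "AE x in half_line. 0 \<le> fin x"
  shows "\<exists>u. size_dist (LBINT x. u x) (LBINT x. x * u x) u \<and> (AE x in half_line. fin x = u x)"
proof -
  have fi: "integrable half_line fin" "integrable half_line (\<lambda>x. (1 + x powr 1) * \<bar>fin x\<bar>)"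
    using assms(1) by (auto simp: L1w_def L1_def)
  then obtain w where [measurable]: "w \<in> borel_measurable borel" and ae: "AE x in half_line. fin x = w x"
    using half_line_borel_version[of fin] by blast
  define u where "u x = (if x > 0 then max 0 (w x) else 0)" for x
  have [measurable]: "u \<in> borel_measurable borel" unfolding u_def by measurable
  have z: "u x = 0" if "x \<le> 0" for x using that by (simp add: u_def)
  have nn: "0 \<le> u x" for x by (simp add: u_def)
  have "AE x in half_line. x \<in> {0<..}" using AE_space[of half_line] by simp
  with ae nonneg have ae: "AE x in half_line. fin x = u x" by eventually_elim (auto simp: u_def)
  then have ae': "AE x in half_line. u x = fin x" by eventually_elim simp
  have "integrable half_line u" using half_line_cong(2)[OF _ ae'] fi by auto
  then have i0: "integrable lborel u" using half_line_vanishing(1)[of u] z by simp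
  have ae2: "AE x in half_line. (1 + x powr 1) * \<bar>u x\<bar> = (1 + x powr 1) * \<bar>fin x\<bar>"
    using ae by eventually_elim simp
  have "integrable half_line (\<lambda>x. (1 + x powr 1) * \<bar>u x\<bar>)" using half_line_cong(2)[OF _ ae2] fi(2) by auto
  then have "integrable lborel (\<lambda>x. (1 + x powr 1) * \<bar>u x\<bar>)"
    by (subst (asm) half_line_vanishing(1)) (auto simp: z)
  then have i1: "integrable lborel (\<lambda>x. x * u x)"
  proof (rule Bochner_Integration.integrable_bound)
    show "AE x in lborel. norm (x * u x) \<le> norm ((1 + x powr 1) * \<bar>u x\<bar>)"
    proof (rule AE_I2)
      fix x show "norm (x * u x) \<le> norm ((1 + x powr 1) * \<bar>u x\<bar>)"
        using z[of x] by (cases "x \<le> 0") (auto simp: abs_mult intro!: mult_right_mono)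
    qed
  qed measurable
  have "size_dist (LBINT x. u x) (LBINT x. x * u x) u"
    using i0 i1 nn z by (auto simp: size_dist_def)
  with ae show ?thesis by blast
qed

lemma Linf_borel_version:
  assumes "\<theta> \<in> Linf"
  shows "\<exists>\<theta>' c. \<theta>' \<in> borel_measurable borel \<and> (\<forall>x. \<bar>\<theta>' x\<bar> \<le> c) \<and> (AE x in half_line. \<theta> x = \<theta>' x)"
proof -
  from assms obtain C where m: "\<theta> \<in> borel_measurable half_line" and C: "AE x in half_line. \<bar>\<theta> x\<bar> \<le> C"
    by (auto simp: Linf_def)
  from half_line_borel_version[OF m] obtain g where [measurable]: "g \<in> borel_measurable borel"
    and ae: "AE x in half_line. \<theta> x = g x" by blast
  define h where "h x = max (- \<bar>C\<bar>) (min \<bar>C\<bar> (g x))" for x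
  have "h \<in> borel_measurable borel" unfolding h_def by measurable
  moreover have "\<bar>h x\<bar> \<le> \<bar>C\<bar>" for x by (auto simp: h_def)
  moreover have "AE x in half_line. \<theta> x = h x" using ae C by eventually_elim (auto simp: h_def)
  ultimately show ?thesis by blast
qed

text \<open>
  The exceptional null set of \<open>\<theta>\<close> is also avoided by \<open>x + y\<close>, for almost every \<open>y\<close>, by translation
  invariance.
\<close>

lemma tilde_AE:
  assumes "AE x in half_line. \<theta> x = \<theta>' x"
  shows "AE x in half_line. AE y in half_line. tilde \<theta> x y = tilde \<theta>' x y"
proof -
  obtain N where N: "{x. \<not> (x > 0 \<longrightarrow> \<theta> x = \<theta>' x)} \<subseteq> N" "emeasure lborel N = 0" "N \<in> sets lborel"
    using AE_half_lineD[OF assms] by (auto elim: AE_E)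
  have Nae: "AE x in lborel. x \<notin> N" using N(2,3) by (intro AE_not_in) (auto simp: null_sets_def)
  have sh: "AE y in lborel. x + y \<notin> N" for x
  proof -
    have "AE y in lborel. x + 1 * y \<notin> N"
      by (rule AE_borel_affine[where P = "\<lambda>z. z \<notin> N"]) (use N(3) Nae in auto)
    then show ?thesis by simp
  qed
  have "AE x in lborel. x > 0 \<longrightarrow> (AE y in half_line. tilde \<theta> x y = tilde \<theta>' x y)"
    using Nae
  proof eventually_elim
    case (elim x)
    show ?case
    proof
      assume "x > 0"
      have "AE y in lborel. y > 0 \<longrightarrow> tilde \<theta> x y = tilde \<theta>' x y"
        using Nae sh[of x]
      proof eventually_elim
        case (elim y)
        have "\<theta> z = \<theta>' z" if "z > 0" "z \<notin> N" for z using N(1) that by auto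
        then show ?case using elim \<open>x \<notin> N\<close> \<open>x > 0\<close> by (auto simp: tilde_def)
      qed
      then show "AE y in half_line. tilde \<theta> x y = tilde \<theta>' x y" by (rule AE_half_lineI)
    qed
  qed
  then show ?thesis by (rule AE_half_lineI)
qed

lemma C_L1_if_lipschitz:
  assumes f: "\<And>t. t \<ge> 0 \<Longrightarrow> size_dist a b (f t)" and l: "0 \<le> l"
    and lip: "\<And>s t. 0 \<le> s \<Longrightarrow> s \<le> t \<Longrightarrow> (LBINT x. \<bar>f t x - f s x\<bar>) \<le> l * (t - s)"
  shows "f \<in> C_L1"
  unfolding C_L1_def
proof (intro CollectI conjI allI impI)
  fix t :: real assume t: "t \<ge> 0"
  show "f t \<in> L1" by (rule size_dist_L1w(1)[OF f[OF t]])
  have e: "(LINT x|half_line. \<bar>f s x - f t x\<bar>) = (LBINT x. \<bar>f s x - f t x\<bar>)" if "s \<ge> 0" for s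
    using f[OF that] f[OF t] by (intro half_line_vanishing(2)) (auto simp: size_dist_def)
  have le: "(LINT x|half_line. \<bar>f s x - f t x\<bar>) \<le> l * \<bar>s - t\<bar>" if "s \<ge> 0" for s
  proof (cases "s \<le> t")
    case True
    then show ?thesis unfolding e[OF that] using lip[OF that True] by (simp add: abs_minus_commute)
  next
    case False
    then show ?thesis unfolding e[OF that] using lip[OF t, of s] by simp
  qed
  show "((\<lambda>s. LINT x|half_line. \<bar>f s x - f t x\<bar>) \<longlongrightarrow> 0) (at t within {0..})"
  proof (rule Lim_null_comparison)
    show "\<forall>\<^sub>F s in at t within {0..}. norm (LINT x|half_line. \<bar>f s x - f t x\<bar>) \<le> l * \<bar>s - t\<bar>"
      using le by (auto simp: eventually_at_filter intro!: always_eventually)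
    have "((\<lambda>s. l * \<bar>s - t\<bar>) \<longlongrightarrow> l * \<bar>t - t\<bar>) (at t within {0..})" by (intro tendsto_intros)
    then show "((\<lambda>s. l * \<bar>s - t\<bar>) \<longlongrightarrow> 0) (at t within {0..})" by simp
  qed
qed

text \<open>
  Simple approximants in time: freeze \<open>f\<close> at the grid of mesh \<open>1 / (n + 1)\<^sup>2\<close> up to time \<open>n\<close> and
  restrict it to sizes up to \<open>n\<close>. On those sizes the weight is at most \<open>1 + n\<close>, so the mesh makes the
  error \<open>O(1 / n)\<close> although the Lipschitz bound is in the unweighted norm; beyond \<open>n\<close> the error is a
  tail of an integrable function.
\<close>

lemma Linf_L1w_if_lipschitz:
  assumes f: "\<And>t. t \<ge> 0 \<Longrightarrow> size_dist a b (f t)" and l: "0 \<le> l"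
    and lip: "\<And>s t. 0 \<le> s \<Longrightarrow> s \<le> t \<Longrightarrow> (LBINT x. \<bar>f t x - f s x\<bar>) \<le> l * (t - s)"
  shows "f \<in> Linf_L1w 1"
proof -
  have pos: "AE t in half_line. 0 < t" using AE_space[of half_line] by simp
  define N where "N n = (real n + 1)\<^sup>2" for n
  have N: "N n > 0" for n by (simp add: N_def)
  \<comment> \<open>An index in the natural numbers makes the values finite in number; 0 marks times beyond n.\<close>
  define q where "q n t = (if t \<le> real n then Suc (nat \<lfloor>t * N n\<rfloor>) else 0)" for n :: nat and t :: real
  define G where "G n j = (case j of 0 \<Rightarrow> (\<lambda>_. 0) | Suc i \<Rightarrow> (\<lambda>x. indicator {..real n} x * f (real i / N n) x))" for n j
  have G: "size_dist a b (G n j)" for n j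
  proof (cases j)
    case 0
    then show ?thesis using size_dist_nonneg[OF f[of 0]] by (simp add: G_def size_dist_def)
  next
    case (Suc i)
    have d: "size_dist a b (f (real i / N n))" using N[of n] by (intro f) simp
    let ?g = "f (real i / N n)"
    have [measurable]: "?g \<in> borel_measurable borel" and nn: "\<And>x. 0 \<le> ?g x" and z: "\<And>x. x \<le> 0 \<Longrightarrow> ?g x = 0"
      and i: "integrable lborel ?g" "integrable lborel (\<lambda>x. x * ?g x)"
      and le: "(LBINT x. ?g x) \<le> a" "(LBINT x. x * ?g x) \<le> b"
      using d by (auto simp: size_dist_def)
    have xnn: "0 \<le> x * ?g x" for x using nn[of x] z[of x] by (cases "x \<le> 0") auto
    have i0: "integrable lborel (\<lambda>x. indicator {..real n} x * ?g x)"
      using size_dist_set(1)[OF d, of "{..real n}"] by simp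
    have i1: "integrable lborel (\<lambda>x. x * (indicator {..real n} x * ?g x))"
      using integrable_real_mult_indicator[OF _ i(2), of "{..real n}"] by (simp add: mult_ac)
    have "(LBINT x. indicator {..real n} x * ?g x) \<le> a"
      using size_dist_set(3)[OF d, of "{..real n}"] by simp
    moreover have "(LBINT x. x * (indicator {..real n} x * ?g x)) \<le> (LBINT x. x * ?g x)"
      by (rule integral_mono[OF i1 i(2)]) (use xnn in \<open>auto simp: indicator_def\<close>)
    ultimately show ?thesis
      using i0 i1 nn z le Suc by (simp add: G_def size_dist_def)
  qed
  define v where "v n t = G n (q n t)" for n t
  have simple: "simple_function half_line (v n)" for n
    unfolding v_def
  proof (rule simple_function_compose1)
    have "q n ` space half_line \<subseteq> {..Suc (nat \<lfloor>real n * N n\<rfloor>)}"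
    proof (rule image_subsetI)
      fix t :: real
      have "\<lfloor>t * N n\<rfloor> \<le> \<lfloor>real n * N n\<rfloor>" if "t \<le> real n" using that N[of n] by (intro floor_mono mult_right_mono) auto
      then show "q n t \<in> {..Suc (nat \<lfloor>real n * N n\<rfloor>)}" by (auto simp: q_def nat_mono)
    qed
    then have fin: "finite (q n ` space half_line)" by (rule finite_subset) simp
    have "q n \<in> borel \<rightarrow>\<^sub>M count_space UNIV" unfolding q_def by measurable
    then have "q n \<in> half_line \<rightarrow>\<^sub>M count_space UNIV"
      by (intro measurable_restrict_space1 measurable_completion) simp
    then have "q n -` {j} \<inter> space half_line \<in> sets half_line" for j by (rule measurable_sets) simp
    with fin show "simple_function half_line (q n)" unfolding simple_function_def by blast
  qed
  have conv: "(\<lambda>n. norm1 1 (\<lambda>x. v n t x - f t x)) \<longlonglongrightarrow> 0" if t: "t > 0" for t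
  proof -
    have d: "size_dist a b (f t)" using t by (intro f) simp
    have [measurable]: "f t \<in> borel_measurable borel" and nn: "\<And>x. 0 \<le> f t x" and z: "\<And>x. x \<le> 0 \<Longrightarrow> f t x = 0"
      and i: "integrable lborel (f t)" "integrable lborel (\<lambda>x. x * f t x)"
      using d by (auto simp: size_dist_def)
    have iw: "integrable lborel (\<lambda>x. f t x + x * f t x)" using i by simp
    have wnn: "0 \<le> f t x + x * f t x" for x using nn[of x] z[of x] by (cases "x \<le> 0") auto
    define tail where "tail n = (LBINT x. indicator {real n<..} x * (f t x + x * f t x))" for n :: nat
    have "tail \<longlonglongrightarrow> (LBINT x::real. 0)"
      unfolding tail_def
    proof (rule integral_dominated_convergence)
      show "integrable lborel (\<lambda>x. f t x + x * f t x)" by (rule iw)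
      show "AE x in lborel. norm (indicator {real n<..} x * (f t x + x * f t x)) \<le> f t x + x * f t x" for n
        using wnn by (intro AE_I2) (auto simp: indicator_def)
      show "AE x in lborel. (\<lambda>n. indicator {real n<..} x * (f t x + x * f t x)) \<longlonglongrightarrow> 0"
      proof (rule AE_I2, rule tendsto_eventually)
        fix x
        have "\<forall>\<^sub>F n in sequentially. real n \<ge> x" using filterlim_real_sequentially unfolding filterlim_at_top by blast
        then show "\<forall>\<^sub>F n in sequentially. indicator {real n<..} x * (f t x + x * f t x) = 0"
          by eventually_elim simp
      qed
    qed auto
    then have tail0: "tail \<longlonglongrightarrow> 0" by simp
    have main: "norm1 1 (\<lambda>x. v n t x - f t x) \<le> l * inverse (real (Suc n)) + tail n" if n: "t \<le> real n" for n
    proof -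
      define s where "s = real (nat \<lfloor>t * N n\<rfloor>) / N n"
      have fl: "real (nat \<lfloor>t * N n\<rfloor>) = of_int \<lfloor>t * N n\<rfloor>" using t N[of n] by simp
      have "of_int \<lfloor>t * N n\<rfloor> \<le> t * N n" "t * N n \<le> of_int \<lfloor>t * N n\<rfloor> + 1" by linarith+
      then have "s \<le> (t * N n) / N n" "(t * N n - of_int \<lfloor>t * N n\<rfloor>) / N n \<le> 1 / N n"
        using N[of n] unfolding s_def fl by (intro divide_right_mono; linarith)+
      moreover have "(t * N n) / N n = t" "(t * N n - of_int \<lfloor>t * N n\<rfloor>) / N n = t - s"
        using N[of n] by (simp_all add: s_def fl diff_divide_distrib)
      ultimately have s: "0 \<le> s" "s \<le> t" "t - s \<le> 1 / N n"
        using N[of n] by (auto simp: s_def)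
      have vs: "v n t x = indicator {..real n} x * f s x" for x using n by (simp add: v_def G_def q_def s_def)
      have ds: "size_dist a b (f s)" by (rule f[OF s(1)])
      have [measurable]: "f s \<in> borel_measurable borel" and zs: "\<And>x. x \<le> 0 \<Longrightarrow> f s x = 0" and ifs: "integrable lborel (f s)"
        using ds by (auto simp: size_dist_def)
      let ?h = "\<lambda>x. (1 + x powr 1) * \<bar>indicator {..real n} x * f s x - f t x\<bar>"
      let ?k = "\<lambda>x. (1 + real n) * \<bar>f t x - f s x\<bar> + indicator {real n<..} x * (f t x + x * f t x)"
      have ik1: "integrable lborel (\<lambda>x. (1 + real n) * \<bar>f t x - f s x\<bar>)" using i ifs by simp
      have ik2: "integrable lborel (\<lambda>x. indicator {real n<..} x * (f t x + x * f t x))"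
        using integrable_real_mult_indicator[OF _ iw, of "{real n<..}"] by (simp add: mult_ac)
      have hk: "?h x \<le> ?k x" for x
      proof (cases "x \<le> 0")
        case True
        then show ?thesis using z zs by simp
      next
        case pos: False
        show ?thesis
        proof (cases "x \<le> real n")
          case True
          then have "(1 + x) * \<bar>f s x - f t x\<bar> \<le> (1 + real n) * \<bar>f s x - f t x\<bar>" by (intro mult_right_mono) auto
          then show ?thesis using pos True by (simp add: abs_minus_commute)
        next
          case False
          then show ?thesis using pos nn[of x] by (simp add: algebra_simps)
        qed
      qed
      have ih: "integrable lborel ?h"
        by (rule Bochner_Integration.integrable_bound[OF Bochner_Integration.integrable_add[OF ik1 ik2]])
           (use hk in \<open>auto intro!: AE_I2 intro: order_trans[OF _ abs_ge_self]\<close>)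
      have "norm1 1 (\<lambda>x. v n t x - f t x) = (LBINT x. ?h x)"
        unfolding norm1_def vs by (rule half_line_vanishing(2)) (auto simp: z zs)
      also have "\<dots> \<le> (LBINT x. ?k x)"
        by (rule integral_mono[OF ih Bochner_Integration.integrable_add[OF ik1 ik2] hk])
      also have "\<dots> = (1 + real n) * (LBINT x. \<bar>f t x - f s x\<bar>) + tail n"
        unfolding tail_def Bochner_Integration.integral_add[OF ik1 ik2] by simp
      also have "\<dots> \<le> (1 + real n) * (l * (1 / N n)) + tail n"
        using lip[OF s(1,2)] mult_left_mono[OF s(3) l] by (intro add_right_mono mult_left_mono) auto
      also have "(1 + real n) * (l * (1 / N n)) = l * inverse (real (Suc n))"
      proof -
        have "m * (l * (1 / (m * m))) = l * inverse m" if "m > 0" for m :: real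
          using that by (simp add: field_simps)
        from this[of "1 + real n"] show ?thesis by (simp add: N_def power2_eq_square add.commute)
      qed
      finally show ?thesis .
    qed
    show ?thesis
    proof (rule Lim_null_comparison)
      have "\<forall>\<^sub>F n in sequentially. real n \<ge> t" using filterlim_real_sequentially unfolding filterlim_at_top by blast
      then show "\<forall>\<^sub>F n in sequentially. norm (norm1 1 (\<lambda>x. v n t x - f t x)) \<le> l * inverse (real (Suc n)) + tail n"
      proof eventually_elim
        case (elim n)
        have "0 \<le> norm1 1 (\<lambda>x. v n t x - f t x)" unfolding norm1_def by (intro integral_nonneg_AE AE_I2) auto
        then show ?case using main[OF elim] by simp
      qed
      have "(\<lambda>n. l * inverse (real (Suc n)) + tail n) \<longlonglongrightarrow> l * 0 + 0"
        by (intro tendsto_add tendsto_mult tendsto_const LIMSEQ_inverse_real_of_nat tail0)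
      then show "(\<lambda>n. l * inverse (real (Suc n)) + tail n) \<longlonglongrightarrow> 0" by simp
    qed
  qed
  show ?thesis
    unfolding Linf_L1w_def
  proof (intro CollectI conjI exI[of _ v] exI[of _ "a + b"] allI impI)
    show "AE t in half_line. f t \<in> L1w 1" using pos by eventually_elim (rule size_dist_L1w(2)[OF f], simp)
    show "v n t \<in> L1w 1" for n t unfolding v_def by (rule size_dist_L1w(2)[OF G])
    show "AE t in half_line. (\<lambda>n. norm1 1 (\<lambda>x. v n t x - f t x)) \<longlonglongrightarrow> 0" using pos by eventually_elim (rule conv)
    show "AE t in half_line. norm1 1 (f t) \<le> a + b" using pos by eventually_elim (rule size_dist_L1w(5)[OF f], simp)
  qed (rule simple)
qed

lemma ex_lborel_solution:
  assumes "coag_problem K \<kappa> u a b"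
  shows "\<exists>f l. 0 \<le> l \<and> (\<forall>t\<ge>0. size_dist a b (f t)) \<and>
    (\<forall>s t. 0 \<le> s \<longrightarrow> s \<le> t \<longrightarrow> (LBINT x. \<bar>f t x - f s x\<bar>) \<le> l * (t - s)) \<and>
    (\<forall>t>0. \<forall>\<theta> c. \<theta> \<in> borel_measurable borel \<longrightarrow> (\<forall>x. \<bar>\<theta> x\<bar> \<le> c) \<longrightarrow>
       (\<lambda>s. indicator {0..<t} s * coag_kernel.weak K \<theta> (f s)) \<in> borel_measurable borel \<and>
       (LBINT x. \<theta> x * f t x) - (LBINT x. \<theta> x * u x) =
         (LBINT s. indicator {0..<t} s * coag_kernel.weak K \<theta> (f s)))"
proof -
  interpret coag_problem K \<kappa> u a b by fact
  obtain r :: "nat \<Rightarrow> nat" and f where "coag_limit K \<kappa> u a b r f"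
  proof -
    obtain r :: "nat \<Rightarrow> nat" and f where rf: "strict_mono r" "\<forall>t\<ge>0. size_dist a b (f t) \<and>
     (\<forall>\<phi>. sublinear \<phi> \<longrightarrow> (\<lambda>n. LBINT x. \<phi> x * approx (r n) t x) \<longlonglongrightarrow> (LBINT x. \<phi> x * f t x))"
      using ex_weak_limit by blast
    have "coag_limit K \<kappa> u a b r f" by unfold_locales (use rf in auto)
    then show ?thesis by (rule that)
  qed
  then interpret coag_limit K \<kappa> u a b r f .
  show ?thesis
    by (intro exI[of _ f] exI[of _ lip] conjI allI impI lip_nonneg f_dist f_lipschitz weak_equation) auto
qed


text \<open>
  For \<open>y\<close> beyond some \<open>Y\<close> the supremum over sizes below \<open>x + 1\<close> bounds \<open>K x y / y\<close> at the point \<open>x\<close>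
  itself; below \<open>Y\<close> the growth condition gives a constant.
\<close>

lemma sublinear_if_omega_tendsto_0:
  fixes K K' :: "real \<Rightarrow> real \<Rightarrow> real"
  assumes K_bound: "\<And>y. y > 0 \<Longrightarrow> 0 \<le> K x y \<and> K x y \<le> \<kappa> * (1 + x) * (1 + y)"
    and bdd: "\<And>y. y > 0 \<Longrightarrow> bdd_above ((\<lambda>x. K x y / y) ` {0<..<x + 1})"
    and lim: "(omega K (x + 1) \<longlongrightarrow> 0) at_top" and x: "x > 0" and kappa: "\<kappa> > 0"
    and [measurable]: "K' x \<in> borel_measurable borel"
    and K': "\<And>y. K' x y = 0 \<or> y > 0 \<and> K' x y = K x y"
  shows "sublinear (K' x)"
  unfolding sublinear_def
proof (intro conjI allI impI)
  fix e :: real assume "e > 0"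
  then have "\<forall>\<^sub>F y in at_top. omega K (x + 1) y < e" by (rule order_tendstoD(2)[OF lim])
  then obtain Y where Y: "\<And>y. y \<ge> Y \<Longrightarrow> omega K (x + 1) y < e" by (auto simp: eventually_at_top_linorder)
  define C where "C = \<kappa> * (1 + x) * (1 + \<bar>Y\<bar>)"
  have C: "C \<ge> 0" using kappa x by (simp add: C_def)
  show "\<exists>C\<ge>0. \<forall>y>0. \<bar>K' x y\<bar> \<le> e * y + C"
  proof (intro exI[of _ C] conjI allI impI C)
    fix y :: real assume y: "y > 0"
    have ey: "0 \<le> e * y" using y \<open>e > 0\<close> by simp
    have "K x y \<le> e * y + C"
    proof (cases "y \<ge> Y")
      case True
      have "K x y / y \<le> omega K (x + 1) y"
        unfolding omega_def using x by (intro cSUP_upper bdd[OF y]) auto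
      then have "K x y / y \<le> e" using Y[OF True] by simp
      then show ?thesis using y C by (simp add: divide_le_eq)
    next
      case False
      have "K x y \<le> \<kappa> * (1 + x) * (1 + y)" using K_bound[OF y] by simp
      also have "\<dots> \<le> C" unfolding C_def using False kappa x y by (intro mult_left_mono) auto
      finally show ?thesis using ey by simp
    qed
    then show "\<bar>K' x y\<bar> \<le> e * y + C" using K'[of y] K_bound[OF y] ey C by auto
  qed
qed fact

theorem theorem3p3:
  fixes K :: "real \<Rightarrow> real \<Rightarrow> real" and \<kappa> :: real and fin :: "real \<Rightarrow> real"
  assumes K_meas: "(\<lambda>(x, y). K x y) \<in> borel_measurable (lebesgue_on ({0<..} \<times> {0<..}))"
    and kappa: "\<kappa> > 0"
    and K_bound: "\<And>x y. x > 0 \<Longrightarrow> y > 0 \<Longrightarrow>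
           0 \<le> K x y \<and> K x y = K y x \<and> K x y \<le> \<kappa> * (1 + x) * (1 + y)"
    and K_omega: "\<And>R. R > 0 \<Longrightarrow> (omega K R \<longlongrightarrow> 0) at_top"
    and fin_L1: "fin \<in> L1w 1"
    and fin_nonneg: "AE x in half_line. 0 \<le> fin x"
  shows "\<exists>f :: real \<Rightarrow> real \<Rightarrow> real.
           (\<forall>t\<ge>0. AE x in half_line. 0 \<le> f t x) \<and>
           f \<in> C_L1 \<inter> Linf_L1w 1 \<and>
           (\<forall>t>0. \<forall>\<theta>\<in>Linf.
              (LINT x|half_line. \<theta> x * (f t x - fin x)) =
              1 / 2 * (LINT s|lebesgue_on {0<..<t}. LINT x|half_line. LINT y|half_line.
                          tilde \<theta> x y * K x y * f s x * f s y)) \<and>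
           (\<forall>t\<ge>0. moment 0 (f t) \<le> moment 0 fin) \<and>
           (\<forall>t\<ge>0. f t \<in> L1w 1 \<and> moment 1 (f t) \<le> moment 1 fin)"
proof -
  obtain K' where K'm: "case_prod K' \<in> borel_measurable (borel \<Otimes>\<^sub>M borel)"
    and K'sym: "\<And>x y. K' x y = K' y x"
    and K'K: "\<And>x y. K' x y = 0 \<or> (x > 0 \<and> y > 0 \<and> K' x y = K x y)"
    and K'ae: "AE x in lborel. AE y in lborel. x > 0 \<longrightarrow> y > 0 \<longrightarrow> K x y = K' x y"
    using ex_borel_kernel[OF K_meas] K_bound by meson
  obtain u where u: "size_dist (LBINT x. u x) (LBINT x. x * u x) u"
    and u_ae: "AE x in half_line. fin x = u x"
    using ex_size_dist_version[OF fin_L1 fin_nonneg] by blast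
  define a b where "a = (LBINT x. u x)" and "b = (LBINT x. x * u x)"
  note u = u[folded a_def b_def]
  interpret coag_kernel K' \<kappa>
  proof
    show "0 \<le> K' x y" for x y using K'K[of x y] K_bound[of x y] by auto
    show "K' x y = 0" if "x \<le> 0" for x y using K'K[of x y] that by auto
    show "K' x y \<le> \<kappa> * (1 + x) * (1 + y)" if "0 < x" "0 < y" for x y
      using K'K[of x y] K_bound[OF that] by auto
  qed (fact K'm kappa K'sym)+
  have "coag_problem K' \<kappa> u a b"
  proof unfold_locales
    fix x
    have m: "(\<lambda>y. K' x y) \<in> borel_measurable borel" by measurable
    show "sublinear (K' x)"
    proof (cases "x > 0")
      case True
      show ?thesis
      proof (rule sublinear_if_omega_tendsto_0[where K = K, OF _ _ K_omega True kappa])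
        show "0 \<le> K x y \<and> K x y \<le> \<kappa> * (1 + x) * (1 + y)" if "y > 0" for y using K_bound[OF True that] by simp
        show "K' x y = 0 \<or> y > 0 \<and> K' x y = K x y" for y using K'K[of x y] by auto
        show "bdd_above ((\<lambda>z. K z y / y) ` {0<..<x + 1})" if y: "y > 0" for y
        proof (rule bdd_aboveI2)
          fix z assume z: "z \<in> {0<..<x + 1}"
          have "K z y \<le> \<kappa> * (1 + z) * (1 + y)" using K_bound[of z y] z y by simp
          also have "\<dots> \<le> \<kappa> * (1 + (x + 1)) * (1 + y)" using z y kappa by (intro mult_right_mono mult_left_mono) auto
          finally show "K z y / y \<le> \<kappa> * (1 + (x + 1)) * (1 + y) / y" using y by (intro divide_right_mono) auto
        qed
      qed (use m True in auto)
    next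
      case False
      then have "K' x = (\<lambda>_. 0)" using K_zero by auto
      then show ?thesis using sublinear_bounded[of "\<lambda>_. 0" 0] by simp
    qed
  qed (fact u)
  from ex_lborel_solution[OF this] obtain f l where l: "0 \<le> l"
    and f_all: "\<forall>t\<ge>0. size_dist a b (f t)"
    and lip_all: "\<forall>s t. 0 \<le> s \<longrightarrow> s \<le> t \<longrightarrow> (LBINT x. \<bar>f t x - f s x\<bar>) \<le> l * (t - s)"
    and eq_all: "\<forall>t>0. \<forall>\<theta> c. \<theta> \<in> borel_measurable borel \<longrightarrow> (\<forall>x. \<bar>\<theta> x\<bar> \<le> c) \<longrightarrow>
       (\<lambda>s. indicator {0..<t} s * weak \<theta> (f s)) \<in> borel_measurable borel \<and>
       (LBINT x. \<theta> x * f t x) - (LBINT x. \<theta> x * u x) =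
         (LBINT s. indicator {0..<t} s * weak \<theta> (f s))"
    by (elim exE conjE)
  have f: "\<And>t. t \<ge> 0 \<Longrightarrow> size_dist a b (f t)" using f_all by simp
  have lip: "\<And>s t. 0 \<le> s \<Longrightarrow> s \<le> t \<Longrightarrow> (LBINT x. \<bar>f t x - f s x\<bar>) \<le> l * (t - s)"
    using lip_all by simp
  have um[measurable]: "u \<in> borel_measurable borel" using u by (auto simp: size_dist_def)
  have moments: "moment 0 fin = a" "moment 1 fin = b"
  proof -
    have "moment \<mu> fin = moment \<mu> u" for \<mu>
      unfolding moment_def
    proof (rule half_line_cong(1)[OF borel_half_line])
      show "AE x in half_line. x powr \<mu> * fin x = x powr \<mu> * u x" using u_ae by eventually_elim simp
    qed measurable
    then show "moment 0 fin = a" "moment 1 fin = b"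
      using size_dist_L1w(3,4)[OF u] by (simp_all add: a_def b_def)
  qed
  have weak_eq: "(LINT x|half_line. \<theta> x * (f t x - fin x)) =
              1 / 2 * (LINT s|lebesgue_on {0<..<t}. LINT x|half_line. LINT y|half_line.
                          tilde \<theta> x y * K x y * f s x * f s y)" if t: "t > 0" and \<theta>: "\<theta> \<in> Linf" for t \<theta>
  proof -
    from Linf_borel_version[OF \<theta>] obtain \<eta> c where \<eta>[measurable]: "\<eta> \<in> borel_measurable borel"
      and bd: "\<And>x. \<bar>\<eta> x\<bar> \<le> c" and \<eta>ae: "AE x in half_line. \<theta> x = \<eta> x" by blast
    have wm[measurable]: "(\<lambda>s. indicator {0..<t} s * weak \<eta> (f s)) \<in> borel_measurable borel"
      and eq: "(LBINT x. \<eta> x * f t x) - (LBINT x. \<eta> x * u x) = (LBINT s. indicator {0..<t} s * weak \<eta> (f s))"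
      using eq_all[rule_format, OF t \<eta> bd] by (rule conjunct1, rule conjunct2)
    have ft: "size_dist a b (f t)" using f t by simp
    have ftm[measurable]: "f t \<in> borel_measurable borel" and fi: "integrable lborel (f t)" "\<And>x. 0 \<le> f t x"
      "\<And>x. x \<le> 0 \<Longrightarrow> f t x = 0"
      using ft by (auto simp: size_dist_def)
    have ui: "integrable lborel u" "\<And>x. 0 \<le> u x" "\<And>x. x \<le> 0 \<Longrightarrow> u x = 0"
      using u by (auto simp: size_dist_def)
    have "(LINT x|half_line. \<theta> x * (f t x - fin x)) = (LINT x|half_line. \<eta> x * (f t x - u x))"
    proof (rule half_line_cong(1)[OF borel_half_line])
      show "AE x in half_line. \<theta> x * (f t x - fin x) = \<eta> x * (f t x - u x)"
        using \<eta>ae u_ae by eventually_elim simp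
    qed measurable
    also have "\<dots> = (LBINT x. \<eta> x * (f t x - u x))"
      by (rule half_line_vanishing(2)) (use fi ui in auto)
    also have "\<dots> = (LBINT x. \<eta> x * f t x - \<eta> x * u x)" by (simp add: right_diff_distrib)
    also have "\<dots> = (LBINT x. \<eta> x * f t x) - (LBINT x. \<eta> x * u x)"
      by (rule Bochner_Integration.integral_diff)
         (rule bounded_weight_le(1)[OF fi(1,2) \<eta> bd] bounded_weight_le(1)[OF ui(1,2) \<eta> bd])+
    also have "\<dots> = (LBINT s. indicator {0..<t} s * weak \<eta> (f s))" by (rule eq)
    also have "\<dots> = 1 / 2 * (LINT s|lebesgue_on {0<..<t}. LINT x|half_line. LINT y|half_line.
                          tilde \<theta> x y * K x y * f s x * f s y)"
    proof -
      have inner: "(LINT x|half_line. LINT y|half_line. tilde \<theta> x y * K x y * f s x * f s y) = 2 * weak \<eta> (f s)"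
        if s: "s \<in> {0<..<t}" for s
      proof -
        have "size_dist a b (f s)" using f s by simp
        then have [measurable]: "f s \<in> borel_measurable borel" and z: "\<And>x. x \<le> 0 \<Longrightarrow> f s x = 0"
          by (auto simp: size_dist_def)
        let ?F = "\<lambda>x y. tilde \<eta> x y * K' x y * f s x * f s y"
        have Fm[measurable]: "?F x \<in> borel_measurable borel" for x unfolding tilde_def by measurable
        have "(\<lambda>x. LBINT y. ?F x y) \<in> borel_measurable lborel" unfolding tilde_def by measurable
        then have Gm: "(\<lambda>x. LBINT y. ?F x y) \<in> borel_measurable borel" by simp
        have "(LINT x|half_line. LINT y|half_line. tilde \<theta> x y * K x y * f s x * f s y) = (LINT x|half_line. (LBINT y. ?F x y))"
        proof (rule half_line_cong(1)[OF borel_half_line[OF Gm]])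
          have "AE x in half_line. AE y in half_line. K x y = K' x y"
          proof (rule AE_half_lineI)
            show "AE x in lborel. x > 0 \<longrightarrow> (AE y in half_line. K x y = K' x y)"
              using K'ae
            proof eventually_elim
              case (elim x)
              show ?case
              proof
                assume "x > 0"
                then show "AE y in half_line. K x y = K' x y"
                  using elim by (intro AE_half_lineI) (auto elim: eventually_mono)
              qed
            qed
          qed
          then show "AE x in half_line. (LINT y|half_line. tilde \<theta> x y * K x y * f s x * f s y) = (LBINT y. ?F x y)"
            using tilde_AE[OF \<eta>ae]
          proof eventually_elim
            case (elim x)
            have "(LINT y|half_line. tilde \<theta> x y * K x y * f s x * f s y) = (LINT y|half_line. ?F x y)"
            proof (rule half_line_cong(1)[OF borel_half_line[OF Fm]])
              show "AE y in half_line. tilde \<theta> x y * K x y * f s x * f s y = ?F x y"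
                using elim by eventually_elim simp
            qed
            also have "\<dots> = (LBINT y. ?F x y)" by (rule half_line_vanishing(2)[OF Fm]) (simp add: z)
            finally show ?case .
          qed
        qed
        also have "\<dots> = (LBINT x. LBINT y. ?F x y)"
          by (rule half_line_vanishing(2)[OF Gm]) (simp add: z)
        finally show ?thesis by (simp add: weak_def)
      qed
      have "(LINT s|lebesgue_on {0<..<t}. LINT x|half_line. LINT y|half_line. tilde \<theta> x y * K x y * f s x * f s y)
          = (LINT s|lebesgue_on {0<..<t}. 2 * weak \<eta> (f s))"
        by (intro Bochner_Integration.integral_cong refl inner) simp
      also have "\<dots> = (\<integral>s. indicator {0<..<t} s * (2 * weak \<eta> (f s)) \<partial>lebesgue)"
        by (subst integral_restrict_space) auto
      also have "\<dots> = (\<integral>s. indicator {0<..} s * (2 * (indicator {0..<t} s * weak \<eta> (f s))) \<partial>lebesgue)"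
        by (intro Bochner_Integration.integral_cong) (auto simp: indicator_def)
      also have "\<dots> = (LBINT s. indicator {0<..} s * (2 * (indicator {0..<t} s * weak \<eta> (f s))))"
        by (intro integral_completion) measurable
      also have "\<dots> = (LBINT s. 2 * (indicator {0..<t} s * weak \<eta> (f s)))"
      proof (rule integral_cong_AE)
        have "AE s in lborel. s \<noteq> (0::real)" by (rule AE_lborel_singleton)
        then show "AE s in lborel. indicator {0<..} s * (2 * (indicator {0..<t} s * weak \<eta> (f s))) = 2 * (indicator {0..<t} s * weak \<eta> (f s))"
          by eventually_elim (auto simp: indicator_def)
      qed measurable
      finally show ?thesis by simp
    qed
    finally show ?thesis .
  qed
  show ?thesis
  proof (intro exI[of _ f] conjI allI impI ballI IntI)
    show "f \<in> C_L1" by (rule C_L1_if_lipschitz[OF f l lip])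
    show "f \<in> Linf_L1w 1" by (rule Linf_L1w_if_lipschitz[OF f l lip])
    show "moment 0 (f t) \<le> moment 0 fin" if "t \<ge> 0" for t
      using f[OF that] size_dist_L1w(3)[OF f[OF that]] moments by (auto simp: size_dist_def)
    show "moment 1 (f t) \<le> moment 1 fin" if "t \<ge> 0" for t
      using f[OF that] size_dist_L1w(4)[OF f[OF that]] moments by (auto simp: size_dist_def)
    show "f t \<in> L1w 1" if "t \<ge> 0" for t by (rule size_dist_L1w(2)[OF f[OF that]])
    show "AE x in half_line. 0 \<le> f t x" if "t \<ge> 0" for t using f[OF that] by (auto simp: size_dist_def)
  qed (rule weak_eq)
qed

end
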